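(* Let $P$ be a polymatroid with lattice of flats $L$ and building set $\mathcal G$. If $\hat 1\in\mathcal G$, then the algebra $\mathrm{DP}(P,\mathcal G)$ is a Poincaré duality algebra of dimension $\mathrm{cd}(\hat 1)-1$. More generally, for an arbitrary building set $\mathcal G$, $\mathrm{DP}(P,\mathcal G)$ is a Poincaré duality algebra of dimension $\mathrm{cd}(\hat 1)-|F(P,\mathcal G,\hat 1)|$.
   Context: A polymatroid $P=(E,\mathrm{cd})$ is a finite set $E$ with a function $\mathrm{cd}\colon 2^E\to\mathbb N$ such that $\mathrm{cd}(\emptyset)=0$, $\mathrm{cd}(A)\le \mathrm{cd}(B)$ if $A\subseteq B$, and $\mathrm{cd}(A\cup B)+\mathrm{cd}(A\cap B)\le \mathrm{cd}(A)+\mathrm{cd}(B)$. The closure of $A\subseteq E$ is $\{a\in E: \mathrm{cd}(A\cup\{a\})=\mathrm{cd}(A)\}$; a flat is a closed set; the flats ordered by inclusion form a lattice $L$ with minimum $\hat 0$ and maximum $\hat 1$. For $X\subseteq L$, $\max(X)$ is the set of maximal elements, $X_{<g}=\{x\in X: x<g\}$, $\bigvee X$ is the join ($\bigvee\emptyset=\hat 0$). $\mathcal G\subseteq L\setminus\{\hat 0\}$ is a (geometric) building set if for every $x\in L$, with $F(P,\mathcal G,x)=\max\{y\in\mathcal G: y\le x\}$ (the set of $\mathcal G$-factors of $x$), the map $\prod_{y\in F(P,\mathcal G,x)}[\hat 0,y]\to[\hat 0,x]$, $(z_y)_y\mapsto\bigvee_y z_y$, is an isomorphism of lattices and $\mathrm{cd}(x)=\sum_{y\in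 F(P,\mathcal G,x)}\mathrm{cd}(y)$. The Chow ring $\mathrm{DP}(P,\mathcal G)$ is the graded $\mathbb Q$-algebra $\mathbb Q[x_g\mid g\in\mathcal G]$ (each $x_g$ in degree $1$) modulo the relations $\prod_{s\in S}x_s\cdot c_g^{\,b}=0$ for all $S\subseteq\mathcal G$, $g\in\mathcal G$, $b\ge\mathrm{cd}(g)-\mathrm{cd}(\bigvee S_{<g})$, where $c_g=\sum_{h\in\mathcal G,\,h\ge g}x_h$. A graded $\mathbb Q$-algebra $A$ is a Poincaré duality algebra of dimension $n$ if $n$ is its top nonzero degree, there is an isomorphism $\deg\colon A^n\to\mathbb Q$, and for all $k$ the pairing $A^k\times A^{n-k}\to\mathbb Q$, $(a,b)\mapsto\deg(ab)$, is non-degenerate. *)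

theory Defs
  imports
    "HOL-Algebra.Algebra"
    "HOL-Algebra.Algebraic_Closure_Type"
    "HOL-Library.Poly_Mapping"
begin

section \<open>Polymatroids and their lattices of flats\<close>

locale polymatroid =
  fixes E :: "'a set" and cd :: "'a set \<Rightarrow> nat"
  assumes finite_ground: "finite E"
    and cd_empty: "cd {} = 0"
    and cd_mono: "\<lbrakk>A \<subseteq> B; B \<subseteq> E\<rbrakk> \<Longrightarrow> cd A \<le> cd B"
    and cd_submodular: "\<lbrakk>A \<subseteq> E; B \<subseteq> E\<rbrakk> \<Longrightarrow> cd (A \<union> B) + cd (A \<inter> B) \<le> cd A + cd B"

definition pm_closure :: "'a set \<Rightarrow> ('a set \<Rightarrow> nat) \<Rightarrow> 'a set \<Rightarrow> 'a set" where
  "pm_closure E cd A = {a \<in> E. cd (A \<union> {a}) = cd A}"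

definition flats :: "'a set \<Rightarrow> ('a set \<Rightarrow> nat) \<Rightarrow> 'a set set" where
  "flats E cd = {A. A \<subseteq> E \<and> pm_closure E cd A = A}"

definition flat_lattice :: "'a set \<Rightarrow> ('a set \<Rightarrow> nat) \<Rightarrow> 'a set gorder" where
  "flat_lattice E cd = \<lparr>carrier = flats E cd, eq = (=), le = (\<subseteq>)\<rparr>"


section \<open>Building sets\<close>

definition interval_order :: "('a, 'm) gorder_scheme \<Rightarrow> 'a \<Rightarrow> 'a \<Rightarrow> ('a, 'm) gorder_scheme" where
  "interval_order L a b = L\<lparr>carrier := \<lbrace>a..b\<rbrace>\<^bsub>L\<^esub>\<rparr>"

definition product_order ::
    "'i set \<Rightarrow> ('i \<Rightarrow> ('a, 'm) gorder_scheme) \<Rightarrow> ('i \<Rightarrow> 'a) gorder" where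
  "product_order I M =
     \<lparr>carrier = (\<Pi>\<^sub>E i\<in>I. carrier (M i)), eq = (=),
      le = (\<lambda>f g. \<forall>i\<in>I. f i \<sqsubseteq>\<^bsub>M i\<^esub> g i)\<rparr>"

definition lattice_iso ::
    "('a, 'm) gorder_scheme \<Rightarrow> ('b, 'n) gorder_scheme \<Rightarrow> ('a \<Rightarrow> 'b) \<Rightarrow> bool" where
  "lattice_iso L M f \<longleftrightarrow>
     bij_betw f (carrier L) (carrier M) \<and> join_pres L M f \<and> meet_pres L M f"

definition max_elements :: "('a, 'm) gorder_scheme \<Rightarrow> 'a set \<Rightarrow> 'a set" where
  "max_elements L A = {x \<in> A. \<not> (\<exists>y\<in>A. x \<sqsubset>\<^bsub>L\<^esub> y)}"

definition bs_factors :: "'a set \<Rightarrow> ('a set \<Rightarrow> nat) \<Rightarrow> 'a set set \<Rightarrow> 'a set \<Rightarrow> 'a set set" where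
  "bs_factors E cd G x =
     max_elements (flat_lattice E cd) {y \<in> G. y \<sqsubseteq>\<^bsub>flat_lattice E cd\<^esub> x}"

definition building_set :: "'a set \<Rightarrow> ('a set \<Rightarrow> nat) \<Rightarrow> 'a set set \<Rightarrow> bool" where
  "building_set E cd G \<longleftrightarrow>
     (let L = flat_lattice E cd in
       G \<subseteq> carrier L - {\<bottom>\<^bsub>L\<^esub>} \<and>
       (\<forall>x \<in> carrier L.
          lattice_iso
            (product_order (bs_factors E cd G x) (\<lambda>y. interval_order L \<bottom>\<^bsub>L\<^esub> y))
            (interval_order L \<bottom>\<^bsub>L\<^esub> x)
            (\<lambda>z. \<Squnion>\<^bsub>L\<^esub> (z ` bs_factors E cd G x)) \<and>
          cd x = (\<Sum>y \<in> bs_factors E cd G x. cd y)))"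


section \<open>The Chow ring\<close>

text \<open>A polynomial in commuting variables indexed by \<open>'v\<close> is a finitely supported map from
  monomials (exponent vectors \<open>'v \<Rightarrow>\<^sub>0 nat\<close>) to coefficients; multiplication on this type is
  convolution, i.e. polynomial multiplication.\<close>

type_synonym 'v rat_mpoly = "('v \<Rightarrow>\<^sub>0 nat) \<Rightarrow>\<^sub>0 rat"

definition mvar :: "'v \<Rightarrow> 'v rat_mpoly" where
  "mvar v = Poly_Mapping.single (Poly_Mapping.single v 1) 1"

definition mconst :: "rat \<Rightarrow> 'v rat_mpoly" where
  "mconst q = Poly_Mapping.single 0 q"

definition mon_degree :: "('v \<Rightarrow>\<^sub>0 nat) \<Rightarrow> nat" where
  "mon_degree m = (\<Sum>v \<in> Poly_Mapping.keys m. Poly_Mapping.lookup m v)"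

definition mpoly_ring :: "'v set \<Rightarrow> 'v rat_mpoly ring" where
  "mpoly_ring V =
     ring_of_type_algebra\<lparr>carrier := {p. \<forall>m \<in> Poly_Mapping.keys p. Poly_Mapping.keys m \<subseteq> V}\<rparr>"

definition homogeneous_polys :: "'v set \<Rightarrow> nat \<Rightarrow> 'v rat_mpoly set" where
  "homogeneous_polys V k =
     {p \<in> carrier (mpoly_ring V). \<forall>m \<in> Poly_Mapping.keys p. mon_degree m = k}"

definition chow_c :: "'a set \<Rightarrow> ('a set \<Rightarrow> nat) \<Rightarrow> 'a set set \<Rightarrow> 'a set \<Rightarrow> 'a set rat_mpoly" where
  "chow_c E cd G g = (\<Sum>h \<in> {h \<in> G. g \<sqsubseteq>\<^bsub>flat_lattice E cd\<^esub> h}. mvar h)"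

text \<open>The bound \<open>b \<ge> cd g - cd (join of the elements of S below g)\<close> is stated additively, avoiding
  truncated subtraction.\<close>

definition chow_relations ::
    "'a set \<Rightarrow> ('a set \<Rightarrow> nat) \<Rightarrow> 'a set set \<Rightarrow> 'a set rat_mpoly set" where
  "chow_relations E cd G =
     (let L = flat_lattice E cd in
       {(\<Prod>s\<in>S. mvar s) * chow_c E cd G g ^ b | S g b.
          S \<subseteq> G \<and> g \<in> G \<and> cd g \<le> b + cd (\<Squnion>\<^bsub>L\<^esub> {s \<in> S. s \<sqsubset>\<^bsub>L\<^esub> g})})"

definition chow_ideal ::
    "'a set \<Rightarrow> ('a set \<Rightarrow> nat) \<Rightarrow> 'a set set \<Rightarrow> 'a set rat_mpoly set" where
  "chow_ideal E cd G = Idl\<^bsub>mpoly_ring G\<^esub> (chow_relations E cd G)"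

definition chow_ring ::
    "'a set \<Rightarrow> ('a set \<Rightarrow> nat) \<Rightarrow> 'a set set \<Rightarrow> (rat, 'a set rat_mpoly set) module" where
  "chow_ring E cd G =
     (let R = mpoly_ring G; I = chow_ideal E cd G; A = R Quot I in
       \<lparr>carrier = carrier A, monoid.mult = monoid.mult A, one = one A,
        ring.zero = ring.zero A, ring.add = ring.add A,
        module.smult = (\<lambda>q a. (I +>\<^bsub>R\<^esub> mconst q) \<otimes>\<^bsub>A\<^esub> a)\<rparr>)"

definition chow_grading ::
    "'a set \<Rightarrow> ('a set \<Rightarrow> nat) \<Rightarrow> 'a set set \<Rightarrow> nat \<Rightarrow> 'a set rat_mpoly set set" where
  "chow_grading E cd G k =
     (\<lambda>p. chow_ideal E cd G +>\<^bsub>mpoly_ring G\<^esub> p) ` homogeneous_polys G k"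


section \<open>Poincare duality algebras\<close>

abbreviation rat_field :: "rat ring" where
  "rat_field \<equiv> ring_of_type_algebra"

text \<open>The last condition says that the algebra is the internal direct sum of its graded pieces.\<close>

definition graded_algebra ::
    "('k, 'r) ring_scheme \<Rightarrow> ('k, 'b, 'm) module_scheme \<Rightarrow> (nat \<Rightarrow> 'b set) \<Rightarrow> bool" where
  "graded_algebra K A gr \<longleftrightarrow>
     algebra K A \<and>
     (\<forall>k. submodule (gr k) K A) \<and>
     \<one>\<^bsub>A\<^esub> \<in> gr 0 \<and>
     (\<forall>i j. \<forall>a \<in> gr i. \<forall>b \<in> gr j. a \<otimes>\<^bsub>A\<^esub> b \<in> gr (i + j)) \<and>
     (\<forall>a \<in> carrier A. \<exists>!f. (\<forall>k. f k \<in> gr k) \<and> finite {k. f k \<noteq> \<zero>\<^bsub>A\<^esub>} \<and>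
        a = (\<Oplus>\<^bsub>A\<^esub>k \<in> {k. f k \<noteq> \<zero>\<^bsub>A\<^esub>}. f k))"

definition poincare_duality_algebra ::
    "(rat, 'b, 'm) module_scheme \<Rightarrow> (nat \<Rightarrow> 'b set) \<Rightarrow> nat \<Rightarrow> bool" where
  "poincare_duality_algebra A gr n \<longleftrightarrow>
     graded_algebra rat_field A gr \<and>
     gr n \<noteq> {\<zero>\<^bsub>A\<^esub>} \<and> (\<forall>k>n. gr k = {\<zero>\<^bsub>A\<^esub>}) \<and>
     (\<exists>deg :: 'b \<Rightarrow> rat.
        bij_betw deg (gr n) UNIV \<and>
        (\<forall>a \<in> gr n. \<forall>b \<in> gr n. deg (a \<oplus>\<^bsub>A\<^esub> b) = deg a + deg b) \<and>
        (\<forall>q. \<forall>a \<in> gr n. deg (q \<odot>\<^bsub>A\<^esub> a) = q * deg a) \<and>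
        (\<forall>k\<le>n.
           (\<forall>a \<in> gr k. (\<forall>b \<in> gr (n - k). deg (a \<otimes>\<^bsub>A\<^esub> b) = 0) \<longrightarrow> a = \<zero>\<^bsub>A\<^esub>) \<and>
           (\<forall>b \<in> gr (n - k). (\<forall>a \<in> gr k. deg (a \<otimes>\<^bsub>A\<^esub> b) = 0) \<longrightarrow> b = \<zero>\<^bsub>A\<^esub>)))"

end

theory Submission
  imports Defs
begin

text \<open>
  The ring is generated by the classes \<open>c\<^sub>g\<close>, which in the realizable case are pulled back
  hyperplane classes of the linear projections \<open>P(V) \<rightarrow> P(V\<^sub>g)\<close>.
  The degree of a product of such classes is therefore \<open>1\<close> or \<open>0\<close>
  according to the dragon Hall--Rado condition: fewer than \<open>cd K\<close> factors lie below every
  nonzero flat \<open>K\<close>. Extended linearly, this rule defines a functional \<open>D\<close>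
  on all polynomials. For an antichain \<open>S\<close> below some \<open>g\<close>, Moebius
  inversion gives \<open>D(x\<^sub>S c\<^sub>M)\<close> explicitly: it is \<open>\<plusminus>1\<close>
  or \<open>0\<close>, depending on which flats are tight for \<open>M\<close>. From this
  formula \<open>D\<close> kills the ideal.

  The relations \<open>x\<^sub>S c\<^sub>g\<^sup>b = 0\<close> reduce every polynomial to standard
  monomials, those in which \<open>x\<^sub>g\<close> has exponent less than \<open>cd g\<close> minus
  \<open>cd\<close> of the join of the variables below \<open>g\<close>. Replacing every exponent of a
  standard monomial by its complement, and \<open>x\<^sub>g\<close> by \<open>c\<^sub>g\<close>, gives
  a dual monomial, and \<open>D\<close> pairs standard with dual monomials by a triangular matrix with
  diagonal entries \<open>\<plusminus>1\<close>. Thus linear independence and duality follow at once,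
  without a Groebner basis computation.
\<close>

section \<open>The lattice of flats\<close>

text \<open>Passing from the variables to the classes \<open>cg g\<close> is unitriangular, so
  \<open>D\<close> may be prescribed freely on monomials in the classes. The obstacle is to evaluate
  \<open>D\<close> on products that still contain variables. Rank is submodular and counting is
  supermodular, so the slack \<open>cd_gap\<close> is submodular. Hence the flats at which one more
  class would break tightness are closed under joins and, if there are any, have a largest member W.
  The new class then fails exactly when its index lies below W. By the building set axioms each
  element of G below W lies below exactly one factor of W, so the indicator of being below W is the
  upper sum of the indicator of the factors of W. The Moebius inverse is therefore explicit. The
  factors of E need separate treatment throughout: there variable and class coincide, and each of
  them lowers the top degree by one.\<close>

lemma flat_lattice_simps [simp]:
  "carrier (flat_lattice E cd) = flats E cd"
  "x \<sqsubseteq>\<^bsub>flat_lattice E cd\<^esub> y \<longleftrightarrow> x \<subseteq> y"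
  "x \<sqsubset>\<^bsub>flat_lattice E cd\<^esub> y \<longleftrightarrow> x \<subset> y"
  by (auto simp: flat_lattice_def lless_def)

context polymatroid
begin

abbreviation cl :: "'a set \<Rightarrow> 'a set" where
  "cl \<equiv> pm_closure E cd"

abbreviation Lat :: "'a set set" where
  "Lat \<equiv> flats E cd"

definition flat_join :: "'a set set \<Rightarrow> 'a set" where
  "flat_join A = cl (\<Union>A)"

text \<open>The flat of all elements of rank zero. It need not be empty, so tests for the bottom
  flat compare with \<open>flat_bot\<close>.\<close>

definition flat_bot :: "'a set" where
  "flat_bot = flat_join {}"

lemma cl_subset: "cl A \<subseteq> E"
  by (auto simp: pm_closure_def)

lemma subset_cl: "A \<subseteq> E \<Longrightarrow> A \<subseteq> cl A"
  by (auto simp: pm_closure_def insert_absorb)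

lemma cl_mono:
  assumes "A \<subseteq> B" "B \<subseteq> E"
  shows "cl A \<subseteq> cl B"
proof
  fix a assume "a \<in> cl A"
  then have a: "a \<in> E" "cd (A \<union> {a}) = cd A"
    by (auto simp: pm_closure_def)
  have "cd (B \<union> (A \<union> {a})) + cd (B \<inter> (A \<union> {a})) \<le> cd B + cd (A \<union> {a})"
    using assms a by (intro cd_submodular) auto
  moreover have "B \<union> (A \<union> {a}) = B \<union> {a}"
    using assms by auto
  moreover have "cd A \<le> cd (B \<inter> (A \<union> {a}))"
    using assms by (intro cd_mono) auto
  moreover have "cd B \<le> cd (B \<union> {a})"
    using assms a by (intro cd_mono) auto
  ultimately show "a \<in> cl B"
    using a by (auto simp: pm_closure_def)
qed

text \<open>An element of the closure adds nothing to the rank of A, hence by submodularity nothing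
  to a larger set either; the closure is adjoined one element at a time.\<close>

lemma cd_cl:
  assumes "A \<subseteq> E"
  shows "cd (cl A) = cd A"
proof -
  have *: "cd (A \<union> B) = cd A" if "finite B" "B \<subseteq> cl A" for B
    using that
  proof (induction B)
    case (insert b B)
    have b: "b \<in> E" "cd (A \<union> {b}) = cd A"
      using insert.prems by (auto simp: pm_closure_def)
    have BE: "B \<subseteq> E"
      using insert.prems cl_subset by auto
    have "cd ((A \<union> B) \<union> (A \<union> {b})) + cd ((A \<union> B) \<inter> (A \<union> {b})) \<le>
        cd (A \<union> B) + cd (A \<union> {b})"
      using assms b BE by (intro cd_submodular) auto
    moreover have "(A \<union> B) \<union> (A \<union> {b}) = A \<union> insert b B"
      by auto
    moreover have "cd A \<le> cd ((A \<union> B) \<inter> (A \<union> {b}))"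
      using assms b BE by (intro cd_mono) auto
    moreover have "cd A \<le> cd (A \<union> insert b B)"
      using assms b BE by (intro cd_mono) auto
    ultimately show ?case
      using insert b by auto
  qed auto
  have "A \<union> cl A = cl A"
    using subset_cl[OF assms] by auto
  then show ?thesis
    using *[of "cl A"] finite_subset[OF cl_subset finite_ground] by simp
qed

lemma cl_cl:
  assumes "A \<subseteq> E"
  shows "cl (cl A) = cl A"
proof
  show "cl A \<subseteq> cl (cl A)"
    using cl_subset subset_cl by blast
  show "cl (cl A) \<subseteq> cl A"
  proof
    fix a assume "a \<in> cl (cl A)"
    then have a: "a \<in> E" "cd (cl A \<union> {a}) = cd A"
      using cd_cl[OF assms] by (auto simp: pm_closure_def)
    have "cd (A \<union> {a}) \<le> cd (cl A \<union> {a})"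
      using cl_subset subset_cl[OF assms] a by (intro cd_mono) auto
    moreover have "cd A \<le> cd (A \<union> {a})"
      using assms a by (intro cd_mono) auto
    ultimately show "a \<in> cl A"
      using a by (auto simp: pm_closure_def)
  qed
qed

lemma Lat_subset: "K \<in> Lat \<Longrightarrow> K \<subseteq> E"
  by (auto simp: flats_def)

lemma cl_Lat: "A \<subseteq> E \<Longrightarrow> cl A \<in> Lat"
  by (simp add: flats_def cl_subset cl_cl)

lemma cl_least: "A \<subseteq> K \<Longrightarrow> K \<in> Lat \<Longrightarrow> cl A \<subseteq> K"
  using cl_mono[of A K] by (auto simp: flats_def)

lemma finite_Lat: "finite Lat"
  by (rule finite_subset[of _ "Pow E"]) (auto simp: flats_def finite_ground)

lemma Int_Lat: "K \<in> Lat \<Longrightarrow> K' \<in> Lat \<Longrightarrow> K \<inter> K' \<in> Lat"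
  using cl_least[of "K \<inter> K'" K] cl_least[of "K \<inter> K'" K'] subset_cl[of "K \<inter> K'"]
  by (auto simp: flats_def)

lemma E_Lat: "E \<in> Lat"
  using subset_cl cl_subset by (auto simp: flats_def)

lemma flat_join_Lat: "A \<subseteq> Lat \<Longrightarrow> flat_join A \<in> Lat"
  unfolding flat_join_def by (rule cl_Lat) (auto dest: Lat_subset)

lemma flat_join_upper:
  assumes "A \<subseteq> Lat" "a \<in> A"
  shows "a \<subseteq> flat_join A"
proof -
  have "\<Union>A \<subseteq> E"
    using assms Lat_subset by auto
  then show ?thesis
    using subset_cl assms unfolding flat_join_def by blast
qed

lemma flat_join_least: "(\<And>a. a \<in> A \<Longrightarrow> a \<subseteq> K) \<Longrightarrow>
    K \<in> Lat \<Longrightarrow> flat_join A \<subseteq> K"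
  unfolding flat_join_def by (rule cl_least) auto

lemma flat_join_mono:
  assumes "A \<subseteq> B" "B \<subseteq> Lat"
  shows "flat_join A \<subseteq> flat_join B"
  using flat_join_upper[OF assms(2)] assms by (intro flat_join_least flat_join_Lat) auto

lemma flat_join_eqI:
  "A \<subseteq> Lat \<Longrightarrow> K \<in> Lat \<Longrightarrow> (\<And>a. a \<in> A \<Longrightarrow>
      a \<subseteq> K) \<Longrightarrow> K \<subseteq> flat_join A \<Longrightarrow> flat_join A = K"
  using flat_join_least[of A K] by auto

lemma flat_join_single: "K \<in> Lat \<Longrightarrow> flat_join {K} = K"
  using flat_join_upper[of "{K}" K] by (intro flat_join_eqI) auto

lemma flat_bot_Lat: "flat_bot \<in> Lat"
  unfolding flat_bot_def by (rule flat_join_Lat) simp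

lemma flat_bot_least: "K \<in> Lat \<Longrightarrow> flat_bot \<subseteq> K"
  unfolding flat_bot_def by (rule flat_join_least) auto

lemma cd_zer: "cd flat_bot = 0"
  unfolding flat_bot_def flat_join_def using cd_cl[of "{}"] cd_empty by simp

lemma cd_strict:
  assumes "K \<subset> K'" "K \<in> Lat" "K' \<in> Lat"
  shows "cd K < cd K'"
proof -
  obtain a where a: "a \<in> K'" "a \<notin> K"
    using assms by auto
  have "K' \<subseteq> E"
    using assms Lat_subset by auto
  then have "cd (K \<union> {a}) \<le> cd K'" "cd K \<le> cd (K \<union> {a})"
    using assms a by (auto intro!: cd_mono)
  moreover have "cd (K \<union> {a}) \<noteq> cd K"
    using assms a \<open>K' \<subseteq> E\<close> by (auto simp: flats_def pm_closure_def)
  ultimately show ?thesis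
    by simp
qed

lemma cd_le: "K \<subseteq> K' \<Longrightarrow> K' \<in> Lat \<Longrightarrow> cd K \<le> cd K'"
  using cd_mono Lat_subset by auto

lemma cd_eqD: "K \<subseteq> K' \<Longrightarrow> K \<in> Lat \<Longrightarrow> K' \<in> Lat \<Longrightarrow>
    cd K' \<le> cd K \<Longrightarrow> K = K'"
  using cd_strict[of K K'] by force

lemma cd_pos: "K \<in> Lat \<Longrightarrow> K \<noteq> flat_bot \<Longrightarrow> 0 < cd K"
  using cd_strict[of flat_bot K] flat_bot_least[of K] flat_bot_Lat by (cases "flat_bot \<subset> K") auto

lemma flat_join2_Lat: "K \<in> Lat \<Longrightarrow> K' \<in> Lat \<Longrightarrow> flat_join {K, K'} \<in> Lat"
  by (rule flat_join_Lat) auto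

lemma flat_join2_upper: "K \<in> Lat \<Longrightarrow> K' \<in> Lat \<Longrightarrow>
    K \<subseteq> flat_join {K, K'}" "K \<in> Lat \<Longrightarrow> K' \<in> Lat \<Longrightarrow> K' \<subseteq> flat_join {K, K'}"
  using flat_join_upper[of "{K,K'}"] by auto

lemma cd_join2:
  assumes "K \<in> Lat" "K' \<in> Lat"
  shows "cd (flat_join {K, K'}) + cd (K \<inter> K') \<le> cd K + cd K'"
  using cd_submodular[of K K'] cd_cl[of "K \<union> K'"] assms Lat_subset
  by (simp add: flat_join_def)

section \<open>Joins and extreme elements in the order structure\<close>

lemma least_unique:
  assumes "least (flat_lattice E cd) x A" "least (flat_lattice E cd) y A"
  shows "x = y"
  using assms by (auto simp: least_def)

lemma sup_flat_lattice:
  assumes "A \<subseteq> Lat"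
  shows "\<Squnion>\<^bsub>flat_lattice E cd\<^esub> A = flat_join A"
proof -
  have "least (flat_lattice E cd) (flat_join A) (Upper (flat_lattice E cd) A)"
    unfolding least_def Upper_def flat_lattice_simps
  proof (intro conjI ballI)
    show "flat_join A \<in> {u. \<forall>x. x \<in> A \<inter> Lat \<longrightarrow> x \<subseteq> u} \<inter> Lat"
      using flat_join_upper[OF assms] flat_join_Lat[OF assms] by blast
    show "flat_join A \<subseteq> x" if "x \<in> {u. \<forall>x. x \<in> A \<inter> Lat \<longrightarrow> x
        \<subseteq> u} \<inter> Lat" for x
      using that assms by (intro flat_join_least) blast+
  qed auto
  then show ?thesis
    unfolding sup_def using least_unique by (metis someI_ex)
qed

lemma bottom_flat_lattice: "\<bottom>\<^bsub>flat_lattice E cd\<^esub> = flat_bot"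
proof -
  have "least (flat_lattice E cd) flat_bot (carrier (flat_lattice E cd))"
    by (auto simp: least_def flat_bot_Lat dest: flat_bot_least)
  then show ?thesis
    unfolding bottom_def using least_unique by (metis someI_ex)
qed

lemma top_flat_lattice: "\<top>\<^bsub>flat_lattice E cd\<^esub> = E"
proof -
  have "greatest (flat_lattice E cd) E (carrier (flat_lattice E cd))"
    by (auto simp: greatest_def E_Lat dest: Lat_subset)
  moreover have "x = y" if "greatest (flat_lattice E cd) x A" "greatest (flat_lattice E cd) y A" for x y A
    using that by (auto simp: greatest_def)
  ultimately show ?thesis
    unfolding top_def by (metis someI_ex)
qed

end

section \<open>Factors of a building set\<close>

locale polymatroid_building = polymatroid +
  fixes G :: "'a set set"
  assumes building: "building_set E cd G"
begin

abbreviation fac :: "'a set \<Rightarrow> 'a set set" where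
  "fac \<equiv> bs_factors E cd G"

lemma fac_eq: "fac x = {y \<in> G. y \<subseteq> x \<and> (\<forall>z\<in>G. z \<subseteq> x \<longrightarrow>
    \<not> y \<subset> z)}"
  by (auto simp: bs_factors_def max_elements_def)

lemma facI:
  assumes "y \<in> G" "y \<subseteq> x" "\<And>z. z \<in> G \<Longrightarrow> z \<subseteq> x \<Longrightarrow>
      y \<subseteq> z \<Longrightarrow> z = y"
  shows "y \<in> fac x"
  unfolding fac_eq using assms(1,2) assms(3) by fast

lemma fac_maximal: "y \<in> fac x \<Longrightarrow> z \<in> G \<Longrightarrow>
    z \<subseteq> x \<Longrightarrow> y \<subseteq> z \<Longrightarrow> z = y"
  by (auto simp: fac_eq)

lemma G_Lat: "g \<in> G \<Longrightarrow> g \<in> Lat"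
  using building by (auto simp: building_set_def Let_def)

lemma G_sub_Lat: "G \<subseteq> Lat"
  using G_Lat by auto

lemma finite_G: "finite G"
  using finite_subset[OF G_sub_Lat finite_Lat] .

lemma G_nonzer: "g \<in> G \<Longrightarrow> g \<noteq> flat_bot"
  using building by (auto simp: building_set_def Let_def bottom_flat_lattice)

lemma G_cd_pos: "g \<in> G \<Longrightarrow> 0 < cd g"
  using cd_pos G_Lat G_nonzer by auto

lemma fac_G: "fac x \<subseteq> G"
  by (auto simp: fac_eq)

lemma fac_in_G: "y \<in> fac x \<Longrightarrow> y \<in> G"
  using fac_G by auto

lemma fac_Lat: "y \<in> fac x \<Longrightarrow> y \<in> Lat"
  using fac_G G_Lat by auto

lemma fac_le: "y \<in> fac x \<Longrightarrow> y \<subseteq> x"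
  by (auto simp: fac_eq)

lemma finite_fac [simp]: "finite (fac x)"
  using finite_subset[OF fac_G finite_G] .

lemma G_not_le_zer: "g \<in> G \<Longrightarrow> \<not> g \<subseteq> flat_bot"
  using flat_bot_least[OF G_Lat] G_nonzer by blast

lemma fac_zer: "fac flat_bot = {}"
  using G_not_le_zer by (auto simp: fac_eq)

lemma fac_self: "g \<in> G \<Longrightarrow> fac g = {g}"
  by (auto simp: fac_eq)

lemma factor_above:
  assumes "g \<in> G" "g \<subseteq> x"
  obtains y where "y \<in> fac x" "g \<subseteq> y"
proof -
  have "finite {h \<in> G. g \<subseteq> h \<and> h \<subseteq> x}" "{h \<in> G. g \<subseteq> h \<and> h
      \<subseteq> x} \<noteq> {}"
    using finite_G assms by auto
  then obtain y where "y \<in> {h \<in> G. g \<subseteq> h \<and> h \<subseteq> x}"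
     "\<forall>h\<in>{h \<in> G. g \<subseteq> h \<and> h \<subseteq> x}. y \<subseteq> h \<longrightarrow> y = h"
    using finite_has_maximal by (metis (no_types, lifting))
  then have "y \<in> fac x" "g \<subseteq> y"
    unfolding fac_eq by blast+
  then show ?thesis
    using that by blast
qed

lemma cd_fac: "x \<in> Lat \<Longrightarrow> cd x = (\<Sum>y\<in>fac x. cd y)"
  using building by (auto simp: building_set_def Let_def)

abbreviation below :: "'a set \<Rightarrow> 'a set set" where
  "below y \<equiv> {w \<in> Lat. w \<subseteq> y}"

text \<open>Surjectivity decomposes a flat below x into its traces on the factors; injectivity
  recovers the coordinates of a join.\<close>

lemma bij_fac:
  assumes "x \<in> Lat"
  shows "bij_betw (\<lambda>z. flat_join (z ` fac x)) (PiE (fac x) below) (below x)"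
proof -
  have eq: "carrier (interval_order (flat_lattice E cd) flat_bot y) = below y" for y
    using flat_bot_least by (auto simp: interval_order_def at_least_at_most_def)
  have "lattice_iso
            (product_order (fac x) (\<lambda>y. interval_order (flat_lattice E cd) flat_bot y))
            (interval_order (flat_lattice E cd) flat_bot x)
            (\<lambda>z. \<Squnion>\<^bsub>flat_lattice E cd\<^esub> (z ` fac x))"
    using building assms by (auto simp: building_set_def Let_def bottom_flat_lattice)
  then have "bij_betw (\<lambda>z. \<Squnion>\<^bsub>flat_lattice E cd\<^esub> (z ` fac x))
     (PiE (fac x) below) (below x)"
    unfolding lattice_iso_def eq[symmetric] by (simp add: product_order_def)
  moreover have "\<Squnion>\<^bsub>flat_lattice E cd\<^esub> (z ` fac x) =
      flat_join (z ` fac x)" if "z \<in> PiE (fac x) below" for z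
    using that by (intro sup_flat_lattice) (auto dest: PiE_mem)
  ultimately show ?thesis
    by (subst (asm) bij_betw_cong) auto
qed

text \<open>Surjectivity writes w as a join of flats below the factors. Each of them lies in w and
  in its factor, so the join of the traces contains w.\<close>

lemma flat_join_Int_fac:
  assumes "x \<in> Lat" "w \<in> Lat" "w \<subseteq> x"
  shows "flat_join ((\<lambda>y. w \<inter> y) ` fac x) = w"
proof -
  have "w \<in> (\<lambda>z. flat_join (z ` fac x)) ` PiE (fac x) below"
    using bij_fac[OF assms(1)] assms by (auto simp: bij_betw_def)
  then obtain z where z: "z \<in> PiE (fac x) below" "w = flat_join (z ` fac x)"
    by blast
  have zL: "z ` fac x \<subseteq> Lat"
    using z by (auto dest: PiE_mem)
  have IL: "(\<lambda>y. w \<inter> y) ` fac x \<subseteq> Lat"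
    using assms by (auto intro: Int_Lat fac_Lat)
  have "z y \<subseteq> flat_join ((\<lambda>y. w \<inter> y) ` fac x)" if "y \<in> fac x" for y
  proof -
    have "z y \<subseteq> w \<inter> y"
      using flat_join_upper[OF zL, of "z y"] z that by (auto dest: PiE_mem)
    also have "\<dots> \<subseteq> flat_join ((\<lambda>y. w \<inter> y) ` fac x)"
      using that by (intro flat_join_upper[OF IL]) auto
    finally show ?thesis .
  qed
  then have "w \<subseteq> flat_join ((\<lambda>y. w \<inter> y) ` fac x)"
    unfolding z(2) by (intro flat_join_least flat_join_Lat) (use IL z in auto)
  then show ?thesis
    by (intro flat_join_eqI) (use IL assms in auto)
qed

lemma flat_join_fac: "x \<in> Lat \<Longrightarrow> flat_join (fac x) = x"
  using flat_join_Int_fac[of x x] fac_le by (simp add: Int_absorb1 cong: image_cong)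

text \<open>The family z and the traces of its join on the factors have the same join, so
  injectivity makes them equal. Restriction turns both into members of \<open>PiE\<close>.\<close>

lemma Int_join_fac:
  assumes "x \<in> Lat" "\<And>y. y \<in> fac x \<Longrightarrow>
      z y \<in> Lat" "\<And>y. y \<in> fac x \<Longrightarrow> z y \<subseteq> y" "y \<in> fac x"
  shows "flat_join (z ` fac x) \<inter> y = z y"
proof -
  let ?w = "flat_join (z ` fac x)"
  have w: "?w \<in> Lat"
    using assms by (intro flat_join_Lat) auto
  have wx: "?w \<subseteq> x"
    using assms fac_le by (intro flat_join_least) blast+
  have "flat_join (restrict z (fac x) ` fac x) = flat_join (restrict (\<lambda>y. ?w \<inter> y) (fac x) ` fac x)"
    using flat_join_Int_fac[OF assms(1) w wx] by (simp cong: image_cong)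
  moreover have "restrict z (fac x) \<in> PiE (fac x) below"
    "restrict (\<lambda>y. ?w \<inter> y) (fac x) \<in> PiE (fac x) below"
    using assms w by (auto simp: Int_Lat fac_Lat)
  ultimately have "restrict z (fac x) = restrict (\<lambda>y. ?w \<inter> y) (fac x)"
    using bij_fac[OF assms(1)] by (auto simp: bij_betw_def inj_on_def)
  then show ?thesis
    using assms(4) by (metis restrict_apply')
qed

lemma fac_disjoint:
  assumes "x \<in> Lat" "y \<in> fac x" "y' \<in> fac x" "y \<noteq> y'"
  shows "y \<inter> y' = flat_bot"
proof -
  \<comment> \<open>The join of this family has trace y on y, so it contains y, and trace
    \<open>flat_bot\<close> on \<open>y'\<close>, which bounds the intersection.\<close>
  let ?z = "\<lambda>u. if u = y then y else flat_bot"
  have *: "flat_join (?z ` fac x) \<inter> u = ?z u" if "u \<in> fac x" for u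
    using assms that by (intro Int_join_fac) (auto simp: flat_bot_Lat fac_Lat dest: flat_bot_least[OF fac_Lat])
  have "y \<inter> y' \<subseteq> flat_bot"
    using *[of y] *[of y'] assms by auto
  then show ?thesis
    using flat_bot_least[OF Int_Lat[OF fac_Lat fac_Lat]] assms by blast
qed

lemma fac_above_unique:
  assumes "x \<in> Lat" "y \<in> fac x" "y' \<in> fac x" "g \<in> G" "g \<subseteq> y" "g \<subseteq> y'"
  shows "y = y'"
  using fac_disjoint[of x y y'] G_not_le_zer[of g] assms by blast

text \<open>An element of G below the join lies below one factor y of x, hence in the trace of the
  join on y, which is \<open>z y\<close>. Maximality can thus be tested in a single
  coordinate.\<close>

lemma fac_join_sub:
  assumes "x \<in> Lat" "\<And>y. y \<in> fac x \<Longrightarrow>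
      z y \<in> Lat" "\<And>y. y \<in> fac x \<Longrightarrow> z y \<subseteq> y"
  shows "fac (flat_join (z ` fac x)) = (\<Union>y\<in>fac x. fac (z y))"
proof -
  let ?w = "flat_join (z ` fac x)"
  have zL: "z ` fac x \<subseteq> Lat"
    using assms by auto
  have w: "?w \<in> Lat"
    using zL by (rule flat_join_Lat)
  have zw: "z y \<subseteq> ?w" if "y \<in> fac x" for y
    using that by (intro flat_join_upper[OF zL]) auto
  have up: "\<exists>y\<in>fac x. g \<subseteq> z y" if g: "g \<in> G" "g \<subseteq> ?w" for g
  proof -
    have "?w \<subseteq> x"
      using assms fac_le by (intro flat_join_least) blast+
    then obtain y where y: "y \<in> fac x" "g \<subseteq> y"
      using factor_above[OF g(1) order_trans[OF g(2)]] by blast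
    then have "g \<subseteq> z y"
      using Int_join_fac[of x z y] assms g by blast
    then show ?thesis
      using y by auto
  qed
  have un: "y = y'" if "y \<in> fac x" "y' \<in> fac x" "g \<in> G" "g \<subseteq> z y" "g \<subseteq> z y'" for g y y'
    using fac_above_unique[OF assms(1) that(1,2,3)] assms(3)[OF that(1)] assms(3)[OF that(2)] that
    by blast
  show ?thesis
  proof (intro equalityI subsetI)
    fix g assume g: "g \<in> fac ?w"
    have "\<exists>y\<in>fac x. g \<subseteq> z y"
      using up[OF subsetD[OF fac_G g] fac_le[OF g]] .
    then obtain y where y: "y \<in> fac x" "g \<subseteq> z y"
      by (rule bexE)
    have "g \<in> fac (z y)"
    proof (rule facI)
      show "g \<in> G" "g \<subseteq> z y"
        using fac_G g y by auto
      show "h = g" if "h \<in> G" "h \<subseteq> z y" "g \<subseteq> h" for h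
        using fac_maximal[OF g that(1) order_trans[OF that(2) zw[OF y(1)]] that(3)] .
    qed
    then show "g \<in> (\<Union>y\<in>fac x. fac (z y))"
      using y by auto
  next
    fix g assume "g \<in> (\<Union>y\<in>fac x. fac (z y))"
    then obtain y where y: "y \<in> fac x" "g \<in> fac (z y)"
      by (rule UN_E)
    have g: "g \<in> G" "g \<subseteq> z y"
      using fac_G fac_le y by auto
    show "g \<in> fac ?w"
    proof (rule facI)
      show "g \<in> G" "g \<subseteq> ?w"
        using g zw[OF y(1)] by auto
      show "h = g" if h: "h \<in> G" "h \<subseteq> ?w" "g \<subseteq> h" for h
      proof -
        obtain y' where y': "y' \<in> fac x" "h \<subseteq> z y'"
          using up[OF h(1,2)] by (rule bexE)
        have "y = y'"
          using un[OF y(1) y'(1) g order_trans[OF h(3) y'(2)]] .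
        then show ?thesis
          using fac_maximal[OF y(2) h(1) _ h(3)] y'(2) by simp
      qed
    qed
  qed
qed

lemma cd_join_sub:
  assumes "x \<in> Lat" "\<And>y. y \<in> fac x \<Longrightarrow>
      z y \<in> Lat" "\<And>y. y \<in> fac x \<Longrightarrow> z y \<subseteq> y"
  shows "cd (flat_join (z ` fac x)) = (\<Sum>y\<in>fac x. cd (z y))"
proof -
  have "flat_join (z ` fac x) \<in> Lat"
    using assms by (intro flat_join_Lat) auto
  then have "cd (flat_join (z ` fac x)) = (\<Sum>g\<in>(\<Union>y\<in>fac x. fac (z y)). cd g)"
    using fac_join_sub[OF assms] cd_fac by simp
  also have "\<dots> = (\<Sum>y\<in>fac x. \<Sum>g\<in>fac (z y). cd g)"
  proof (rule sum.UNION_disjoint)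
    show "\<forall>i\<in>fac x. \<forall>j\<in>fac x. i \<noteq> j \<longrightarrow> fac (z i) \<inter> fac (z j) = {}"
    proof (intro ballI impI)
      fix i j assume ij: "i \<in> fac x" "j \<in> fac x" "i \<noteq> j"
      have False if g: "g \<in> fac (z i)" "g \<in> fac (z j)" for g
      proof -
        have "g \<subseteq> i" "g \<subseteq> j" "g \<in> G"
          using fac_le[OF g(1)] fac_le[OF g(2)] assms(3)[OF ij(1)] assms(3)[OF ij(2)] fac_in_G[OF g(1)]
          by auto
        then show False
          using fac_above_unique[OF assms(1) ij(1,2)] ij by blast
      qed
      then show "fac (z i) \<inter> fac (z j) = {}"
        by auto
    qed
  qed auto
  also have "\<dots> = (\<Sum>y\<in>fac x. cd (z y))"
    using assms cd_fac by (intro sum.cong) auto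
  finally show ?thesis .
qed

text \<open>Coordinates y on Y and \<open>flat_bot\<close> elsewhere have the same join as Y, and
  bottom coordinates contribute no factors.\<close>

lemma fac_join_subset:
  assumes "x \<in> Lat" "Y \<subseteq> fac x"
  shows "fac (flat_join Y) = Y"
proof -
  let ?z = "\<lambda>y. if y \<in> Y then y else flat_bot"
  have YL: "Y \<subseteq> Lat"
    using assms fac_Lat by auto
  have zL: "?z ` fac x \<subseteq> Lat"
    using fac_Lat flat_bot_Lat by auto
  have "flat_join (?z ` fac x) = flat_join Y"
  proof (rule antisym)
    show "flat_join (?z ` fac x) \<subseteq> flat_join Y"
      using YL flat_join_upper[OF YL] flat_bot_least[OF flat_join_Lat[OF YL]] by (intro flat_join_least flat_join_Lat) auto
    show "flat_join Y \<subseteq> flat_join (?z ` fac x)"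
      using assms by (intro flat_join_mono zL) (auto simp: image_iff)
  qed
  moreover have "fac (flat_join (?z ` fac x)) = (\<Union>y\<in>fac x. fac (?z y))"
    using assms by (intro fac_join_sub) (auto simp: flat_bot_Lat fac_Lat dest: flat_bot_least[OF fac_Lat])
  moreover have "(\<Union>y\<in>fac x. fac (?z y)) = Y"
  proof -
    have "fac (?z y) = (if y \<in> Y then {y} else {})" if "y \<in> fac x" for y
      using that fac_self[of y] fac_G[of x] fac_zer by (cases "y \<in> Y") auto
    then show ?thesis
      using assms(2) by auto
  qed
  ultimately show ?thesis
    by simp
qed

section \<open>Counting\<close>

definition count_below :: "'a set multiset \<Rightarrow> 'a set \<Rightarrow> nat" where
  "count_below M K = size {#g \<in># M. g \<subseteq> K#}"

lemma count_below_empty [simp]: "count_below {#} K = 0"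
  by (simp add: count_below_def)

lemma count_below_add_mset: "count_below (add_mset g M) K = count_below M K + (if g \<subseteq> K then 1 else 0)"
  by (simp add: count_below_def)

lemma count_below_union [simp]: "count_below (M + N) K = count_below M K + count_below N K"
  by (simp add: count_below_def)

lemma count_below_replicate: "count_below (replicate_mset n g) K = (if g \<subseteq> K then n else 0)"
  by (induction n) (auto simp: count_below_add_mset)

lemma count_below_mono: "K \<subseteq> K' \<Longrightarrow> count_below M K \<le> count_below M K'"
  by (induction M) (auto simp: count_below_add_mset)

text \<open>Counting is supermodular, opposite to \<open>cd\<close>, so the difference
  \<open>cd_gap\<close> is submodular.\<close>

lemma count_below_join2:
  assumes "K \<in> Lat" "K' \<in> Lat"
  shows "count_below M K + count_below M K' \<le> count_below M (flat_join {K, K'}) + count_below M (K \<inter> K')"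
  using flat_join2_upper[OF assms] by (induction M) (auto simp: count_below_add_mset)

lemma count_below_fac:
  assumes "x \<in> Lat" "set_mset M \<subseteq> G"
  shows "count_below M x = (\<Sum>y\<in>fac x. count_below M y)"
  using assms(2)
proof (induction M)
  case (add g M)
  have "(if g \<subseteq> x then 1 else 0) = (\<Sum>y\<in>fac x. if g \<subseteq> y then 1 else (0::nat))"
  proof (cases "g \<subseteq> x")
    case True
    then obtain y where y: "y \<in> fac x" "g \<subseteq> y"
      using factor_above[of g x] add.prems by auto
    have "(\<Sum>y\<in>fac x. if g \<subseteq> y then 1 else (0::nat)) = (\<Sum>u\<in>fac x. if u = y then 1 else 0)"
    proof (intro sum.cong refl if_cong)
      show "g \<subseteq> u \<longleftrightarrow> u = y" if "u \<in> fac x" for u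
        using fac_above_unique[OF assms(1) that y(1)] y(2) add.prems by auto
    qed
    then show ?thesis
      using y True by simp
  next
    case False
    then have "\<not> g \<subseteq> y" if "y \<in> fac x" for y
      using that fac_le by blast
    then show ?thesis
      using False by simp
  qed
  then show ?case
    using add by (simp add: count_below_add_mset sum.distrib)
qed simp


section \<open>The dragon Hall--Rado condition\<close>

text \<open>The slack of the Hall--Rado inequality at K, integer valued so that it can be subtracted
  freely.\<close>

definition cd_gap :: "'a set multiset \<Rightarrow> 'a set \<Rightarrow> int" where
  "cd_gap M K = int (cd K) - int (count_below M K)"

definition dhr :: "'a set multiset \<Rightarrow> bool" where
  "dhr M \<longleftrightarrow> (\<forall>K\<in>Lat. K \<noteq> flat_bot \<longrightarrow> count_below M K < cd K)"

text \<open>This is the condition for \<open>D((\<Prod>s\<in>S. x\<^sub>s) c\<^sub>M)\<close> to be nonzero.\<close>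

definition tight :: "'a set set \<Rightarrow> 'a set multiset \<Rightarrow> bool" where
  "tight S M \<longleftrightarrow> dhr M \<and> fac (flat_join S) = S \<and> (\<forall>s\<in>S. cd_gap M s = 1) \<and>
     (\<forall>K\<in>Lat. flat_join S \<subset> K \<longrightarrow> int (card S) < cd_gap M K)"

lemma tightD:
  assumes "tight S M"
  shows "dhr M" "fac (flat_join S) = S" "s \<in> S \<Longrightarrow> cd_gap M s = 1"
    "K \<in> Lat \<Longrightarrow> flat_join S \<subset> K \<Longrightarrow> int (card S) < cd_gap M K"
  using assms unfolding tight_def by auto

lemma cd_gap_add_mset: "cd_gap (add_mset h M) K = cd_gap M K - of_bool (h \<subseteq> K)"
  by (simp add: cd_gap_def count_below_add_mset)

lemma cd_gap_pos: "dhr M \<Longrightarrow> K \<in> Lat \<Longrightarrow> K \<noteq> flat_bot \<Longrightarrow>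
    1 \<le> cd_gap M K"
  by (force simp: dhr_def cd_gap_def)

lemma dhr_gap: "dhr M \<longleftrightarrow> (\<forall>K\<in>Lat. K \<noteq> flat_bot \<longrightarrow> 1 \<le> cd_gap M K)"
  by (force simp: dhr_def cd_gap_def)

lemma count_below_zer: "set_mset M \<subseteq> G \<Longrightarrow> count_below M flat_bot = 0"
  by (induction M) (auto simp: count_below_add_mset dest: G_not_le_zer)

lemma cd_gap_zer: "set_mset M \<subseteq> G \<Longrightarrow> cd_gap M flat_bot = 0"
  by (simp add: cd_gap_def count_below_zer cd_zer)

lemma cd_gap_nonneg: "dhr M \<Longrightarrow> set_mset M \<subseteq> G \<Longrightarrow>
    K \<in> Lat \<Longrightarrow> 0 \<le> cd_gap M K"
  using cd_gap_pos[of M K] cd_gap_zer[of M] by (cases "K = flat_bot") auto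

lemma cd_gap_fac: "x \<in> Lat \<Longrightarrow> set_mset M \<subseteq> G \<Longrightarrow>
    cd_gap M x = (\<Sum>y\<in>fac x. cd_gap M y)"
  using cd_fac[of x] count_below_fac[of x M] by (simp add: cd_gap_def sum_subtractf)

lemma cd_gap_join_subset:
  assumes "x \<in> Lat" "set_mset M \<subseteq> G" "Y \<subseteq> fac x"
  shows "cd_gap M (flat_join Y) = (\<Sum>y\<in>Y. cd_gap M y)"
proof -
  have "Y \<subseteq> Lat"
    using assms fac_Lat by auto
  then show ?thesis
    using cd_gap_fac[of "flat_join Y" M] fac_join_subset[of x Y] assms flat_join_Lat by simp
qed

lemma cd_gap_join2:
  assumes "K \<in> Lat" "K' \<in> Lat"
  shows "cd_gap M (flat_join {K, K'}) + cd_gap M (K \<inter> K') \<le> cd_gap M K + cd_gap M K'"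
  using cd_join2[OF assms] count_below_join2[OF assms, of M] by (simp add: cd_gap_def)

text \<open>The factors of the join are the members of S, each with gap 1, and gaps add over
  factors.\<close>

lemma cd_gap_join_tight:
  assumes "tight S M" "set_mset M \<subseteq> G" "S \<subseteq> Lat"
  shows "cd_gap M (flat_join S) = int (card S)"
proof -
  have "cd_gap M (flat_join S) = (\<Sum>s\<in>S. cd_gap M s)"
    using cd_gap_fac[OF flat_join_Lat[OF assms(3)] assms(2)] assms(1) by (simp add: tight_def)
  also have "\<dots> = int (card S)"
    using assms(1) by (simp add: tight_def)
  finally show ?thesis .
qed

section \<open>Adjoining a class or a variable to a tight configuration\<close>

context
  fixes S :: "'a set set" and t :: "'a set" and M :: "'a set multiset"
  assumes SG: "S \<subseteq> G" and tG: "t \<in> G" and MG: "set_mset M \<subseteq> G"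
    and incomparable: "\<And>s. s \<in> S \<Longrightarrow>
        \<not> t \<subseteq> s" "\<And>s. s \<in> S \<Longrightarrow> \<not> s \<subseteq> t"
begin

text \<open>Adjoining h lowers the gap by one on the flats above h. These are the flats where it
  then becomes too small: it reaches 0, which breaks \<open>dhr\<close>, or it is at most
  \<open>card S\<close> above the join of S, which breaks the last clause of
  \<open>tight\<close>.\<close>

private definition "bad = {K \<in> Lat. t \<subseteq> K \<and>
   (cd_gap M K = 1 \<or> flat_join S \<subseteq> K \<and> cd_gap M K \<le> int (card S) + 1)}"

private lemma SL: "S \<subseteq> Lat"
  using SG G_sub_Lat by auto

private lemma VL: "flat_join S \<in> Lat"
  by (rule flat_join_Lat[OF SL])

private lemma tL: "t \<in> Lat"
  using tG G_Lat by auto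

private lemma fin_S: "finite S"
  using SG finite_G finite_subset by auto

private lemma t_notin_S: "t \<notin> S"
  using incomparable by auto

private lemma not_le_join:
  assumes "fac (flat_join S) = S" "h \<in> G" "t \<subseteq> h"
  shows "\<not> h \<subseteq> flat_join S"
proof
  assume "h \<subseteq> flat_join S"
  then obtain s where "s \<in> S" "h \<subseteq> s"
    using factor_above[OF assms(2)] assms(1) by metis
  then show False
    using incomparable(1)[of s] assms(3) by auto
qed

private lemma tight_add_D:
  assumes "tight S (add_mset h M)" "h \<in> G" "t \<subseteq> h"
  shows "tight S M"
proof -
  have fac: "fac (flat_join S) = S"
    using assms by (simp add: tight_def)
  have hs: "\<not> h \<subseteq> s" if "s \<in> S" for s
    using incomparable(1)[OF that] assms(3) by auto
  show ?thesis
  proof (unfold tight_def dhr_gap, intro conjI ballI impI)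
    show "1 \<le> cd_gap M K" if "K \<in> Lat" "K \<noteq> flat_bot" for K
      using cd_gap_pos[OF tightD(1)[OF assms(1)] that] by (cases "h \<subseteq> K") (simp_all add: cd_gap_add_mset)
    show "cd_gap M s = 1" if "s \<in> S" for s
      using tightD(3)[OF assms(1) that] hs[OF that] by (simp add: cd_gap_add_mset)
    show "int (card S) < cd_gap M K" if "K \<in> Lat" "flat_join S \<subset> K" for K
      using tightD(4)[OF assms(1) that] by (cases "h \<subseteq> K") (simp_all add: cd_gap_add_mset)
  qed (rule fac)
qed

private lemma tight_add_iff:
  assumes "tight S M" "h \<in> G" "t \<subseteq> h"
  shows "tight S (add_mset h M) \<longleftrightarrow> \<not> (\<exists>K\<in>bad. h \<subseteq> K)"
proof -
  have fac: "fac (flat_join S) = S" and d: "dhr M" and g1: "\<And>s. s \<in> S \<Longrightarrow> cd_gap M s = 1"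
    and g2: "\<And>K. K \<in> Lat \<Longrightarrow> flat_join S \<subset> K \<Longrightarrow> int (card S) < cd_gap M K"
    using tightD[OF assms(1)] by simp_all
  have hs: "\<not> h \<subseteq> s" if "s \<in> S" for s
    using incomparable(1)[OF that] assms(3) by auto
  have hz: "K \<noteq> flat_bot" if "h \<subseteq> K" for K
    using that G_not_le_zer assms by auto
  have 1: "dhr (add_mset h M) \<longleftrightarrow> \<not> (\<exists>K\<in>Lat. h \<subseteq> K \<and> cd_gap M K = 1)"
  proof -
    have "(1 \<le> cd_gap M K - of_bool (h \<subseteq> K)) \<longleftrightarrow>
        \<not> (h \<subseteq> K \<and> cd_gap M K = 1)"
      if "K \<in> Lat" "K \<noteq> flat_bot" for K
      using cd_gap_pos[OF d that] by auto
    then show ?thesis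
      unfolding dhr_gap cd_gap_add_mset using hz by auto
  qed
  have 2: "(\<forall>K\<in>Lat. flat_join S \<subset> K \<longrightarrow> int (card S) < cd_gap (add_mset h M)
      K) \<longleftrightarrow>
     \<not> (\<exists>K\<in>Lat. h \<subseteq> K \<and> flat_join S \<subseteq> K \<and> cd_gap M K \<le> int (card S) + 1)"
  proof -
    have "(flat_join S \<subset> K \<longrightarrow> int (card S) < cd_gap (add_mset h M) K) \<longleftrightarrow>
       \<not> (h \<subseteq> K \<and> flat_join S \<subseteq> K \<and> cd_gap M K \<le> int (card S) + 1)"
           if "K \<in> Lat" for K
    proof (cases "h \<subseteq> K")
      case True
      \<comment> \<open>K contains h, which does not lie below the join of S, so the containment is
        automatically strict.\<close>
      then have "flat_join S \<subset> K \<longleftrightarrow> flat_join S \<subseteq> K"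
        using not_le_join[OF fac assms(2,3)] by auto
      then show ?thesis
        using True by (auto simp: cd_gap_add_mset)
    next
      case False
      then show ?thesis
        using g2[OF that] by (simp add: cd_gap_add_mset)
    qed
    then show ?thesis
      by simp
  qed
  have 3: "\<forall>s\<in>S. cd_gap (add_mset h M) s = 1"
    using g1 hs by (simp add: cd_gap_add_mset)
  have tK: "h \<subseteq> K \<Longrightarrow> t \<subseteq> K" for K
    using assms(3) by auto
  have 4: "(\<exists>K\<in>bad. h \<subseteq> K) \<longleftrightarrow>
      (\<exists>K\<in>Lat. h \<subseteq> K \<and> cd_gap M K = 1) \<or>
     (\<exists>K\<in>Lat. h \<subseteq> K \<and> flat_join S \<subseteq> K \<and> cd_gap M K \<le> int (card S) + 1)"
    unfolding bad_def using tK by (smt (verit) mem_Collect_eq)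
  show ?thesis
    unfolding tight_def[of S "add_mset h M"] 1 2 4 using fac 3 by simp
qed

text \<open>The gap at the join is at most the sum of both gaps minus the gap at the intersection.
  The intersection contains t, so its gap is at least 1, which suffices as soon as one of the two
  gaps is 1.\<close>

private lemma bad_join:
  assumes "tight S M" "K \<in> bad" "K' \<in> bad"
  shows "flat_join {K, K'} \<in> bad"
proof -
  have d: "dhr M" and fac: "fac (flat_join S) = S"
    and g2: "\<And>K. K \<in> Lat \<Longrightarrow> flat_join S \<subset> K \<Longrightarrow> int (card S) < cd_gap M K"
    using tightD[OF assms(1)] by simp_all
  have K: "K \<in> Lat" "K' \<in> Lat" "t \<subseteq> K" "t \<subseteq> K'"
    using assms by (auto simp: bad_def)
  let ?J = "flat_join {K, K'}"
  have J: "?J \<in> Lat" "K \<subseteq> ?J" "K' \<subseteq> ?J"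
    using K flat_join2_Lat flat_join2_upper by auto
  have tJ: "t \<subseteq> ?J"
    using K J by auto
  have I: "K \<inter> K' \<in> Lat" "t \<subseteq> K \<inter> K'"
    using K by (auto intro: Int_Lat)
  then have "K \<inter> K' \<noteq> flat_bot" "?J \<noteq> flat_bot"
    using G_not_le_zer[OF tG] tJ by auto
  then have g: "1 \<le> cd_gap M (K \<inter> K')" "1 \<le> cd_gap M ?J"
    using cd_gap_pos[OF d] I J by auto
  have sub: "cd_gap M ?J + cd_gap M (K \<inter> K') \<le> cd_gap M K + cd_gap M K'"
    using cd_gap_join2 K by auto
  consider "cd_gap M K = 1" "cd_gap M K' = 1"
    | "cd_gap M K = 1" "flat_join S \<subseteq> K'" "cd_gap M K' \<le> int (card S) + 1"
    | "cd_gap M K' = 1" "flat_join S \<subseteq> K" "cd_gap M K \<le> int (card S) + 1"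
    | "flat_join S \<subseteq> K" "cd_gap M K \<le> int (card S) + 1" "flat_join S \<subseteq> K'" "cd_gap M K'
        \<le> int (card S) + 1"
    using assms by (auto simp: bad_def)
  then show ?thesis
  proof cases
    \<comment> \<open>The bound 1 is too weak here. The intersection contains the join of S and also
      t, hence lies strictly above that join, and tightness gives it a gap above
      \<open>card S\<close>.\<close>
    case 4
    have "\<not> t \<subseteq> flat_join S"
      using not_le_join[OF fac tG] by auto
    then have "flat_join S \<subset> K \<inter> K'"
      using 4 I by auto
    then have "int (card S) < cd_gap M (K \<inter> K')"
      using g2 I by auto
    then show ?thesis
      using sub 4 J tJ by (auto simp: bad_def)
  qed (use sub g J tJ in \<open>auto simp: bad_def\<close>)
qed

private lemma bad_max:
  assumes "tight S M" "bad \<noteq> {}"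
  obtains W where "W \<in> bad" "\<And>K. K \<in> bad \<Longrightarrow> K \<subseteq> W"
proof -
  have fin: "finite bad"
    unfolding bad_def using finite_Lat by auto
  obtain W where W: "W \<in> bad" "\<forall>K\<in>bad. W \<subseteq> K \<longrightarrow> W = K"
    using finite_has_maximal[OF fin assms(2)] by metis
  have "K \<subseteq> W" if "K \<in> bad" for K
  proof -
    have "flat_join {W, K} = W"
      using W bad_join[OF assms(1) W(1) that] flat_join2_upper[of W K] that by (auto simp: bad_def)
    then show ?thesis
      using flat_join2_upper(2)[of W K] W that by (auto simp: bad_def)
  qed
  then show ?thesis
    using that W by blast
qed

private lemma insert_join:
  "flat_join (insert t S) \<in> Lat" "flat_join S \<subseteq> flat_join (insert t S)" "t \<subseteq> flat_join (insert t S)"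
  using flat_join_Lat[of "insert t S"] flat_join_mono[of S "insert t S"] flat_join_upper[of "insert t S" t] SL tL by auto

text \<open>The gap at K is compared with the gap at its join J with t. If K meets t nontrivially,
  the gap at the intersection compensates the gap 1 of t. Otherwise one unit is lost, which is
  regained because J lies strictly above the join of \<open>insert t S\<close>.\<close>

private lemma tight_insert_D:
  assumes "tight (insert t S) M"
  shows "tight S M"
proof -
  have fac: "fac (flat_join (insert t S)) = insert t S" and d: "dhr M"
    and g1: "\<And>s. s \<in> insert t S \<Longrightarrow> cd_gap M s = 1"
    and g2: "\<And>K. K \<in> Lat \<Longrightarrow> flat_join (insert t S) \<subset> K \<Longrightarrow>
        int (card S) + 1 < cd_gap M K"
    using tightD[OF assms] fin_S t_notin_S by (simp_all add: add.commute)
  have facS: "fac (flat_join S) = S"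
    using fac_join_subset[OF insert_join(1), of S] fac by auto
  have gW: "cd_gap M (flat_join (insert t S)) = int (card S) + 1"
    using cd_gap_join_tight[OF assms MG] SL tL fin_S t_notin_S by auto
  have "int (card S) < cd_gap M K" if K: "K \<in> Lat" "flat_join S \<subset> K" for K
  proof -
    let ?J = "flat_join {K, t}"
    have J: "?J \<in> Lat" "K \<subseteq> ?J" "t \<subseteq> ?J"
      using K tL flat_join2_Lat flat_join2_upper by auto
    have WJ: "flat_join (insert t S) \<subseteq> ?J"
    proof (rule flat_join_least[OF _ J(1)])
      show "a \<subseteq> ?J" if "a \<in> insert t S" for a
      proof (cases "a = t")
        case False
        then have "a \<subseteq> flat_join S"
          using that flat_join_upper[OF SL] by auto
        then show ?thesis
          using K J by auto
      qed (use J in auto)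
    qed
    have sub: "cd_gap M ?J + cd_gap M (K \<inter> t) \<le> cd_gap M K + 1"
      using cd_gap_join2[OF K(1) tL, of M] g1[of t] by auto
    have gJ: "int (card S) + 1 \<le> cd_gap M ?J"
    proof (cases "flat_join (insert t S) = ?J")
      case True
      then show ?thesis
        using gW by simp
    next
      case False
      then show ?thesis
        using g2[OF J(1) psubsetI[OF WJ False]] by simp
    qed
    show ?thesis
    proof (cases "K \<inter> t = flat_bot")
      case False
      then have "1 \<le> cd_gap M (K \<inter> t)"
        using cd_gap_pos[OF d] Int_Lat K tL by auto
      then show ?thesis
        using sub gJ by linarith
    next
      case True
      then have "cd_gap M ?J \<le> cd_gap M K + 1"
        using sub cd_gap_zer[OF MG] by auto
      \<comment> \<open>Under equality K would be the join of its traces on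
        \<open>insert t S\<close>; the trace on t is the bottom flat, so K would lie below the join
        of S.\<close>
      moreover have ne: "flat_join (insert t S) \<noteq> ?J"
      proof
        assume eq: "flat_join (insert t S) = ?J"
        have "flat_join ((\<lambda>y. K \<inter> y) ` insert t S) = K"
          using flat_join_Int_fac[OF J(1) K(1) J(2)] fac eq by simp
        moreover have "flat_join ((\<lambda>y. K \<inter> y) ` insert t S) \<subseteq> flat_join S"
        proof (rule flat_join_least[OF _ VL])
          show "a \<subseteq> flat_join S" if "a \<in> (\<lambda>y. K \<inter> y) ` insert t S" for a
            using that True flat_bot_least[OF VL] flat_join_upper[OF SL] by auto
        qed
        ultimately show False
          using K by auto
      qed
      ultimately show ?thesis
        using g2[OF J(1) psubsetI[OF WJ ne]] by simp
    qed
  qed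
  then show ?thesis
    unfolding tight_def using d facS g1 by auto
qed

private lemma tight_insert_bad:
  assumes "tight (insert t S) M"
  shows "flat_join (insert t S) \<in> bad"
proof -
  have "cd_gap M (flat_join (insert t S)) = int (card S) + 1"
    using cd_gap_join_tight[OF assms MG] SL tL fin_S t_notin_S by auto
  then show ?thesis
    using insert_join by (auto simp: bad_def)
qed

text \<open>Comparing gaps forces \<open>insert t S\<close> to be the factor set of W. If W contains
  the join of S, the factors other than t join to a flat above it with gap at most
  \<open>card S\<close>, so tightness leaves only equality. If W has gap 1, it has a single factor,
  because each factor has gap at least 1.\<close>

private lemma tight_insertI:
  assumes "tight S M" "W \<in> bad" "\<And>K. K \<in> bad \<Longrightarrow> K \<subseteq> W" "t \<in> fac W"
  shows "tight (insert t S) M"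
proof -
  have d: "dhr M" and fac: "fac (flat_join S) = S" and g1: "\<And>s. s \<in> S \<Longrightarrow> cd_gap M s = 1"
    and g2: "\<And>K. K \<in> Lat \<Longrightarrow> flat_join S \<subset> K \<Longrightarrow> int (card S) < cd_gap M K"
    using tightD[OF assms(1)] by simp_all
  have W: "W \<in> Lat" "t \<subseteq> W"
    using assms by (auto simp: bad_def)
  have tV: "\<not> t \<subseteq> flat_join S"
    using not_le_join[OF fac tG] by auto
  have gV: "cd_gap M (flat_join S) = int (card S)"
    by (rule cd_gap_join_tight[OF assms(1) MG SL])
  have gWs: "cd_gap M W = (\<Sum>y\<in>fac W. cd_gap M y)"
    by (rule cd_gap_fac[OF W(1) MG])
  have gf: "1 \<le> cd_gap M y" if "y \<in> fac W" for y
    using cd_gap_pos[OF d] fac_in_G[OF that] G_Lat G_nonzer by auto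
  consider "flat_join S \<subseteq> W" "cd_gap M W \<le> int (card S) + 1" | "cd_gap M W = 1"
    using assms(2) by (auto simp: bad_def)
  then show ?thesis
  proof cases
    case 1
    let ?R = "fac W - {t}"
    have RL: "?R \<subseteq> Lat"
      using fac_Lat by auto
    have "s \<subseteq> flat_join ?R" if s: "s \<in> S" for s
    proof -
      have sW: "s \<subseteq> W"
        using flat_join_upper[OF SL s] 1 by simp
      obtain y where y: "y \<in> fac W" "s \<subseteq> y"
        using factor_above[OF subsetD[OF SG s] sW] by blast
      then have "y \<in> ?R"
        using incomparable(2)[OF s] by auto
      then show ?thesis
        using flat_join_upper[OF RL] y by blast
    qed
    then have VR: "flat_join S \<subseteq> flat_join ?R"
      by (intro flat_join_least flat_join_Lat[OF RL])
    have gR: "cd_gap M (flat_join ?R) = cd_gap M W - cd_gap M t"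
      using cd_gap_join_subset[OF W(1) MG, of ?R] gWs assms(4) by (simp add: sum_diff1)
    then have "cd_gap M (flat_join ?R) \<le> int (card S)"
      using 1 gf[OF assms(4)] by simp
    then have eq: "flat_join S = flat_join ?R"
      using VR g2[OF flat_join_Lat[OF RL]] by force
    have "int (card S) < cd_gap M W"
      using g2[OF W(1)] 1 tV W by auto
    then have gt: "cd_gap M t = 1" "cd_gap M W = int (card S) + 1"
      using gR gV eq 1 gf[OF assms(4)] by auto
    have "S = ?R"
      using fac_join_subset[OF W(1), of ?R] fac eq by simp
    then have ins: "insert t S = fac W"
      using assms(4) by auto
    have "int (card (insert t S)) < cd_gap M K" if K: "K \<in> Lat" "W \<subset> K" for K
    proof (rule ccontr)
      assume "\<not> ?thesis"
      then have "K \<in> bad"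
        using K 1 W fin_S t_notin_S by (auto simp: bad_def)
      then show False
        using assms(3) K by auto
    qed
    moreover have "\<forall>s\<in>insert t S. cd_gap M s = 1"
      using g1 gt by simp
    ultimately show ?thesis
      unfolding tight_def using ins flat_join_fac[OF W(1)] d by auto
  next
    case 2
    have "int (card (fac W)) \<le> 1"
      using 2 gWs sum_mono[of "fac W" "\<lambda>_. 1" "cd_gap M"] gf by simp
    then have "fac W = {t}"
      using assms(4) card_le_Suc0_iff_eq[of "fac W"] by auto
    then have Wt: "W = t"
      using flat_join_fac[OF W(1)] flat_join_single[OF tL] by simp
    \<comment> \<open>This flat is bad, hence below W, which is t. A member of S would then lie
      below t, so S is empty.\<close>
    let ?J = "flat_join {flat_join S, t}"
    have J: "?J \<in> Lat" "flat_join S \<subseteq> ?J" "t \<subseteq> ?J"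
      using VL tL flat_join2_Lat flat_join2_upper by auto
    have gJ: "int (card S) < cd_gap M ?J"
      using g2[OF J(1)] J tV by auto
    have sub: "cd_gap M ?J + cd_gap M (flat_join S \<inter> t) \<le> int (card S) + 1"
      using cd_gap_join2[OF VL tL, of M] gV 2 Wt by auto
    have "0 \<le> cd_gap M (flat_join S \<inter> t)"
      using cd_gap_nonneg[OF d MG] Int_Lat VL tL by auto
    then have "?J \<in> bad"
      using J sub by (auto simp: bad_def)
    then have "flat_join S \<subseteq> t"
      using assms(3) J Wt by blast
    then have S: "S = {}"
      using incomparable(2) flat_join_upper[OF SL] by blast
    have "int (card (insert t S)) < cd_gap M K" if K: "K \<in> Lat" "t \<subset> K" for K
    proof (rule ccontr)
      assume "\<not> ?thesis"
      moreover have "K \<noteq> flat_bot"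
        using K G_not_le_zer[OF tG] by auto
      then have "1 \<le> cd_gap M K"
        using cd_gap_pos[OF d] K by auto
      ultimately have "cd_gap M K = 1"
        using S by simp
      then have "K \<in> bad"
        using K by (auto simp: bad_def)
      then show False
        using assms(3) K Wt by auto
    qed
    then show ?thesis
      unfolding tight_def using S d 2 Wt fac_self[OF tG] flat_join_single[OF tL] by auto
  qed
qed

text \<open>The function \<open>w\<close> is the Moebius inverse of the indicator of \<open>tight S (add_mset h M)\<close>,
  restricted to \<open>h \<supseteq> t\<close>: those \<open>h\<close> for which the condition fails are the ones below one
  fixed flat.\<close>

lemma tight_step:
  assumes "t \<notin> fac E"
  obtains w :: "'a set \<Rightarrow> rat" where
    "\<And>h. h \<in> G \<Longrightarrow> t \<subseteq> h \<Longrightarrow>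
        of_bool (tight S (add_mset h M)) = (\<Sum>k | k \<in> G \<and> h \<subseteq> k. w k)"
    "w t = - of_bool (tight (insert t S) M)"
proof -
  \<comment> \<open>Exactly one factor of x lies above h if h lies below x, and none
    otherwise.\<close>
  have sum_fac: "(\<Sum>k | k \<in> G \<and> h \<subseteq> k. of_bool (k \<in> fac x)) = (of_bool (h \<subseteq> x) :: rat)"
    if hx: "h \<in> G" "x \<in> Lat" for h x
  proof (cases "h \<subseteq> x")
    case True
    then obtain y where y: "y \<in> fac x" "h \<subseteq> y"
      using factor_above[OF hx(1)] by blast
    have "(\<Sum>k | k \<in> G \<and> h \<subseteq> k. of_bool (k \<in> fac x)) =
        (\<Sum>k | k \<in> G \<and> h \<subseteq> k. if k = y then 1 else (0::rat))"
    proof (rule sum.cong[OF refl])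
      fix k assume "k \<in> {k. k \<in> G \<and> h \<subseteq> k}"
      then have "h \<subseteq> k"
        by simp
      then have "k \<in> fac x \<longleftrightarrow> k = y"
        using fac_above_unique[OF hx(2) _ y(1) hx(1) _ y(2), of k] y(1) by metis
      then show "of_bool (k \<in> fac x) = (if k = y then 1 else (0::rat))"
        by simp
    qed
    also have "\<dots> = 1"
      using y finite_G fac_in_G by (subst sum.delta) auto
    finally show ?thesis
      using True by simp
  next
    case False
    then have "k \<notin> fac x" if "h \<subseteq> k" for k
      using fac_le[of k x] that by auto
    then show ?thesis
      using False by simp
  qed
  have leE: "h \<subseteq> E" if "h \<in> G" for h
    using that G_Lat Lat_subset by auto
  show ?thesis
  proof (cases "tight S M")
    case False
    then have "\<not> tight S (add_mset h M)" if "h \<in> G" "t \<subseteq> h" for h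
      using tight_add_D that by blast
    moreover have "\<not> tight (insert t S) M"
      using tight_insert_D False by blast
    ultimately show ?thesis
      using that[of "\<lambda>_. 0"] by simp
  next
    case T: True
    show ?thesis
    proof (cases "bad = {}")
      case True
      then have "tight S (add_mset h M)" if "h \<in> G" "t \<subseteq> h" for h
        using tight_add_iff[OF T] that by auto
      moreover have "\<not> tight (insert t S) M"
        using tight_insert_bad True by blast
      \<comment> \<open>The condition holds for every h, and the constant 1 is the upper sum of the
        indicator of the factors of E. Its value at t is 0 because t is not a factor of E.\<close>
      ultimately show ?thesis
        using that[of "\<lambda>k. of_bool (k \<in> fac E)"] sum_fac[OF _ E_Lat] leE assms by simp
    next
      case False
      then obtain W where W: "W \<in> bad" "\<And>K. K \<in> bad \<Longrightarrow> K \<subseteq> W"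
        using bad_max[OF T] by blast
      have WL: "W \<in> Lat"
        using W by (auto simp: bad_def)
      have 1: "tight S (add_mset h M) \<longleftrightarrow> \<not> h \<subseteq> W" if "h \<in> G" "t \<subseteq> h" for h
        using tight_add_iff[OF T that] W by blast
      have 2: "tight (insert t S) M \<longleftrightarrow> t \<in> fac W"
      proof
        assume A: "tight (insert t S) M"
        let ?U = "flat_join (insert t S)"
        have U: "?U \<subseteq> W" "fac ?U = insert t S"
          using W(2)[OF tight_insert_bad[OF A]] tightD(2)[OF A] by auto
        \<comment> \<open>Being bad, W has gap 1 or at most \<open>card S + 1\<close>, whereas
          tightness demands more strictly above the join.\<close>
        moreover have "\<not> ?U \<subset> W"
        proof
          assume "?U \<subset> W"
          then have "int (card S) + 1 < cd_gap M W"
            using tightD(4)[OF A WL] fin_S t_notin_S by simp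
          then show False
            using W(1) by (auto simp: bad_def)
        qed
        ultimately show "t \<in> fac W"
          by auto
      next
        assume "t \<in> fac W"
        then show "tight (insert t S) M"
          using tight_insertI[OF T W] by blast
      qed
      show ?thesis
      proof (rule that)
        show "of_bool (tight S (add_mset h M)) =
            (\<Sum>k | k \<in> G \<and> h \<subseteq> k. of_bool (k \<in> fac E) - of_bool (k \<in> fac W) :: rat)"
          if "h \<in> G" "t \<subseteq> h" for h
          unfolding sum_subtractf 1[OF that] sum_fac[OF that(1) E_Lat] sum_fac[OF that(1) WL]
          using leE[OF that(1)] by simp
        show "of_bool (t \<in> fac E) - of_bool (t \<in> fac W) = - (of_bool (tight (insert t S) M) :: rat)"
          unfolding 2 using assms by simp
      qed
    qed
  qed
qed

end

end

section \<open>Polynomials\<close>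

lemma mpoly_sum_singles:
  "p = (\<Sum>m\<in>Poly_Mapping.keys p. Poly_Mapping.single m (Poly_Mapping.lookup p m))"
proof (rule poly_mapping_eqI)
  fix k
  have "Poly_Mapping.lookup (\<Sum>m\<in>Poly_Mapping.keys p. Poly_Mapping.single m (Poly_Mapping.lookup p m)) k
      = (\<Sum>m\<in>Poly_Mapping.keys p. if m = k then Poly_Mapping.lookup p m else 0)"
    by (simp add: lookup_sum lookup_single when_def)
  also have "\<dots> = Poly_Mapping.lookup p k"
    by (simp add: in_keys_iff)
  finally show "Poly_Mapping.lookup p k = Poly_Mapping.lookup
     (\<Sum>m\<in>Poly_Mapping.keys p. Poly_Mapping.single m (Poly_Mapping.lookup p m)) k" ..
qed

lemma mconst_add: "mconst (a + b) = mconst a + mconst b"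
  by (simp add: mconst_def single_add)

lemma mconst_mult: "mconst (a * b) = mconst a * mconst b"
  by (simp add: mconst_def mult_single)

lemma mconst_0 [simp]: "mconst 0 = 0"
  by (simp add: mconst_def)

lemma mconst_1 [simp]: "mconst 1 = 1"
  by (simp add: mconst_def)

lemma mconst_uminus: "mconst (- a) = - mconst a"
  by (simp add: mconst_def single_uminus)

text \<open>Multisets serve as exponent vectors, so that an induction peels off one variable at a
  time; \<open>exponent\<close> translates them to finitely supported maps.\<close>

definition var_monom :: "'v multiset \<Rightarrow> 'v rat_mpoly" where
  "var_monom a = prod_mset (image_mset mvar a)"

definition exponent :: "'v multiset \<Rightarrow> ('v \<Rightarrow>\<^sub>0 nat)" where
  "exponent a = sum_mset (image_mset (\<lambda>v. Poly_Mapping.single v 1) a)"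

lemma var_monom_expo: "var_monom a = Poly_Mapping.single (exponent a) 1"
  by (induction a) (simp_all add: var_monom_def exponent_def mvar_def mult_single)

lemma lookup_expo: "Poly_Mapping.lookup (exponent a) v = count a v"
  by (induction a) (simp_all add: exponent_def lookup_add lookup_single when_def)

lemma keys_expo: "Poly_Mapping.keys (exponent a) = set_mset a"
  by (auto simp: in_keys_iff lookup_expo)

lemma exponent_surj: "\<exists>a. exponent a = m"
proof -
  have "finite {v. 0 < Poly_Mapping.lookup m v}"
    using finite_keys[of m] by (simp add: keys.rep_eq)
  then have "exponent (Abs_multiset (Poly_Mapping.lookup m)) = m"
    by (intro poly_mapping_eqI) (simp add: lookup_expo Abs_multiset_inverse)
  then show ?thesis ..
qed

lemma mon_degree_expo: "mon_degree (exponent a) = size a"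
  by (simp add: mon_degree_def keys_expo lookup_expo size_multiset_overloaded_eq)

lemma var_monom_empty [simp]: "var_monom {#} = 1"
  by (simp add: var_monom_def)

lemma var_monom_add_mset: "var_monom (add_mset v a) = mvar v * var_monom a"
  by (simp add: var_monom_def)

lemma var_monom_union: "var_monom (a + b) = var_monom a * var_monom b"
  by (simp add: var_monom_def)

lemma mpoly_sum_xm:
  assumes "p \<in> carrier (mpoly_ring V)"
  shows "\<exists>A c. finite A \<and> (\<forall>a\<in>A. set_mset a \<subseteq> V \<and> exponent a \<in>
      Poly_Mapping.keys p) \<and>
    p = (\<Sum>a\<in>A. mconst (c a) * var_monom a)"
proof -
  obtain f :: "('a \<Rightarrow>\<^sub>0 nat) \<Rightarrow> 'a multiset" where f: "\<And>m. exponent (f m) = m"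
    using exponent_surj by metis
  have inj: "inj_on f (Poly_Mapping.keys p)"
    by (metis f inj_onI)
  let ?A = "f ` Poly_Mapping.keys p"
  have "p = (\<Sum>m\<in>Poly_Mapping.keys p. Poly_Mapping.single m (Poly_Mapping.lookup p m))"
    by (rule mpoly_sum_singles)
  also have "\<dots> = (\<Sum>a\<in>?A. mconst (Poly_Mapping.lookup p (exponent a)) * var_monom a)"
    by (simp add: sum.reindex[OF inj] f var_monom_expo mconst_def mult_single)
  finally have "p = (\<Sum>a\<in>?A. mconst (Poly_Mapping.lookup p (exponent a)) * var_monom a)" .
  moreover have "\<forall>a\<in>?A. set_mset a \<subseteq> V \<and> exponent a \<in> Poly_Mapping.keys p"
    using assms by (auto simp: mpoly_ring_def keys_expo[symmetric] f)
  ultimately show ?thesis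
    by (intro exI[of _ ?A] exI[of _ "\<lambda>a. Poly_Mapping.lookup p (exponent a)"] conjI) simp_all
qed

lemma mpoly_induct [consumes 1, case_names monom add]:
  assumes "p \<in> carrier (mpoly_ring V)"
    and "\<And>q a. set_mset a \<subseteq> V \<Longrightarrow> P (mconst q * var_monom a)"
    and "\<And>p q. P p \<Longrightarrow> P q \<Longrightarrow> P (p + q)"
  shows "P p"
proof -
  obtain A c where A: "finite A" "\<forall>a\<in>A. set_mset a \<subseteq> V \<and> exponent a \<in> Poly_Mapping.keys p"
    "p = (\<Sum>a\<in>A. mconst (c a) * var_monom a)"
    using mpoly_sum_xm[OF assms(1)] by (elim exE conjE)
  have "P (\<Sum>a\<in>A. mconst (c a) * var_monom a)"
    using A(1,2)
  proof (induction A)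
    case empty
    then show ?case
      using assms(2)[of "{#}" 0] by simp
  next
    case (insert a A)
    then show ?case
      using assms(2)[of a] assms(3) by auto
  qed
  then show ?thesis
    using A by simp
qed

lemma carrier_UNIV: "carrier (mpoly_ring UNIV) = UNIV"
  by (simp add: mpoly_ring_def)

subsection \<open>Substitution and linear functionals\<close>

definition mon_eval :: "('v \<Rightarrow> 'b::comm_monoid_mult) \<Rightarrow> ('v \<Rightarrow>\<^sub>0 nat)
    \<Rightarrow> 'b" where
  "mon_eval s m = (\<Prod>v\<in>Poly_Mapping.keys m. s v ^ Poly_Mapping.lookup m v)"

definition mpoly_subst :: "('v \<Rightarrow> 'w rat_mpoly) \<Rightarrow> 'v rat_mpoly \<Rightarrow> 'w rat_mpoly" where
  "mpoly_subst s p = (\<Sum>m\<in>Poly_Mapping.keys p. mconst (Poly_Mapping.lookup p m) * mon_eval s m)"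

text \<open>Composed with a substitution, this yields a functional with prescribed values on
  monomials in other generators.\<close>

definition lin_ext :: "(('v \<Rightarrow>\<^sub>0 nat) \<Rightarrow> rat) \<Rightarrow> 'v rat_mpoly \<Rightarrow> rat" where
  "lin_ext f p = (\<Sum>m\<in>Poly_Mapping.keys p. Poly_Mapping.lookup p m * f m)"

lemma mon_eval_superset:
  assumes "finite B" "Poly_Mapping.keys m \<subseteq> B"
  shows "mon_eval s m = (\<Prod>v\<in>B. s v ^ Poly_Mapping.lookup m v)"
  unfolding mon_eval_def using assms
  by (intro prod.mono_neutral_left) (auto simp: in_keys_iff)

lemma mon_eval_add: "mon_eval s (m + n) = mon_eval s m * mon_eval s n"
proof -
  let ?B = "Poly_Mapping.keys m \<union> Poly_Mapping.keys n"
  have "Poly_Mapping.keys (m + n) \<subseteq> ?B"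
    by (rule keys_add)
  then show ?thesis
    using mon_eval_superset[of ?B m s] mon_eval_superset[of ?B n s] mon_eval_superset[of ?B "m + n" s]
    by (simp add: lookup_add power_add prod.distrib)
qed

lemma mpoly_subst_add: "mpoly_subst s (p + q) = mpoly_subst s p + mpoly_subst s q"
  unfolding mpoly_subst_def
  by (rule setsum_keys_plus_distrib) (simp_all add: mconst_add algebra_simps)

lemma mpoly_subst_single: "mpoly_subst s (Poly_Mapping.single m q) = mconst q * mon_eval s m"
  by (simp add: mpoly_subst_def)

lemma mpoly_subst_sum: "mpoly_subst s (sum f A) = (\<Sum>a\<in>A. mpoly_subst s (f a))"
proof (induction A rule: infinite_finite_induct)
  case (insert a A)
  then show ?case
    by (simp add: mpoly_subst_add)
qed (simp_all add: mpoly_subst_def)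

lemma monom_single: "mconst q * var_monom a = Poly_Mapping.single (exponent a) q"
  by (simp add: var_monom_expo mconst_def mult_single)

lemma mpoly_subst_monom: "mpoly_subst s (mconst q * var_monom a) = mconst q * mon_eval s (exponent a)"
  by (simp add: monom_single mpoly_subst_single)

lemma mpoly_subst_monom_mult:
  "mpoly_subst s ((mconst q * var_monom a) * (mconst r * var_monom b)) =
      mpoly_subst s (mconst q * var_monom a) * mpoly_subst s (mconst r * var_monom b)"
proof -
  have eq: "(mconst q * var_monom a) * (mconst r * var_monom b) = mconst (q * r) * var_monom (a + b)"
    by (simp add: mconst_mult var_monom_union algebra_simps)
  have "exponent (a + b) = exponent a + exponent b"
    by (simp add: exponent_def)
  then show ?thesis
    unfolding eq mpoly_subst_monom by (simp add: mconst_mult mon_eval_add algebra_simps)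
qed

lemma mpoly_subst_mult: "mpoly_subst s (p * q) = mpoly_subst s p * mpoly_subst s q"
proof -
  have *: "mpoly_subst s ((mconst c * var_monom a) * q) = mpoly_subst s (mconst c * var_monom a) * mpoly_subst s q" for c a
  proof -
    have "q \<in> carrier (mpoly_ring UNIV)"
      by (simp add: carrier_UNIV)
    then show ?thesis
    proof (induction rule: mpoly_induct)
      case (monom r b)
      show ?case
        by (rule mpoly_subst_monom_mult)
    qed (simp only: mpoly_subst_add distrib_left)
  qed
  have "p \<in> carrier (mpoly_ring UNIV)"
    by (simp add: carrier_UNIV)
  then show ?thesis
  proof (induction rule: mpoly_induct)
    case (monom r b)
    show ?case
      by (rule *)
  qed (simp only: mpoly_subst_add distrib_right)
qed

lemma mpoly_subst_mconst: "mpoly_subst s (mconst q) = mconst q"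
  using mpoly_subst_monom[of s q "{#}"] by (simp add: exponent_def mon_eval_def)

lemma mpoly_subst_one: "mpoly_subst s 1 = 1"
  using mpoly_subst_mconst[of s 1] by simp

lemma mpoly_subst_mvar: "mpoly_subst s (mvar v) = s v"
  by (simp add: mvar_def mpoly_subst_single mon_eval_def)

lemma lin_ext_add: "lin_ext f (p + q) = lin_ext f p + lin_ext f q"
  unfolding lin_ext_def
  by (rule setsum_keys_plus_distrib) (simp_all add: algebra_simps)

lemma lin_ext_xm: "lin_ext f (mconst q * var_monom a) = q * f (exponent a)"
  by (simp add: lin_ext_def var_monom_expo mconst_def mult_single)

lemma lin_ext_mconst: "lin_ext f (mconst q * p) = q * lin_ext f p"
proof -
  have "p \<in> carrier (mpoly_ring UNIV)"
    by (simp add: carrier_UNIV)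
  then show ?thesis
  proof (induction rule: mpoly_induct)
    case (monom r a)
    have "mconst q * (mconst r * var_monom a) = mconst (q * r) * var_monom a"
      by (simp add: mconst_mult algebra_simps)
    then show ?case
      by (simp add: lin_ext_xm)
  qed (simp add: lin_ext_add algebra_simps)
qed

section \<open>The degree functional\<close>

context polymatroid_building
begin

abbreviation cg :: "'a set \<Rightarrow> 'a set rat_mpoly" where
  "cg \<equiv> chow_c E cd G"

definition c_monom :: "'a set multiset \<Rightarrow> 'a set rat_mpoly" where
  "c_monom M = prod_mset (image_mset cg M)"

lemma c_monom_empty [simp]: "c_monom {#} = 1"
  by (simp add: c_monom_def)

lemma c_monom_add_mset: "c_monom (add_mset g M) = cg g * c_monom M"
  by (simp add: c_monom_def)

lemma c_monom_union: "c_monom (M + N) = c_monom M * c_monom N"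
  by (simp add: c_monom_def)

lemma c_monom_replicate: "c_monom (replicate_mset n g) = cg g ^ n"
  by (simp add: c_monom_def)

lemma cg_eq: "cg g = (\<Sum>h | h \<in> G \<and> g \<subseteq> h. mvar h)"
  by (simp add: chow_c_def)

lemma finite_above [simp]: "finite {h. h \<in> G \<and> P h}"
  using finite_G by simp

lemma sum_above:
  fixes u :: "'a set \<Rightarrow> 'b::comm_monoid_add"
  assumes "g \<in> G"
  shows "(\<Sum>h | h \<in> G \<and> g \<subseteq> h. u h) = u g + (\<Sum>h | h \<in> G \<and> g \<subset> h. u h)"
proof -
  have "{h. h \<in> G \<and> g \<subseteq> h} = insert g {h. h \<in> G \<and> g \<subset> h}"
    using assms by auto
  then show ?thesis
    by simp
qed

lemma mvar_eq: "g \<in> G \<Longrightarrow> mvar g = cg g - (\<Sum>h | h \<in> G \<and> g \<subset> h. mvar h)"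
  by (simp add: cg_eq sum_above)

text \<open>Upper sums determine a function on G: once the values strictly above t agree, they
  cancel from the sum at t.\<close>

lemma moebius_unique:
  fixes u w :: "'a set \<Rightarrow> 'b::cancel_comm_monoid_add"
  assumes "t \<in> G"
    and "\<And>h. h \<in> G \<Longrightarrow> t \<subseteq> h \<Longrightarrow>
        (\<Sum>k | k \<in> G \<and> h \<subseteq> k. u k) = (\<Sum>k | k \<in> G \<and> h \<subseteq> k. w k)"
  shows "u t = w t"
  using assms
proof (induction "card {k. k \<in> G \<and> t \<subset> k}" arbitrary: t rule: less_induct)
  case less
  have "u h = w h" if h: "h \<in> G" "t \<subset> h" for h
  proof (rule less.hyps)
    show "card {k. k \<in> G \<and> h \<subset> k} < card {k. k \<in> G \<and> t \<subset> k}"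
      using h by (intro psubset_card_mono) auto
    show "h \<in> G"
      by fact
    show "(\<Sum>k | k \<in> G \<and> k' \<subseteq> k. u k) =
        (\<Sum>k | k \<in> G \<and> k' \<subseteq> k. w k)" if "k' \<in> G" "h \<subseteq> k'" for k'
      using less.prems(2)[OF that(1)] that h by auto
  qed
  then have "(\<Sum>h | h \<in> G \<and> t \<subset> h. u h) = (\<Sum>h | h \<in> G \<and> t \<subset> h. w h)"
    by (intro sum.cong) auto
  then show ?case
    using less.prems(2)[of t] less.prems(1) by (simp add: sum_above)
qed

text \<open>Substituting \<open>s h\<close> for \<open>mvar h\<close> turns each \<open>cg g\<close>
  into \<open>mvar g\<close>. The equation at g determines \<open>s g\<close> from the values
  strictly above g, so s is built by descending rank.\<close>

lemma ex_inverse_subst: "\<exists>s :: 'a set \<Rightarrow> 'a set rat_mpoly. \<forall>g\<in>G. (\<Sum>h | h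
    \<in> G \<and> g \<subseteq> h. s h) = mvar g"
proof -
  have "\<exists>s :: 'a set \<Rightarrow> 'a set rat_mpoly.
      \<forall>g\<in>G. cd E \<le> cd g + n \<longrightarrow> (\<Sum>h | h \<in> G \<and> g \<subseteq> h. s h)
          = mvar g" for n
  proof (induction n)
    case 0
    have "{h. h \<in> G \<and> g \<subseteq> h} = {E}" if "g \<in> G" "cd E \<le> cd g" for g
      using that cd_eqD[OF Lat_subset[OF G_Lat] G_Lat E_Lat] Lat_subset[OF G_Lat] by blast
    then show ?case
      by (intro exI[of _ mvar]) (use cd_eqD[OF Lat_subset[OF G_Lat] G_Lat E_Lat] in auto)
  next
    case (Suc n)
    then obtain s :: "'a set \<Rightarrow> 'a set rat_mpoly" where
      s: "\<And>g. g \<in> G \<Longrightarrow> cd E \<le> cd g + n \<Longrightarrow>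
          (\<Sum>h | h \<in> G \<and> g \<subseteq> h. s h) = mvar g"
      by blast
    \<comment> \<open>Values already constructed are kept; flats strictly above a new g have larger
      rank and are among those.\<close>
    define s' where "s' = (\<lambda>g. if cd E \<le> cd g + n then s g
       else mvar g - (\<Sum>h | h \<in> G \<and> g \<subset> h. s h))"
    have "(\<Sum>h | h \<in> G \<and> g \<subseteq> h. s' h) = mvar g" if g: "g \<in> G" "cd E \<le> cd g + Suc n" for g
    proof -
      have above: "s' h = s h" if h: "h \<in> G" "g \<subset> h" for h
        using cd_strict[OF h(2)] G_Lat g h by (auto simp: s'_def)
      then have eq: "(\<Sum>h | h \<in> G \<and> g \<subset> h. s' h) = (\<Sum>h | h \<in> G \<and> g \<subset> h. s h)"
        by (intro sum.cong) auto
      show ?thesis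
      proof (cases "cd E \<le> cd g + n")
        case True
        then show ?thesis
          using s[OF g(1) True] g eq by (simp add: sum_above s'_def)
      next
        case False
        then show ?thesis
          using g eq by (simp add: sum_above s'_def)
      qed
    qed
    then show ?case
      by blast
  qed
  from this[of "cd E"] show ?thesis
    by auto
qed

lemma ex_degree_functional:
  "\<exists>D :: 'a set rat_mpoly \<Rightarrow> rat. (\<forall>p q. D (p + q) =
      D p + D q) \<and> (\<forall>c p. D (mconst c * p) = c * D p) \<and>
     (\<forall>M. set_mset M \<subseteq> G \<longrightarrow> D (c_monom M) = of_bool (dhr M))"
proof -
  obtain s :: "'a set \<Rightarrow> 'a set rat_mpoly" where
    s: "\<And>g. g \<in> G \<Longrightarrow> (\<Sum>h | h \<in> G \<and> g \<subseteq> h. s h) = mvar g"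
    using ex_inverse_subst by blast
  obtain f :: "('a set \<Rightarrow>\<^sub>0 nat) \<Rightarrow> 'a set multiset" where f: "\<And>m. exponent (f m) = m"
    using exponent_surj by metis
  have fe: "f (exponent a) = a" for a
    by (rule multiset_eqI) (metis f lookup_expo)
  define D where "D = (\<lambda>p. lin_ext (\<lambda>m. of_bool (dhr (f m))) (mpoly_subst s p))"
  have "mpoly_subst s (c_monom M) = var_monom M" if "set_mset M \<subseteq> G" for M
    using that
    by (induction M) (simp_all add: c_monom_add_mset var_monom_add_mset mpoly_subst_one mpoly_subst_mult cg_eq
        mpoly_subst_sum mpoly_subst_mvar s)
  then have "D (c_monom M) = of_bool (dhr M)" if "set_mset M \<subseteq> G" for M
    using lin_ext_xm[of _ 1 M] that by (simp add: D_def fe)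
  moreover have "D (p + q) = D p + D q" "D (mconst c * p) = c * D p" for p q c
    by (simp_all add: D_def mpoly_subst_add lin_ext_add mpoly_subst_mult mpoly_subst_mconst lin_ext_mconst)
  ultimately show ?thesis
    by blast
qed

definition D :: "'a set rat_mpoly \<Rightarrow> rat" where
  "D = (SOME D. (\<forall>p q. D (p + q) = D p + D q) \<and> (\<forall>c p. D (mconst c * p) = c * D p) \<and>
     (\<forall>M. set_mset M \<subseteq> G \<longrightarrow> D (c_monom M) = of_bool (dhr M)))"

lemma D_add: "D (p + q) = D p + D q"
  and D_scale: "D (mconst c * p) = c * D p"
  and D_cm: "set_mset M \<subseteq> G \<Longrightarrow> D (c_monom M) = of_bool (dhr M)"
  using someI_ex[OF ex_degree_functional] unfolding D_def[symmetric] by blast+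

lemma D_0 [simp]: "D 0 = 0"
  using D_add[of 0 0] by simp

lemma D_uminus: "D (- p) = - D p"
  using D_add[of p "- p"] by simp

lemma D_diff: "D (p - q) = D p - D q"
  using D_add[of p "- q"] by (simp add: D_uminus)

lemma D_sum: "D (sum f A) = (\<Sum>a\<in>A. D (f a))"
  by (induction A rule: infinite_finite_induct) (simp_all add: D_add)

lemma D_sum_above:
  "(\<Sum>k | k \<in> G \<and> h \<subseteq> k. D (p * mvar k * c_monom M)) = D (p * c_monom (add_mset h M))"
  by (simp add: c_monom_add_mset cg_eq sum_distrib_left sum_distrib_right D_sum algebra_simps)

text \<open>Let the variable t be replaced by any k in G. Summing over k above h produces
  \<open>cg h\<close>, so these upper sums are known by the induction hypothesis. Moebius uniqueness
  identifies the value at t with the one supplied by \<open>tight_step\<close>, whose minus sign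
  accounts for one variable.\<close>

lemma D_tight:
  assumes "S \<subseteq> G" "S \<inter> fac E = {}" "\<And>s t. s \<in> S \<Longrightarrow>
      t \<in> S \<Longrightarrow> s \<subseteq> t \<Longrightarrow> s = t" "set_mset M \<subseteq> G"
  shows "D ((\<Prod>s\<in>S. mvar s) * c_monom M) = (- 1) ^ card S * of_bool (tight S M)"
proof -
  have "finite S"
    by (rule finite_subset[OF assms(1) finite_G])
  then show ?thesis
    using assms
  proof (induction S arbitrary: M rule: finite_induct)
    case empty
    have "tight {} M \<longleftrightarrow> dhr M"
    proof
      assume d: "dhr M"
      have "0 < cd_gap M K" if "K \<in> Lat" "flat_bot \<subset> K" for K
        using cd_gap_pos[OF d that(1)] that(2) by (cases "K = flat_bot") auto
      then show "tight {} M"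
        unfolding tight_def using d fac_zer by (auto simp: flat_bot_def)
    qed (simp add: tight_def)
    then show ?case
      using D_cm empty by simp
  next
    case (insert t S)
    have inc: "\<not> t \<subseteq> s" "\<not> s \<subseteq> t" if "s \<in> S" for s
      using insert.prems(3)[of s t] insert.prems(3)[of t s] insert.hyps(2) that by auto
    have SG: "S \<subseteq> G" and tG: "t \<in> G" and tE: "t \<notin> fac E"
      using insert.prems by auto
    obtain w :: "'a set \<Rightarrow> rat" where
      w: "\<And>h. h \<in> G \<Longrightarrow> t \<subseteq> h \<Longrightarrow>
          of_bool (tight S (add_mset h M)) = (\<Sum>k | k \<in> G \<and> h \<subseteq> k. w k)"
      "w t = - of_bool (tight (insert t S) M)"
      using tight_step[OF SG tG insert.prems(4) inc tE] by metis
    have IH: "D ((\<Prod>s\<in>S. mvar s) * c_monom M') = (- 1) ^ card S * of_bool (tight S M')"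
      if "set_mset M' \<subseteq> G" for M'
      using insert.prems that by (intro insert.IH) auto
    have "D ((\<Prod>s\<in>S. mvar s) * mvar t * c_monom M) = (- 1) ^ card S * w t"
    proof (rule moebius_unique[OF tG])
      fix h assume h: "h \<in> G" "t \<subseteq> h"
      show "(\<Sum>k | k \<in> G \<and> h \<subseteq> k. D ((\<Prod>s\<in>S. mvar s) * mvar k * c_monom M)) =
         (\<Sum>k | k \<in> G \<and> h \<subseteq> k. (- 1) ^ card S * w k)"
        using IH[of "add_mset h M"] insert.prems(4) h w(1)[OF h]
        by (simp add: D_sum_above sum_distrib_left[symmetric])
    qed
    then show ?case
      using insert.hyps w(2) by (simp add: algebra_simps)
  qed
qed

text \<open>Every \<open>x\<^sub>s\<close> is a combination of the \<open>c\<^sub>h\<close> with \<open>h \<supseteq> s\<close>, so a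
  monomial in the \<open>x\<^sub>s\<close> expands into monomials \<open>c\<^sub>N\<close> whose indices have moved up.
  Only the effect of this on the counts is recorded.\<close>

definition raised :: "'a set multiset \<Rightarrow> 'a set multiset \<Rightarrow> bool" where
  "raised a N \<longleftrightarrow> set_mset N \<subseteq> G \<and> (\<forall>K. count_below N K \<le>
      count_below a K) \<and> (\<forall>y\<in>fac E. count_below N y = count_below a y)"

lemma raised_empty: "raised {#} {#}"
  by (simp add: raised_def)

lemma raised_add_mset:
  assumes "raised a N" "s \<in> G" "h \<in> G" "s \<subseteq> h"
  shows "raised (add_mset s a) (add_mset h N)"
proof -
  \<comment> \<open>The factor of E above h also contains s, so it is y. This is why counts at
    factors of E are preserved exactly.\<close>
  have "h \<subseteq> y" if "y \<in> fac E" "s \<subseteq> y" for y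
  proof -
    have "h \<subseteq> E"
      using assms G_Lat Lat_subset by auto
    then obtain y' where y': "y' \<in> fac E" "h \<subseteq> y'"
      using factor_above[OF assms(3)] by metis
    then have "y = y'"
      using fac_above_unique[OF E_Lat that(1) y'(1) assms(2) that(2)] assms(4) by auto
    then show ?thesis
      using y' by simp
  qed
  then show ?thesis
    using assms unfolding raised_def count_below_add_mset by (auto simp: le_SucI)
qed

text \<open>Variables are traded for classes one by one: if the value is zero with every
  \<open>cg h\<close> for h above s, then it is zero with \<open>mvar s\<close>, by Moebius
  uniqueness against the zero function.\<close>

lemma D_raise:
  assumes "set_mset a \<subseteq> G" "\<And>N. raised a N \<Longrightarrow> D (p * c_monom N) = 0"
  shows "D (p * var_monom a) = 0"
  using assms
proof (induction a arbitrary: p)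
  case empty
  then show ?case
    using raised_empty by fastforce
next
  case (add s a)
  have "D (p * mvar s * var_monom a) = 0"
  proof (rule add.IH)
    show "set_mset a \<subseteq> G"
      using add.prems by auto
    fix N assume N: "raised a N"
    show "D (p * mvar s * c_monom N) = 0"
    proof (rule moebius_unique[of s])
      show "s \<in> G"
        using add.prems by auto
      fix h assume "h \<in> G" "s \<subseteq> h"
      then show "(\<Sum>k | k \<in> G \<and> h \<subseteq> k. D (p * mvar k * c_monom N)) =
          (\<Sum>k | k \<in> G \<and> h \<subseteq> k. 0)"
        unfolding D_sum_above using add.prems raised_add_mset[OF N] by simp
    qed
  qed
  then show ?case
    by (simp add: var_monom_add_mset algebra_simps)
qed

section \<open>Vanishing of the degree functional\<close>

lemma D_carrier:
  assumes "q \<in> carrier (mpoly_ring G)" "\<And>N. set_mset N \<subseteq> G \<Longrightarrow> D (p * c_monom N) = 0"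
  shows "D (p * q) = 0"
  using assms(1)
proof (induction rule: mpoly_induct)
  case (monom c a)
  have "D (p * var_monom a) = 0"
    using monom assms(2) by (intro D_raise) (auto simp: raised_def)
  then show ?case
    by (simp add: mult.left_commute[of p] D_scale)
qed (simp add: distrib_left D_add)

lemma not_fac_E:
  assumes "g \<in> G" "s \<subset> g"
  shows "s \<notin> fac E"
  using fac_maximal[of s E g] assms Lat_subset[OF G_Lat] by auto

text \<open>If A were tight, the gap would be \<open>card A\<close> at its join and larger at g. But
  the b copies of g count below g and not below the join, and the bound on b makes the gap at g no
  larger than at the join.\<close>

lemma D_relation_antichain:
  assumes "A \<subseteq> G" "\<And>s. s \<in> A \<Longrightarrow>
      s \<subset> g" "\<And>s t. s \<in> A \<Longrightarrow> t \<in> A \<Longrightarrow> s \<subseteq> t \<Longrightarrow> s = t"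
    "g \<in> G" "cd g \<le> b + cd (flat_join A)" "set_mset M \<subseteq> G"
  shows "D ((\<Prod>s\<in>A. mvar s) * (cg g ^ b * c_monom M)) = 0"
proof -
  let ?M = "replicate_mset b g + M"
  have AL: "A \<subseteq> Lat"
    using assms G_sub_Lat by auto
  have VL: "flat_join A \<in> Lat"
    by (rule flat_join_Lat[OF AL])
  have gL: "g \<in> Lat"
    using assms G_Lat by auto
  have MG: "set_mset ?M \<subseteq> G"
    using assms by auto
  have "\<not> tight A ?M"
  proof
    assume T: "tight A ?M"
    have Vg: "flat_join A \<subseteq> g"
      using assms gL by (intro flat_join_least) auto
    have "flat_join A \<noteq> g"
      using tightD(2)[OF T] fac_self[OF assms(4)] assms(2) by auto
    with Vg have lt: "flat_join A \<subset> g" "\<not> g \<subseteq> flat_join A"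
      by auto
    have "cd_gap ?M (flat_join A) = int (card A)"
      by (rule cd_gap_join_tight[OF T MG AL])
    moreover have "count_below M (flat_join A) \<le> count_below M g"
      by (rule count_below_mono[OF Vg])
    ultimately show False
      using tightD(4)[OF T gL lt(1)] assms(5) lt(2) by (simp add: cd_gap_def count_below_replicate)
  qed
  moreover have "A \<inter> fac E = {}"
    using not_fac_E assms by auto
  ultimately show ?thesis
    using D_tight[OF assms(1) _ assms(3) MG] by (simp add: c_monom_union c_monom_replicate)
qed

lemma flat_join_maximal:
  assumes "T \<subseteq> Lat"
  shows "flat_join {u\<in>T. \<forall>v\<in>T. u \<subseteq> v \<longrightarrow> u = v} = flat_join T"
proof (rule flat_join_eqI)
  let ?A = "{u\<in>T. \<forall>v\<in>T. u \<subseteq> v \<longrightarrow> u = v}"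
  show AL: "?A \<subseteq> Lat" and TL: "flat_join T \<in> Lat"
    using assms flat_join_Lat by auto
  show "a \<subseteq> flat_join T" if "a \<in> ?A" for a
    using that flat_join_upper[OF assms] by auto
  show "flat_join T \<subseteq> flat_join ?A"
  proof (rule flat_join_least[OF _ flat_join_Lat[OF AL]])
    fix s assume "s \<in> T"
    then obtain u where u: "u \<in> T" "s \<subseteq> u" "\<forall>v\<in>T. u \<subseteq> v \<longrightarrow> u = v"
      using finite_has_maximal2[OF finite_subset[OF assms finite_Lat], of s] by metis
    have "u \<subseteq> flat_join ?A"
      by (rule flat_join_upper[OF AL]) (use u in simp)
    then show "s \<subseteq> flat_join ?A"
      using u(2) by simp
  qed
qed

lemma prod_mvar: "finite S \<Longrightarrow> (\<Prod>s\<in>S. mvar s) = var_monom (mset_set S)"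
  by (simp add: var_monom_def prod_unfold_prod_mset)

text \<open>The maximal variables strictly below g form an antichain with the same join and are
  kept. All other variables and q are expanded into classes, which the antichain case absorbs into
  its multiset.\<close>

lemma D_relation:
  assumes "S \<subseteq> G" "g \<in> G" "cd g \<le> b + cd (flat_join {s \<in> S. s \<subset> g})" "q \<in>
      carrier (mpoly_ring G)"
  shows "D ((\<Prod>s\<in>S. mvar s) * cg g ^ b * q) = 0"
proof (rule D_carrier[OF assms(4)])
  fix N assume N: "set_mset N \<subseteq> G"
  let ?T = "{s \<in> S. s \<subset> g}"
  let ?A = "{u\<in>?T. \<forall>v\<in>?T. u \<subseteq> v \<longrightarrow> u = v}"
  have fin: "finite S"
    using assms finite_G finite_subset by auto
  have "flat_join ?A = flat_join ?T"
    using assms G_sub_Lat by (intro flat_join_maximal) auto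
  then have A: "D ((\<Prod>s\<in>?A. mvar s) * (cg g ^ b * c_monom M)) = 0" if "set_mset M \<subseteq> G" for M
    using assms that by (intro D_relation_antichain) auto
  have "D ((\<Prod>s\<in>?A. mvar s) * (cg g ^ b * c_monom N) * var_monom (mset_set (S - ?A))) = 0"
  proof (rule D_raise)
    show "set_mset (mset_set (S - ?A)) \<subseteq> G"
      using assms fin by auto
    fix M assume "raised (mset_set (S - ?A)) M"
    then have "set_mset (N + M) \<subseteq> G"
      using N by (auto simp: raised_def)
    from A[OF this] show "D ((\<Prod>s\<in>?A. mvar s) * (cg g ^ b * c_monom N) * c_monom M) = 0"
      by (simp add: c_monom_union algebra_simps)
  qed
  moreover have "(\<Prod>s\<in>S. mvar s) = (\<Prod>s\<in>?A. mvar s) * (\<Prod>s\<in>S - ?A. mvar s :: 'a set rat_mpoly)"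
    using fin by (intro prod.subset_diff[THEN trans]) (auto simp: mult.commute)
  ultimately show "D ((\<Prod>s\<in>S. mvar s) * cg g ^ b * c_monom N) = 0"
    using fin by (simp add: prod_mvar algebra_simps)
qed

text \<open>One variable t is kept and the others become classes, whose count below t can only fall.
  Tightness of \<open>{t}\<close> needs a count of exactly \<open>cd t - 1\<close>. The kept
  variable is itself part of \<open>count_below a t\<close>, so the classes stay below this
  number.\<close>

lemma D_tight_vanish:
  assumes "set_mset a \<subseteq> G" "set_mset M \<subseteq> G" "t \<in># a" "t \<notin> fac E" "count_below a
      t + count_below M t < cd t"
  shows "D (var_monom a * c_monom M) = 0"
proof -
  obtain a' where a: "a = add_mset t a'"
    using assms(3) by (metis mset_add)
  have "D (mvar t * c_monom M * var_monom a') = 0"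
  proof (rule D_raise)
    show "set_mset a' \<subseteq> G"
      using assms a by auto
    fix N assume N: "raised a' N"
    then have MN: "set_mset (M + N) \<subseteq> G" "count_below N t \<le> count_below a' t"
      using assms by (auto simp: raised_def)
    have "\<not> tight {t} (M + N)"
    proof
      assume "tight {t} (M + N)"
      then have "cd_gap (M + N) t = 1"
        using tightD(3) by blast
      then show False
        using assms(5) MN(2) a by (simp add: cd_gap_def count_below_add_mset)
    qed
    then show "D (mvar t * c_monom M * c_monom N) = 0"
      using D_tight[of "{t}" "M + N"] assms MN a by (simp add: c_monom_union algebra_simps)
  qed
  then show ?thesis
    by (simp add: a var_monom_add_mset algebra_simps)
qed

text \<open>Raising preserves the counts at factors of E, so every class monomial that arises
  violates \<open>dhr\<close> at y.\<close>

lemma D_fac_vanish: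
  assumes "set_mset a \<subseteq> G" "set_mset M \<subseteq> G" "y \<in> fac E" "cd y \<le> count_below a y +
      count_below M y"
  shows "D (var_monom a * c_monom M) = 0"
proof -
  have "D (c_monom M * var_monom a) = 0"
  proof (rule D_raise[OF assms(1)])
    fix N assume N: "raised a N"
    have "cd y \<le> count_below (M + N) y"
      using N assms(3,4) by (simp add: raised_def)
    then have "\<not> dhr (M + N)"
      using G_nonzer[OF fac_in_G[OF assms(3)]] fac_Lat[OF assms(3)] unfolding dhr_def by force
    then show "D (c_monom M * c_monom N) = 0"
      using D_cm[of "M + N"] assms N by (simp add: c_monom_union raised_def)
  qed
  then show ?thesis
    by (simp add: mult.commute)
qed


section \<open>Nested sets\<close>

text \<open>The power at which \<open>cg g\<close> is killed by the variables of T strictly below g,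
  and also the rank that g adds to their join.\<close>

definition cd_drop :: "'a set set \<Rightarrow> 'a set \<Rightarrow> nat" where
  "cd_drop T g = cd g - cd (flat_join {s \<in> T. s \<subset> g})"

text \<open>Equivalent to the usual condition that no antichain of at least two members of T has its
  join in G: such an antichain lies strictly below its join, and conversely, if the members strictly
  below g join to g, the maximal ones among them form such an antichain.\<close>

definition nested :: "'a set set \<Rightarrow> bool" where
  "nested T \<longleftrightarrow> T \<subseteq> G \<and> (\<forall>g\<in>G. flat_join {s \<in> T. s \<subset> g} \<noteq> g)"

lemma flat_join_filter:
  assumes "T \<subseteq> G"
  shows "flat_join {s \<in> T. P s} \<in> Lat"
  using assms G_sub_Lat by (intro flat_join_Lat) auto

lemma flat_join_below:
  assumes "T \<subseteq> G" "K \<in> Lat"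
  shows "flat_join {s \<in> T. s \<subseteq> K} \<subseteq> K" "flat_join {s \<in> T. s \<subset> K} \<subseteq> K"
  using assms(2) by (rule flat_join_least[rotated]; blast)+

lemma cd_join_below:
  assumes "T \<subseteq> G" "K \<in> Lat"
  shows "cd (flat_join {s \<in> T. s \<subset> K}) \<le> cd K" "cd (flat_join {s \<in> T. s \<subseteq> K}) \<le> cd K"
  using flat_join_below[OF assms] assms(2) cd_le by auto

lemma nested_lt:
  assumes "nested T" "g \<in> G"
  shows "cd (flat_join {s \<in> T. s \<subset> g}) < cd g"
proof -
  have TG: "T \<subseteq> G"
    using assms by (simp add: nested_def)
  have "flat_join {s \<in> T. s \<subset> g} \<subset> g"
    using assms flat_join_below(2)[OF TG G_Lat[OF assms(2)]] by (auto simp: nested_def)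
  then show ?thesis
    by (rule cd_strict[OF _ flat_join_filter[OF TG] G_Lat[OF assms(2)]])
qed

lemma cd_drop_pos: "nested T \<Longrightarrow> g \<in> G \<Longrightarrow> 0 < cd_drop T g"
  using nested_lt by (simp add: cd_drop_def)

lemma nested_subset:
  assumes "nested T" "U \<subseteq> T"
  shows "nested U"
proof -
  have TG: "T \<subseteq> G"
    using assms by (simp add: nested_def)
  have "flat_join {s \<in> U. s \<subset> g} \<noteq> g" if g: "g \<in> G" for g
  proof
    assume eq: "flat_join {s \<in> U. s \<subset> g} = g"
    have "flat_join {s \<in> U. s \<subset> g} \<subseteq> flat_join {s \<in> T. s \<subset> g}"
      using assms TG G_sub_Lat by (intro flat_join_mono) auto
    then have "cd g \<le> cd (flat_join {s \<in> T. s \<subset> g})"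
      using eq cd_le[OF _ flat_join_filter[OF TG]] by auto
    then show False
      using nested_lt[OF assms(1) g] by simp
  qed
  then show ?thesis
    using assms by (auto simp: nested_def)
qed

text \<open>A factor y of the join of A is the join of the members of A below y. If y were not in A,
  these would lie strictly below y, against nestedness.\<close>

lemma nested_fac:
  assumes "nested T" "A \<subseteq> T"
  shows "fac (flat_join A) \<subseteq> A"
proof
  fix y assume y: "y \<in> fac (flat_join A)"
  have TG: "T \<subseteq> G"
    using assms by (simp add: nested_def)
  have AL: "A \<subseteq> Lat"
    using assms TG G_sub_Lat by auto
  let ?z = "\<lambda>y. flat_join {a \<in> A. a \<subseteq> y}"
  have zL: "?z u \<in> Lat" for u
    using AL by (intro flat_join_Lat) auto
  have zle: "?z u \<subseteq> u" if "u \<in> fac (flat_join A)" for u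
    using fac_Lat[OF that] by (intro flat_join_least) auto
  have "flat_join (?z ` fac (flat_join A)) = flat_join A"
  proof (rule flat_join_eqI)
    show "flat_join A \<subseteq> flat_join (?z ` fac (flat_join A))"
    proof (rule flat_join_least)
      fix a assume a: "a \<in> A"
      then obtain u where u: "u \<in> fac (flat_join A)" "a \<subseteq> u"
        using factor_above[OF _ flat_join_upper[OF AL a]] assms(2) TG by (metis subsetD)
      have "a \<subseteq> ?z u"
        using AL a u by (intro flat_join_upper) auto
      also have "\<dots> \<subseteq> flat_join (?z ` fac (flat_join A))"
        using zL u by (intro flat_join_upper) auto
      finally show "a \<subseteq> flat_join (?z ` fac (flat_join A))" .
    qed (use zL in \<open>auto intro: flat_join_Lat\<close>)
    show "a \<subseteq> flat_join A" if "a \<in> ?z ` fac (flat_join A)" for a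
      using that zle fac_le by blast
  qed (use zL AL in \<open>auto intro: flat_join_Lat\<close>)
  then have "y = ?z y"
    using Int_join_fac[OF flat_join_Lat[OF AL] zL zle y] fac_le[OF y] by auto
  show "y \<in> A"
  proof (rule ccontr)
    assume "y \<notin> A"
    then have "{a \<in> A. a \<subseteq> y} \<subseteq> {s \<in> T. s \<subset> y}"
      using assms by auto
    then have "?z y \<subseteq> flat_join {s \<in> T. s \<subset> y}"
      using TG G_sub_Lat by (intro flat_join_mono) auto
    then have "cd y \<le> cd (flat_join {s \<in> T. s \<subset> y})"
      using \<open>y = ?z y\<close> cd_le[OF _ flat_join_filter[OF TG]] by auto
    then show False
      using nested_lt[OF assms(1) fac_in_G[OF y]] by simp
  qed
qed

text \<open>A maximal t of A is a factor of the join. Deleting it replaces the coordinate t by the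
  join of the members of T strictly below t, which all belong to A, so the rank falls by
  \<open>cd_drop T t\<close>.\<close>

lemma cd_join_nested:
  assumes "nested T" "A \<subseteq> T" "\<And>a s. a \<in> A \<Longrightarrow> s \<in> T \<Longrightarrow>
      s \<subseteq> a \<Longrightarrow> s \<in> A"
  shows "cd (flat_join A) = (\<Sum>t\<in>A. cd_drop T t)"
proof -
  have TG: "T \<subseteq> G"
    using assms by (simp add: nested_def)
  have finA: "finite A"
    using assms(2) TG finite_G by (meson finite_subset)
  show ?thesis
    using assms(2,3)
  proof (induction "card A" arbitrary: A)
    case 0
    moreover have "finite A"
      using 0(2) TG finite_G by (meson finite_subset)
    ultimately have "A = {}"
      by simp
    then show ?case
      using cd_zer by (simp add: flat_bot_def)
  next
    case (Suc n)
    have fin: "finite A"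
      using Suc.prems TG finite_G by (meson finite_subset)
    moreover have "A \<noteq> {}"
      using Suc.hyps by auto
    ultimately obtain t where t: "t \<in> A" "\<And>u. u \<in> A \<Longrightarrow> t \<subseteq> u \<Longrightarrow> t = u"
      using finite_has_maximal[of A] by metis
    let ?A = "A - {t}" and ?X = "flat_join A" and ?J = "flat_join {s \<in> T. s \<subset> t}"
    have AL: "A \<subseteq> Lat" and XL: "?X \<in> Lat"
      using Suc.prems TG G_sub_Lat flat_join_Lat by auto
    have AL': "?A \<subseteq> Lat"
      using AL by auto
    have JL: "?J \<in> Lat"
      by (rule flat_join_filter[OF TG])
    have tL: "t \<in> Lat"
      using t AL by auto
    have Jt: "?J \<subseteq> t"
      by (rule flat_join_below(2)[OF TG tL])
    have facA: "fac ?X \<subseteq> A"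
      by (rule nested_fac[OF assms(1) Suc.prems(1)])
    obtain y where y: "y \<in> fac ?X" "t \<subseteq> y"
      using factor_above[OF _ flat_join_upper[OF AL t(1)]] t(1) Suc.prems(1) TG by (metis subsetD)
    then have tX: "t \<in> fac ?X"
      using t(2)[of y] facA by auto
    let ?z = "\<lambda>y. if y = t then ?J else y"
    have z: "?z y \<in> Lat" "?z y \<subseteq> y" if "y \<in> fac ?X" for y
      using that JL Jt fac_Lat by auto
    have zL: "?z ` fac ?X \<subseteq> Lat"
      using z by blast
    have "flat_join (?z ` fac ?X) = flat_join ?A"
    proof (rule antisym)
      show "flat_join (?z ` fac ?X) \<subseteq> flat_join ?A"
      proof (rule flat_join_least[OF _ flat_join_Lat[OF AL']])
        fix b assume "b \<in> ?z ` fac ?X"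
        then obtain y where y: "y \<in> fac ?X" "b = ?z y"
          by blast
        show "b \<subseteq> flat_join ?A"
        proof (cases "y = t")
          case True
          have "{s \<in> T. s \<subset> t} \<subseteq> ?A"
            using Suc.prems(2)[OF t(1)] by auto
          then show ?thesis
            using y True flat_join_mono[OF _ AL'] by simp
        next
          case False
          then have "y \<in> ?A"
            using facA y by auto
          then show ?thesis
            using y False flat_join_upper[OF AL'] by simp
        qed
      qed
      show "flat_join ?A \<subseteq> flat_join (?z ` fac ?X)"
      proof (rule flat_join_least[OF _ flat_join_Lat[OF zL]])
        fix a assume a: "a \<in> ?A"
        then have "a \<subseteq> ?X" "a \<in> G"
          using flat_join_upper[OF AL] Suc.prems TG by auto
        then obtain y where y: "y \<in> fac ?X" "a \<subseteq> y"
          using factor_above[of a ?X] by blast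
        have "a \<subseteq> ?z y"
        proof (cases "y = t")
          case True
          then have "a \<in> {s \<in> T. s \<subset> t}"
            using a y Suc.prems by auto
          then have "a \<subseteq> ?J"
            using TG G_sub_Lat by (intro flat_join_upper) auto
          then show ?thesis
            using True by simp
        qed (use y in simp)
        also have "\<dots> \<subseteq> flat_join (?z ` fac ?X)"
          by (rule flat_join_upper[OF zL]) (use y in blast)
        finally show "a \<subseteq> flat_join (?z ` fac ?X)" .
      qed
    qed
    then have "cd (flat_join ?A) = (\<Sum>y\<in>fac ?X. cd (?z y))"
      using cd_join_sub[OF XL z] by simp
    also have "\<dots> = cd ?J + (\<Sum>y\<in>fac ?X - {t}. cd y)"
      using tX by (simp add: sum.remove)
    finally have 1: "cd (flat_join ?A) = cd ?J + (\<Sum>y\<in>fac ?X - {t}. cd y)" .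
    have 2: "cd ?X = cd t + (\<Sum>y\<in>fac ?X - {t}. cd y)"
      using cd_fac[OF XL] tX by (simp add: sum.remove)
    have "cd (flat_join ?A) = (\<Sum>s\<in>?A. cd_drop T s)"
    proof (rule Suc.hyps(1))
      show "n = card ?A"
        using Suc.hyps(2) t fin by simp
      show "?A \<subseteq> T"
        using Suc.prems by auto
      show "s \<in> ?A" if "a \<in> ?A" "s \<in> T" "s \<subseteq> a" for a s
        using that Suc.prems(2)[of a s] t(2)[of a] by auto
    qed
    moreover have "cd ?J \<le> cd t"
      by (rule cd_le[OF Jt tL])
    ultimately have "cd ?X = (\<Sum>s\<in>?A. cd_drop T s) + cd_drop T t"
      using 1 2 by (simp add: cd_drop_def)
    then show ?case
      using t(1) fin by (simp add: sum.remove[of A t])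
  qed
qed

lemma nested_sum_le:
  assumes "nested T"
  shows "(\<Sum>t | t \<in> T \<and> t \<subseteq> K. cd_drop T t) = cd (flat_join {t \<in> T. t \<subseteq> K})"
    "(\<Sum>t | t \<in> T \<and> t \<subset> K. cd_drop T t) = cd (flat_join {t \<in> T. t \<subset> K})"
  by (rule cd_join_nested[OF assms, symmetric]; auto)+

lemma nested_lt_notin:
  assumes "nested T" "h \<in> G" "h \<notin> T"
  shows "cd (flat_join {t \<in> T. t \<subseteq> h}) < cd h"
proof -
  have "{t \<in> T. t \<subseteq> h} = {t \<in> T. t \<subset> h}"
    using assms(3) by auto
  then show ?thesis
    using nested_lt[OF assms(1,2)] by simp
qed

section \<open>Standard monomials and their duals\<close>

definition mset_of_fun :: "('a set \<Rightarrow> nat) \<Rightarrow> 'a set multiset" where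
  "mset_of_fun n = (\<Sum>g\<in>G. replicate_mset (n g) g)"

lemma count_msum: "count (mset_of_fun n) g = (if g \<in> G then n g else 0)"
  using finite_G by (simp add: mset_of_fun_def count_sum)

lemma set_msum: "set_mset (mset_of_fun n) \<subseteq> G"
  by (metis count_msum not_in_iff subsetI)

lemma count_below_eq_sum:
  assumes "set_mset M \<subseteq> G"
  shows "count_below M K = (\<Sum>g | g \<in> G \<and> g \<subseteq> K. count M g)"
  using assms
proof (induction M)
  case (add h M)
  have "(\<Sum>g | g \<in> G \<and> g \<subseteq> K. count (add_mset h M) g) =
      (\<Sum>g | g \<in> G \<and> g \<subseteq> K. count M g + (if g = h then 1 else 0))"
    by (intro sum.cong) auto
  also have "\<dots> = count_below M K + (\<Sum>g | g \<in> G \<and> g \<subseteq> K. if g = h then 1 else 0)"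
    using add by (simp add: sum.distrib)
  also have "(\<Sum>g | g \<in> G \<and> g \<subseteq> K. if g = h then 1 else 0) =
      (if h \<subseteq> K then 1 else (0::nat))"
    using add.prems by (subst sum.delta) auto
  finally show ?case
    by (simp add: count_below_add_mset)
qed simp

lemma count_below_mset_set: "finite S \<Longrightarrow> count_below (mset_set S) K = card {s \<in> S. s \<subseteq> K}"
  by (simp add: count_below_def)

lemma count_below_E:
  assumes "set_mset M \<subseteq> G"
  shows "count_below M E = size M"
proof -
  have "filter_mset (\<lambda>g. g \<subseteq> E) M = M"
    using assms G_Lat Lat_subset by (auto simp: filter_mset_eq_conv)
  then show ?thesis
    by (simp add: count_below_def)
qed

definition standard :: "'a set multiset \<Rightarrow> bool" where
  "standard a \<longleftrightarrow> set_mset a \<subseteq> G \<and> (\<forall>g\<in>G. count a g + cd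
      (flat_join {s \<in> set_mset a. s \<subset> g}) < cd g)"

text \<open>Outside the factors of E only positive exponents are complemented, to
  \<open>cd_drop\<close>, and absent variables stay absent. At a factor of E variable and class
  coincide and all exponents from 0 to \<open>cd_drop - 1\<close> occur, so the complement is taken
  to \<open>cd_drop - 1\<close>, also when the factor is absent from a.\<close>

definition dual :: "'a set multiset \<Rightarrow> 'a set multiset" where
  "dual a = mset_of_fun (\<lambda>g. if g \<in> fac E then cd_drop (set_mset a) g - 1 - count a g
     else if g \<in># a then cd_drop (set_mset a) g - count a g else 0)"

lemma standard_G: "standard a \<Longrightarrow> set_mset a \<subseteq> G"
  by (simp add: standard_def)

lemma standard_nested: "standard a \<Longrightarrow> nested (set_mset a)"
  by (auto simp: standard_def nested_def)

lemma standard_count: "standard a \<Longrightarrow> g \<in> G \<Longrightarrow> count a g < cd_drop (set_mset a) g"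
  by (auto simp: standard_def cd_drop_def less_diff_conv)

lemma dual_G: "set_mset (dual a) \<subseteq> G"
  unfolding dual_def by (rule set_msum)

lemma below_not_fac:
  assumes "t \<in> G" "t \<notin> fac E" "g \<subseteq> t"
  shows "g \<notin> fac E"
  using fac_maximal[of g E t] Lat_subset[OF G_Lat] assms by auto

text \<open>At each support element of a below t the two exponents add up to its drop, and the drops
  add up to the rank of the join.\<close>

lemma count_below_dual:
  assumes "standard a" "t \<in> G" "t \<notin> fac E"
  shows "count_below (dual a) t + count_below a t = cd (flat_join {s \<in> set_mset a. s \<subseteq> t})"
proof -
  let ?T = "set_mset a"
  have "count_below (dual a) t + count_below a t =
      (\<Sum>g | g \<in> G \<and> g \<subseteq> t. count (dual a) g + count a g)"
    using assms(1) by (simp add: count_below_eq_sum dual_G standard_G sum.distrib)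
  also have "\<dots> = (\<Sum>g | g \<in> G \<and> g \<subseteq> t. if g \<in> ?T then cd_drop ?T g else 0)"
  proof (rule sum.cong[OF refl])
    fix g assume "g \<in> {g. g \<in> G \<and> g \<subseteq> t}"
    then have g: "g \<in> G" "g \<notin> fac E"
      using below_not_fac assms by auto
    then show "count (dual a) g + count a g = (if g \<in> ?T then cd_drop ?T g else 0)"
      using standard_count[OF assms(1) g(1)] by (simp add: dual_def count_msum not_in_iff)
  qed
  also have "\<dots> = (\<Sum>g | g \<in> ?T \<and> g \<subseteq> t. cd_drop ?T g)"
    using standard_G[OF assms(1)] by (intro sum.mono_neutral_cong_right) auto
  finally show ?thesis
    using nested_sum_le(1)[OF standard_nested[OF assms(1)]] by simp
qed

text \<open>The missing unit comes from y, whose two exponents add up to \<open>cd_drop - 1\<close>;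
  everything in G strictly below y is a non-factor.\<close>

lemma count_below_dual_fac:
  assumes "standard a" "y \<in> fac E"
  shows "Suc (count_below (dual a) y + count_below a y) = cd y"
proof -
  let ?T = "set_mset a"
  have yG: "y \<in> G"
    by (rule fac_in_G[OF assms(2)])
  have "count_below (dual a) y + count_below a y =
      (\<Sum>g | g \<in> G \<and> g \<subseteq> y. count (dual a) g + count a g)"
    using assms(1) by (simp add: count_below_eq_sum dual_G standard_G sum.distrib)
  also have "\<dots> = count (dual a) y + count a y + (\<Sum>g | g \<in> G \<and> g \<subset> y. count (dual a)
      g + count a g)"
  proof -
    have "{g. g \<in> G \<and> g \<subseteq> y} = insert y {g. g \<in> G \<and> g \<subset> y}"
      using yG by auto
    then show ?thesis
      by simp
  qed
  also have "(\<Sum>g | g \<in> G \<and> g \<subset> y. count (dual a) g + count a g) =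
      (\<Sum>g | g \<in> G \<and> g \<subset> y. if g \<in> ?T then cd_drop ?T g else 0)"
  proof (rule sum.cong[OF refl])
    fix g assume "g \<in> {g. g \<in> G \<and> g \<subset> y}"
    then have g: "g \<in> G" "g \<notin> fac E"
      using not_fac_E[OF yG] by auto
    then show "count (dual a) g + count a g = (if g \<in> ?T then cd_drop ?T g else 0)"
      using standard_count[OF assms(1) g(1)] by (simp add: dual_def count_msum not_in_iff)
  qed
  also have "\<dots> = (\<Sum>g | g \<in> ?T \<and> g \<subset> y. cd_drop ?T g)"
    using standard_G[OF assms(1)] by (intro sum.mono_neutral_cong_right) auto
  also have "\<dots> = cd (flat_join {s \<in> ?T. s \<subset> y})"
    using nested_sum_le(2)[OF standard_nested[OF assms(1)]] by simp
  finally have "count_below (dual a) y + count_below a y =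
      count (dual a) y + count a y + cd (flat_join {s \<in> ?T. s \<subset> y})" .
  moreover have "count (dual a) y = cd_drop ?T y - 1 - count a y"
    using assms yG by (simp add: dual_def count_msum)
  moreover have "count a y < cd_drop ?T y"
    by (rule standard_count[OF assms(1) yG])
  ultimately show ?thesis
    by (simp add: cd_drop_def)
qed

lemma size_dual:
  assumes "standard a"
  shows "size a + size (dual a) + card (fac E) = cd E"
proof -
  have "size a + size (dual a) = (\<Sum>y\<in>fac E. count_below (dual a) y + count_below a y)"
    using count_below_fac[OF E_Lat] standard_G[OF assms] dual_G by (simp add: count_below_E[symmetric] sum.distrib)
  then have "size a + size (dual a) + card (fac E) = (\<Sum>y\<in>fac E. Suc (count_below (dual a) y + count_below a y))"
    by (simp add: sum_Suc)
  also have "\<dots> = cd E"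
    using count_below_dual_fac[OF assms] cd_fac[OF E_Lat] by simp
  finally show ?thesis .
qed

text \<open>The weight orders exponents so that the pairing of standard monomials with dual monomials
  is triangular for the lexicographic order; an exponent \<open>0\<close> has to be the largest
  one outside the factors of \<open>E\<close>, which \<open>1 / 0 = 0\<close> provides.\<close>

definition lex_weight :: "'a set \<Rightarrow> nat \<Rightarrow> rat" where
  "lex_weight t n = (if t \<in> fac E then - of_nat n else - (1 / of_nat n))"

lemma lex_weight_inj: "lex_weight t m = lex_weight t n \<Longrightarrow> m = n"
  by (auto simp: lex_weight_def split: if_splits)

text \<open>The counts of a and b below t differ only by the exponents at t, and a nonzero value
  excludes both vanishing criteria. At a factor of E this bounds the exponent in a from above;
  elsewhere it bounds it from below, provided that t occurs in a.\<close>

lemma triangular: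
  assumes "standard a" "standard b" "D (var_monom a * c_monom (dual b)) \<noteq> 0" "t \<in> G" "count a t
      \<noteq> count b t"
    and agree: "\<And>s. s \<in> G \<Longrightarrow> s \<subset> t \<Longrightarrow> count a s = count b s"
  shows "lex_weight t (count b t) < lex_weight t (count a t)"
proof -
  have eq: "count_below a t + count b t = count_below b t + count a t"
  proof -
    have "{g. g \<in> G \<and> g \<subseteq> t} = insert t {g. g \<in> G \<and> g \<subset> t}"
      using assms(4) by auto
    moreover have "(\<Sum>g | g \<in> G \<and> g \<subset> t. count a g) =
        (\<Sum>g | g \<in> G \<and> g \<subset> t. count b g)"
      using agree by (intro sum.cong) auto
    ultimately show ?thesis
      using count_below_eq_sum[OF standard_G[OF assms(1)], of t] count_below_eq_sum[OF standard_G[OF assms(2)], of t]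
      by simp
  qed
  show ?thesis
  proof (cases "t \<in> fac E")
    case True
    have "count_below a t + count_below (dual b) t < cd t"
      using D_fac_vanish[OF standard_G[OF assms(1)] dual_G True] assms(3) by (meson not_le)
    then have "count a t < count b t"
      using count_below_dual_fac[OF assms(2) True] eq assms(5) by linarith
    then show ?thesis
      using True by (simp add: lex_weight_def)
  next
    case False
    show ?thesis
    proof (cases "t \<in># a")
      case True
      have "cd t \<le> count_below a t + count_below (dual b) t"
        using D_tight_vanish[OF standard_G[OF assms(1)] dual_G True False] assms(3) by (meson not_le)
      moreover have dl: "count_below (dual b) t + count_below b t = cd (flat_join {s \<in> set_mset b. s \<subseteq> t})"
        by (rule count_below_dual[OF assms(2,4) False])
      moreover have "cd (flat_join {s \<in> set_mset b. s \<subseteq> t}) \<le> cd t"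
        using cd_join_below(2)[OF standard_G[OF assms(2)] G_Lat[OF assms(4)]] .
      ultimately have lt: "count b t < count a t" "cd t + count b t \<le> count a t + cd (flat_join {s \<in>
          set_mset b. s \<subseteq> t})"
        using eq assms(5) by linarith+
      \<comment> \<open>If t were absent from b, the support of b up to t would be the support of a
        strictly below t, and the second inequality would contradict that a is standard. The
        exponent in b is thus positive, as the comparison of reciprocals requires.\<close>
      have "t \<in># b"
      proof (rule ccontr)
        assume tb: "t \<notin># b"
        have "s \<in># b \<longleftrightarrow> s \<in># a" if "s \<subset> t" for s
        proof (cases "s \<in> G")
          case True
          show ?thesis
            using agree[OF True that] by (metis not_in_iff)
        next
          case False
          then show ?thesis
            using standard_G[OF assms(1)] standard_G[OF assms(2)] by auto
        qed
        then have "{s \<in> set_mset b. s \<subseteq> t} = {s \<in> set_mset a. s \<subset> t}"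
          using tb by blast
        then show False
          using lt(2) assms(1,4) by (auto simp: standard_def)
      qed
      then have "0 < count b t"
        by simp
      then show ?thesis
        using lt(1) False by (simp add: lex_weight_def frac_less2)
    next
      case nt: False
      then have "count a t = 0" "0 < count b t"
        using assms(5) by (auto simp: not_in_iff)
      then show ?thesis
        using False by (simp add: lex_weight_def)
    qed
  qed
qed

section \<open>The diagonal of the pairing\<close>

text \<open>The classes left on the diagonal once all but one copy of every non-factor variable have
  been converted; they depend only on the set T of these variables.\<close>

definition top_mset :: "'a set set \<Rightarrow> 'a set multiset" where
  "top_mset T = mset_of_fun (\<lambda>g. if g \<in> T \<union> fac E then cd_drop T g - 1 else 0)"

lemma cg_fac: "y \<in> fac E \<Longrightarrow> cg y = mvar y"
proof -
  assume y: "y \<in> fac E"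
  have "{h. h \<in> G \<and> y \<subseteq> h} = {y}"
    using fac_in_G[OF y] fac_maximal[OF y] Lat_subset[OF G_Lat] by auto
  then show ?thesis
    by (simp add: cg_eq)
qed

text \<open>Modulo terms killed by \<open>D\<close>, a variable \<open>x\<^sub>t\<close> may be replaced by \<open>c\<^sub>t\<close>
  if the product leaves no slack at \<open>t\<close>, and below \<open>c\<^sub>t\<close> may be
  replaced by the class of the factor of \<open>E\<close> above \<open>t\<close>.\<close>

lemma D_convert:
  assumes "finite T" "T \<subseteq> G" "T \<inter> fac E = {}" "set_mset r \<subseteq> T" "set_mset M \<subseteq> G"
    "\<And>t. t \<in> T \<Longrightarrow> card {s \<in> T. s \<subseteq> t} + count_below r t + count_below M t \<le> cd t"
  shows "D (var_monom (mset_set T) * var_monom r * c_monom M) = D (var_monom (mset_set T) * c_monom (r + M))"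
  using assms(4,5,6)
proof (induction r arbitrary: M)
  case (add t r)
  have tT: "t \<in> T"
    using add.prems by auto
  have tG: "t \<in> G"
    using tT assms by auto
  let ?x = "var_monom (mset_set T) * var_monom r * c_monom M"
  \<comment> \<open>Trading this copy of t for a strictly larger h lowers the count below t by one,
    which leaves slack there, and t is still present through \<open>mset_set T\<close>.\<close>
  have van: "D (mvar h * ?x) = 0" if h: "h \<in> G" "t \<subset> h" for h
  proof -
    let ?a = "add_mset h (mset_set T + r)"
    have "D (var_monom ?a * c_monom M) = 0"
    proof (rule D_tight_vanish)
      show "set_mset ?a \<subseteq> G"
        using assms h add.prems by auto
      show "set_mset M \<subseteq> G"
        by fact
      show "t \<in># ?a" "t \<notin> fac E"
        using tT assms by auto
      show "count_below ?a t + count_below M t < cd t"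
      proof -
        have "\<not> h \<subseteq> t"
          using h by auto
        then show ?thesis
          using add.prems(3)[OF tT] assms(1) by (simp add: count_below_add_mset count_below_mset_set)
      qed
    qed
    then show ?thesis
      by (simp add: var_monom_add_mset var_monom_union algebra_simps)
  qed
  have "D (var_monom (mset_set T) * var_monom (add_mset t r) * c_monom M) = D (mvar t * ?x)"
    by (simp add: var_monom_add_mset algebra_simps)
  also have "\<dots> = D (cg t * ?x)"
    using van by (simp add: mvar_eq[OF tG] left_diff_distrib sum_distrib_right D_diff D_sum)
  also have "\<dots> = D (var_monom (mset_set T) * var_monom r * c_monom (add_mset t M))"
    by (simp add: c_monom_add_mset algebra_simps)
  also have "\<dots> = D (var_monom (mset_set T) * c_monom (r + add_mset t M))"
  proof (rule add.IH)
    show "card {s \<in> T. s \<subseteq> u} + count_below r u + count_below (add_mset t M) u \<le> cd u" if "u \<in> T" for u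
      using add.prems(3)[OF that] by (simp add: count_below_add_mset)
  qed (use add.prems tG in auto)
  finally show ?case
    by simp
qed simp

lemma D_exchange:
  assumes "finite T" "T \<subseteq> G" "t \<in> G" "y \<in> fac E" "t \<subset> y" "set_mset N \<subseteq> G"
    "\<And>h. h \<in> G \<Longrightarrow> t \<subseteq> h \<Longrightarrow> h \<notin> fac E \<Longrightarrow>
        card {s \<in> T. s \<subseteq> h} + count_below N h + k < cd h"
  shows "D (var_monom (mset_set T) * c_monom (N + replicate_mset k t)) =
      D (var_monom (mset_set T) * c_monom (N + replicate_mset k y))"
  using assms(6,7)
proof (induction k arbitrary: N)
  case (Suc k)
  let ?x = "var_monom (mset_set T) * c_monom (N + replicate_mset k t)"
  have yG: "y \<in> G"
    by (rule fac_in_G[OF assms(4)])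
  \<comment> \<open>The variable h takes one unit of the slack assumed for \<open>Suc k\<close> and
    the remaining copies of t at most k, so the count at h stays below \<open>cd h\<close>. Only the
    term of y survives.\<close>
  have van: "D (mvar h * ?x) = 0" if h: "h \<in> G" "t \<subseteq> h" "h \<noteq> y" for h
  proof -
    have nf: "h \<notin> fac E"
    proof
      assume "h \<in> fac E"
      then have "h = y"
        using fac_above_unique[OF E_Lat _ assms(4,3) h(2)] assms(5) by simp
      then show False
        using h(3) by simp
    qed
    have cr: "count_below (replicate_mset k t) h \<le> k"
      by (induction k) (auto simp: count_below_add_mset)
    have "D (var_monom (add_mset h (mset_set T)) * c_monom (N + replicate_mset k t)) = 0"
    proof (rule D_tight_vanish[OF _ _ _ nf])
      show "count_below (add_mset h (mset_set T)) h + count_below (N + replicate_mset k t) h < cd h"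
        using Suc.prems(2)[OF h(1,2) nf] cr assms(1) by (simp add: count_below_add_mset count_below_mset_set)
    qed (use assms h Suc.prems in auto)
    then show ?thesis
      by (simp add: var_monom_add_mset algebra_simps)
  qed
  have "D (var_monom (mset_set T) * c_monom (N + replicate_mset (Suc k) t)) = D (cg t * ?x)"
    by (simp add: c_monom_add_mset algebra_simps)
  also have "\<dots> = (\<Sum>h | h \<in> G \<and> t \<subseteq> h. D (mvar h * ?x))"
    by (simp add: cg_eq sum_distrib_right D_sum)
  also have "\<dots> = D (mvar y * ?x)"
    using van yG assms(5) sum.remove[of "{h. h \<in> G \<and> t \<subseteq> h}" y "\<lambda>h. D (mvar h * ?x)"] by simp
  also have "\<dots> = D (var_monom (mset_set T) * c_monom (add_mset y N + replicate_mset k t))"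
    by (simp add: c_monom_add_mset cg_fac[OF assms(4)] algebra_simps)
  also have "\<dots> = D (var_monom (mset_set T) * c_monom (add_mset y N + replicate_mset k y))"
  proof (rule Suc.IH)
    fix h assume h: "h \<in> G" "t \<subseteq> h" "h \<notin> fac E"
    have "\<not> y \<subseteq> h"
      using fac_maximal[OF assms(4) h(1) Lat_subset[OF G_Lat[OF h(1)]]] h(3) assms(4) by auto
    then show "card {s \<in> T. s \<subseteq> h} + count_below (add_mset y N) h + k < cd h"
      using Suc.prems(2)[OF h] by (simp add: count_below_add_mset)
  qed (use Suc.prems yG in auto)
  finally show ?case
    by simp
qed simp

text \<open>Among the remaining members of T and the factors of E only the drop of y changes. It
  grows by \<open>cd_drop T t\<close>: one unit is the extra y, the rest replaces the deleted copies
  of t.\<close>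

lemma top_mset_step:
  assumes "nested T" "T \<inter> fac E = {}" "t \<in> T" "\<And>u. u \<in> T \<Longrightarrow>
      t \<subseteq> u \<Longrightarrow> t = u"
    "y \<in> fac E" "t \<subseteq> y"
  shows "top_mset (T - {t}) = add_mset y {#g \<in># top_mset T. g \<noteq> t#} + replicate_mset (cd_drop T t - 1) y"
proof (rule multiset_eqI)
  fix g
  let ?U = "T - {t}"
  have TG: "T \<subseteq> G"
    using assms by (simp add: nested_def)
  have UN: "nested ?U"
    by (rule nested_subset[OF assms(1)]) auto
  have yG: "y \<in> G"
    by (rule fac_in_G[OF assms(5)])
  have ty: "t \<subset> y" "y \<notin> T"
    using assms by auto
  have same: "cd_drop ?U h = cd_drop T h" if "\<not> t \<subset> h" for h
  proof -
    have "{s \<in> ?U. s \<subset> h} = {s \<in> T. s \<subset> h}"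
      using that by auto
    then show ?thesis
      by (simp add: cd_drop_def)
  qed
  have sameT: "cd_drop ?U h = cd_drop T h" if "h \<in> ?U" for h
    using that assms(4)[of h] by (intro same) auto
  have top: "cd_drop ?U y = cd_drop T y + cd_drop T t"
  proof -
    have fin: "finite {s \<in> T. s \<subset> y}"
      using TG finite_G by (auto intro: finite_subset)
    have "cd (flat_join {s \<in> T. s \<subset> y}) = (\<Sum>s | s \<in> T \<and> s \<subset> y. cd_drop T s)"
      by (rule nested_sum_le(2)[OF assms(1), symmetric])
    also have "\<dots> = cd_drop T t + (\<Sum>s\<in>{s \<in> T. s \<subset> y} - {t}. cd_drop T s)"
      using assms(3) ty fin by (subst sum.remove[of _ t]) auto
    also have "{s \<in> T. s \<subset> y} - {t} = {s. s \<in> ?U \<and> s \<subset> y}"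
      by auto
    also have "(\<Sum>s | s \<in> ?U \<and> s \<subset> y. cd_drop T s) =
        (\<Sum>s | s \<in> ?U \<and> s \<subset> y. cd_drop ?U s)"
      using sameT by (intro sum.cong) auto
    also have "\<dots> = cd (flat_join {s \<in> ?U. s \<subset> y})"
      by (rule nested_sum_le(2)[OF UN])
    finally have "cd (flat_join {s \<in> T. s \<subset> y}) = cd_drop T t + cd (flat_join {s \<in> ?U. s \<subset> y})" .
    moreover have "cd (flat_join {s \<in> T. s \<subset> y}) \<le> cd y"
      by (rule cd_join_below(1)[OF TG G_Lat[OF yG]])
    ultimately show ?thesis
      by (simp add: cd_drop_def)
  qed
  have pos: "0 < cd_drop T t" "0 < cd_drop T y"
    using cd_drop_pos[OF assms(1)] assms(3) TG yG by auto
  have tnf: "t \<notin> fac E"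
    using assms by auto
  have nfy: "\<not> t \<subset> h" if h: "h \<in> fac E" "h \<noteq> y" for h
    using fac_above_unique[OF E_Lat h(1) assms(5) _ _ assms(6)] h(2) assms(3) TG by auto
  consider "g = y" | "g = t" | "g \<noteq> y" "g \<noteq> t" "g \<in> fac E" | "g \<noteq> y" "g \<noteq> t" "g
      \<notin> fac E" "g \<in> T"
    | "g \<noteq> y" "g \<noteq> t" "g \<notin> fac E" "g \<notin> T"
    by blast
  then show "count (top_mset ?U) g = count (add_mset y {#g \<in># top_mset T. g \<noteq> t#} + replicate_mset
      (cd_drop T t - 1) y) g"
  proof cases
    case 1
    then show ?thesis
      using top pos yG assms(5) ty by (auto simp: top_mset_def count_msum)
  next
    case 2
    then show ?thesis
      using tnf ty by (auto simp: top_mset_def count_msum)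
  next
    case 3
    then show ?thesis
      using same[OF nfy] by (simp add: top_mset_def count_msum)
  next
    case 4
    then show ?thesis
      using sameT by (simp add: top_mset_def count_msum)
  qed (simp add: top_mset_def count_msum)
qed

lemma count_below_topm:
  assumes "nested T" "h \<in> G" "h \<notin> fac E"
  shows "count_below (top_mset T) h + card {s \<in> T. s \<subseteq> h} = cd (flat_join {s \<in> T. s \<subseteq> h})"
proof -
  have TG: "T \<subseteq> G"
    using assms by (simp add: nested_def)
  have "count_below (top_mset T) h = (\<Sum>g | g \<in> G \<and> g \<subseteq> h. count (top_mset T) g)"
    unfolding top_mset_def by (rule count_below_eq_sum[OF set_msum])
  also have "\<dots> = (\<Sum>g | g \<in> T \<and> g \<subseteq> h. cd_drop T g - 1)"
  proof (rule sum.mono_neutral_cong_right)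
    show "\<forall>i\<in>{g. g \<in> G \<and> g \<subseteq> h} - {g. g \<in> T \<and> g \<subseteq> h}. count
        (top_mset T) i = 0"
      using below_not_fac[OF assms(2,3)] by (auto simp: top_mset_def count_msum)
    show "count (top_mset T) x = cd_drop T x - 1" if "x \<in> {g. g \<in> T \<and> g \<subseteq> h}" for x
      using that TG by (auto simp: top_mset_def count_msum)
  qed (use TG in auto)
  finally have "count_below (top_mset T) h + card {s \<in> T. s \<subseteq> h} =
      (\<Sum>g | g \<in> T \<and> g \<subseteq> h. cd_drop T g - 1 + 1)"
    by (simp only: sum.distrib card_eq_sum)
  also have "\<dots> = (\<Sum>g | g \<in> T \<and> g \<subseteq> h. cd_drop T g)"
    using cd_drop_pos[OF assms(1)] TG by (intro sum.cong refl) (auto simp: Suc_leI)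
  finally show ?thesis
    using nested_sum_le(1)[OF assms(1)] by simp
qed

end

section \<open>Polynomials in a set of variables\<close>

lemma carrier_mpoly: "p \<in> carrier (mpoly_ring V) \<longleftrightarrow>
    (\<forall>m\<in>Poly_Mapping.keys p. Poly_Mapping.keys m \<subseteq> V)"
  by (simp add: mpoly_ring_def)

lemma carrier_add:
  assumes "p \<in> carrier (mpoly_ring V)" "q \<in> carrier (mpoly_ring V)"
  shows "p + q \<in> carrier (mpoly_ring V)"
  using assms keys_add[of p q] by (auto simp: carrier_mpoly)

lemma carrier_uminus: "p \<in> carrier (mpoly_ring V) \<Longrightarrow> - p \<in> carrier (mpoly_ring V)"
  by (simp add: carrier_mpoly in_keys_iff)

lemma carrier_mult:
  assumes "p \<in> carrier (mpoly_ring V)" "q \<in> carrier (mpoly_ring V)"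
  shows "p * q \<in> carrier (mpoly_ring V)"
proof -
  have "Poly_Mapping.keys m \<subseteq> V" if m: "m \<in> Poly_Mapping.keys (p * q)" for m
  proof -
    obtain a b where "m = a + b" "a \<in> Poly_Mapping.keys p" "b \<in> Poly_Mapping.keys q"
      using subsetD[OF keys_mult m] by blast
    then show ?thesis
      using assms keys_add[of a b] unfolding carrier_mpoly by blast
  qed
  then show ?thesis
    by (simp add: carrier_mpoly)
qed

lemma carrier_mconst: "mconst c \<in> carrier (mpoly_ring V)"
  by (simp add: carrier_mpoly mconst_def)

lemma carrier_0: "0 \<in> carrier (mpoly_ring V)"
  by (simp add: carrier_mpoly)

lemma carrier_1: "1 \<in> carrier (mpoly_ring V)"
  using carrier_mconst[of 1] by simp

lemma carrier_mvar: "v \<in> V \<Longrightarrow> mvar v \<in> carrier (mpoly_ring V)"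
  by (simp add: carrier_mpoly mvar_def)

lemma carrier_sum: "(\<And>a. a \<in> A \<Longrightarrow> f a \<in> carrier (mpoly_ring V)) \<Longrightarrow>
    sum f A \<in> carrier (mpoly_ring V)"
  by (induction A rule: infinite_finite_induct) (auto simp: carrier_0 intro: carrier_add)

lemma carrier_xm: "set_mset a \<subseteq> V \<Longrightarrow> var_monom a \<in> carrier (mpoly_ring V)"
  by (induction a) (auto simp: var_monom_add_mset carrier_1 intro: carrier_mult carrier_mvar)

context polymatroid_building
begin

lemma carrier_cg: "cg g \<in> carrier (mpoly_ring G)"
  unfolding cg_eq by (intro carrier_sum carrier_mvar) auto

lemma carrier_cm: "c_monom M \<in> carrier (mpoly_ring G)"
  by (induction M) (auto simp: c_monom_add_mset carrier_1 intro: carrier_mult carrier_cg)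

text \<open>With T empty the drops are full ranks. Each factor y of E below K contributes
  \<open>cd y - 1\<close> to the count, while the ranks \<open>cd y\<close> add up to at most
  \<open>cd K\<close>.\<close>

lemma dhr_topm_empty: "dhr (top_mset {})"
  unfolding dhr_def
proof (intro ballI impI)
  fix K assume K: "K \<in> Lat" "K \<noteq> flat_bot"
  let ?Y = "{y \<in> fac E. y \<subseteq> K}"
  have dl: "cd_drop {} g = cd g" for g
    using cd_zer by (simp add: cd_drop_def flat_bot_def)
  have YL: "?Y \<subseteq> Lat"
    using fac_Lat by auto
  have "count_below (top_mset {}) K = (\<Sum>g | g \<in> G \<and> g \<subseteq> K. count (top_mset {}) g)"
    unfolding top_mset_def by (rule count_below_eq_sum[OF set_msum])
  also have "\<dots> = (\<Sum>y\<in>?Y. cd y - 1)"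
    using fac_in_G by (intro sum.mono_neutral_cong_right) (auto simp: top_mset_def count_msum dl)
  finally have 1: "count_below (top_mset {}) K = (\<Sum>y\<in>?Y. cd y - 1)" .
  show "count_below (top_mset {}) K < cd K"
  proof (cases "?Y = {}")
    case True
    then show ?thesis
      unfolding 1 True using cd_pos[OF K] by simp
  next
    case False
    have "(\<Sum>y\<in>?Y. cd y - 1) < (\<Sum>y\<in>?Y. cd y)"
      using False G_cd_pos[OF fac_in_G] by (intro sum_strict_mono) auto
    also have "\<dots> = cd (flat_join ?Y)"
      using cd_fac[OF flat_join_Lat[OF YL]] fac_join_subset[OF E_Lat, of ?Y] by simp
    also have "\<dots> \<le> cd K"
      by (rule cd_le[OF flat_join_least]) (use K in auto)
    finally show ?thesis
      unfolding 1 .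
  qed
qed

text \<open>A maximal t is removed by writing \<open>mvar t\<close> as \<open>cg t\<close> minus the
  variables strictly above. Of these terms only the one of the factor y of E above t survives, with
  a minus sign, and the classes of t beside it can be exchanged for classes of y.\<close>

lemma D_topm:
  assumes "nested T" "T \<inter> fac E = {}"
  shows "D (var_monom (mset_set T) * c_monom (top_mset T)) = (- 1) ^ card T"
  using assms
proof (induction "card T" arbitrary: T)
  case 0
  then have "T = {}"
    using finite_G unfolding nested_def by (metis card_0_eq finite_subset)
  moreover have "set_mset (top_mset {}) \<subseteq> G"
    unfolding top_mset_def by (rule set_msum)
  ultimately show ?case
    using D_cm dhr_topm_empty by simp
next
  case (Suc n)
  have TG: "T \<subseteq> G"
    using Suc.prems by (simp add: nested_def)
  have fin: "finite T"
    by (rule finite_subset[OF TG finite_G])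
  moreover have "T \<noteq> {}"
    using Suc.hyps by auto
  ultimately obtain t where t: "t \<in> T" "\<And>u. u \<in> T \<Longrightarrow> t \<subseteq> u \<Longrightarrow> t = u"
    using finite_has_maximal[of T] by metis
  have tG: "t \<in> G" and tnf: "t \<notin> fac E"
    using t TG Suc.prems by auto
  obtain y where y: "y \<in> fac E" "t \<subseteq> y"
    using factor_above[OF tG Lat_subset[OF G_Lat[OF tG]]] by metis
  have yG: "y \<in> G"
    by (rule fac_in_G[OF y(1)])
  have ty: "t \<subset> y"
    using y tnf by auto
  let ?U = "T - {t}"
  let ?M = "top_mset T"
  let ?k = "cd_drop T t - 1"
  let ?N = "{#g \<in># ?M. g \<noteq> t#}"
  have UN: "nested ?U"
    by (rule nested_subset[OF Suc.prems(1)]) auto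
  have finU: "finite ?U"
    using fin by simp
  have MG: "set_mset ?M \<subseteq> G"
    unfolding top_mset_def by (rule set_msum)
  have NG: "set_mset ?N \<subseteq> G"
    using MG by auto
  have M_split: "?M = ?N + replicate_mset ?k t"
    by (rule multiset_eqI) (use t(1) tG in \<open>auto simp: top_mset_def count_msum\<close>)
  have kpos: "Suc ?k = cd_drop T t"
    using cd_drop_pos[OF Suc.prems(1) tG] by simp
  let ?P = "var_monom (mset_set ?U) * c_monom ?M"
  have xT: "var_monom (mset_set T) = mvar t * var_monom (mset_set ?U)"
    using mset_set.remove[OF fin t(1)] by (simp add: var_monom_add_mset)
  \<comment> \<open>The additional \<open>cg t\<close> raises the power of this class from
    \<open>cd_drop T t - 1\<close> to \<open>cd_drop T t\<close>, where the relation
    applies.\<close>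
  have 1: "D (cg t * ?P) = 0"
  proof -
    have flat_join_eq: "flat_join {s \<in> ?U. s \<subset> t} = flat_join {s \<in> T. s \<subset> t}"
      by (rule arg_cong[of _ _ flat_join]) auto
    have "D ((\<Prod>s\<in>?U. mvar s) * cg t ^ Suc ?k * c_monom ?N) = 0"
    proof (rule D_relation[OF _ tG _ carrier_cm])
      show "cd t \<le> Suc ?k + cd (flat_join {s \<in> ?U. s \<subset> t})"
        unfolding kpos flat_join_eq cd_drop_def by simp
    qed (use TG in auto)
    moreover have "c_monom ?M = c_monom ?N * cg t ^ ?k"
      by (subst M_split) (simp add: c_monom_union c_monom_replicate)
    ultimately show ?thesis
      using finU by (simp add: prod_mvar algebra_simps)
  qed
  have cardU: "Suc (card {s \<in> ?U. s \<subseteq> h}) = card {s \<in> T. s \<subseteq> h}" if "t \<subseteq> h" for h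
  proof -
    have "{s \<in> T. s \<subseteq> h} = insert t {s \<in> ?U. s \<subseteq> h}"
      using t that by auto
    then show ?thesis
      using finU by simp
  qed
  have lt: "card {s \<in> ?U. s \<subseteq> h} + count_below ?M h < cd h"
      if h: "h \<in> G" "t \<subseteq> h" "h \<notin> fac E" for h
    using count_below_topm[OF Suc.prems(1) h(1,3)] cardU[OF h(2)] cd_join_below(2)[OF TG G_Lat[OF h(1)]] by simp
  \<comment> \<open>At h the new variable replaces t, so the count is the rank of the join of the
    members of T below h. As h is not in T, nestedness keeps this below \<open>cd h\<close>.\<close>
  have 2: "D (mvar h * ?P) = 0" if h: "h \<in> G" "t \<subset> h" "h \<noteq> y" for h
  proof -
    have nf: "h \<notin> fac E"
    proof
      assume "h \<in> fac E"
      then have "h = y"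
        using fac_above_unique[OF E_Lat _ y(1) tG _ y(2)] h(2) by auto
      then show False
        using h(3) by simp
    qed
    have hT: "h \<notin> T"
      using t(2)[of h] h by auto
    have "D (var_monom (add_mset h (mset_set ?U)) * c_monom ?M) = 0"
    proof (rule D_tight_vanish[OF _ MG _ nf])
      have "t \<subseteq> h"
        using h by auto
      then show "count_below (add_mset h (mset_set ?U)) h + count_below ?M h < cd h"
        using count_below_topm[OF Suc.prems(1) h(1) nf] cardU[of h] nested_lt_notin[OF Suc.prems(1) h(1) hT] finU
        by (simp add: count_below_add_mset count_below_mset_set)
    qed (use h finU TG in auto)
    then show ?thesis
      by (simp add: var_monom_add_mset algebra_simps)
  qed
  have "D (var_monom (mset_set T) * c_monom ?M) = D (mvar t * ?P)"
    by (simp add: xT algebra_simps)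
  also have "\<dots> = - (\<Sum>h | h \<in> G \<and> t \<subset> h. D (mvar h * ?P))"
    using 1 by (simp add: mvar_eq[OF tG] left_diff_distrib sum_distrib_right D_diff D_sum)
  also have "(\<Sum>h | h \<in> G \<and> t \<subset> h. D (mvar h * ?P)) = D (mvar y * ?P)"
    using 2 yG ty sum.remove[of "{h. h \<in> G \<and> t \<subset> h}" y "\<lambda>h. D (mvar h * ?P)"] by simp
  also have "mvar y * ?P = var_monom (mset_set ?U) * c_monom (add_mset y ?N + replicate_mset ?k t)"
    by (subst M_split) (simp add: c_monom_add_mset c_monom_union cg_fac[OF y(1)] algebra_simps)
  also have "D \<dots> = D (var_monom (mset_set ?U) * c_monom (add_mset y ?N + replicate_mset ?k y))"
  proof (rule D_exchange[OF finU _ tG y(1) ty])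
    fix h assume h: "h \<in> G" "t \<subseteq> h" "h \<notin> fac E"
    have "\<not> y \<subseteq> h"
      using fac_maximal[OF y(1) h(1) Lat_subset[OF G_Lat[OF h(1)]]] h(3) y(1) by auto
    moreover have "count_below (replicate_mset ?k t) h = ?k"
      using h(2) by (simp add: count_below_replicate)
    then have "count_below ?M h = count_below ?N h + ?k"
      by (subst M_split) (simp only: count_below_union)
    ultimately show "card {s \<in> ?U. s \<subseteq> h} + count_below (add_mset y ?N) h + ?k < cd h"
      using lt[OF h] by (simp add: count_below_add_mset)
  qed (use TG yG NG in auto)
  also have "add_mset y ?N + replicate_mset ?k y = top_mset ?U"
    by (rule top_mset_step[OF Suc.prems t y, symmetric])
  also have "D (var_monom (mset_set ?U) * c_monom (top_mset ?U)) = (- 1) ^ card ?U"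
  proof (rule Suc.hyps(1))
    show "n = card ?U"
      using Suc.hyps(2) t(1) fin by simp
  qed (use UN Suc.prems in auto)
  finally show ?case
    using card.remove[OF fin t(1)] by simp
qed

text \<open>Factor variables are already classes. One copy of each other variable is kept and the
  spare copies are converted; together with the dual exponents the classes form
  \<open>top_mset\<close>, so the entry is a sign.\<close>

lemma D_diagonal:
  assumes "standard a"
  shows "D (var_monom a * c_monom (dual a)) \<noteq> 0"
proof -
  let ?S = "set_mset a"
  let ?T = "?S - fac E"
  let ?f = "{#g \<in># a. g \<in> fac E#}"
  let ?b = "{#g \<in># a. g \<notin> fac E#}"
  let ?r = "?b - mset_set ?T"
  have N: "nested ?T"
    by (rule nested_subset[OF standard_nested[OF assms]]) auto
  have aG: "?S \<subseteq> G"
    by (rule standard_G[OF assms])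
  then have TG: "?T \<subseteq> G"
    by auto
  \<comment> \<open>No factor of E lies strictly below a member of G, so omitting the factors
    changes no drop.\<close>
  have dl: "cd_drop ?T g = cd_drop ?S g" if "g \<in> G" for g
  proof -
    have "{s \<in> ?T. s \<subset> g} = {s \<in> ?S. s \<subset> g}"
      using not_fac_E[OF that] by auto
    then show ?thesis
      by (simp add: cd_drop_def)
  qed
  have sub: "mset_set ?T \<subseteq># ?b"
    by (rule mset_subset_eqI) (auto simp: count_mset_set' Suc_le_eq)
  have b: "?b = mset_set ?T + ?r"
    using sub by simp
  have a: "a = ?f + ?b"
    by (rule multiset_partition)
  have xf: "var_monom ?f = c_monom ?f"
    unfolding var_monom_def c_monom_def by (intro arg_cong[of _ _ prod_mset] image_mset_cong) (simp add: cg_fac)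
  have top: "?r + (?f + dual a) = top_mset ?T"
  proof (rule multiset_eqI)
    fix g
    show "count (?r + (?f + dual a)) g = count (top_mset ?T) g"
    proof (cases "g \<in> G")
      case True
      have c: "count a g < cd_drop ?S g"
        by (rule standard_count[OF assms True])
      show ?thesis
      proof (cases "g \<in> fac E")
        case F: True
        then show ?thesis
          using True c dl[OF True] by (simp add: dual_def top_mset_def count_msum)
      next
        case F: False
        then show ?thesis
          using True c dl[OF True]
        proof (cases "g \<in># a")
          case A: True
          then have "0 < count a g"
            by simp
          then show ?thesis
            using True F A c dl[OF True] by (simp add: dual_def top_mset_def count_msum)
        next
          case A: False
          then have "count a g = 0"
            by (simp add: not_in_iff)
          then show ?thesis
            using True F A by (simp add: dual_def top_mset_def count_msum)
        qed
      qed
    next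
      case False
      then have "count a g = 0"
        using aG by (auto simp: not_in_iff[symmetric])
      then show ?thesis
        using False by (simp add: dual_def top_mset_def count_msum)
    qed
  qed
  have "D (var_monom a * c_monom (dual a)) = D (var_monom (mset_set ?T) * var_monom ?r * c_monom (?f + dual a))"
  proof -
    have "var_monom a = var_monom ?f * (var_monom (mset_set ?T) * var_monom ?r)"
      using arg_cong[OF a, of var_monom] arg_cong[OF b, of var_monom] unfolding var_monom_union by simp
    then show ?thesis
      by (simp add: xf c_monom_union algebra_simps)
  qed
  also have "\<dots> = D (var_monom (mset_set ?T) * c_monom (?r + (?f + dual a)))"
  proof (rule D_convert)
    show "set_mset ?r \<subseteq> ?T"
      by (auto dest: in_diffD)
    show "set_mset (?f + dual a) \<subseteq> G"
      using aG dual_G by auto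
    fix t assume t: "t \<in> ?T"
    then have tG: "t \<in> G" and nf: "t \<notin> fac E"
      using aG by auto
    have "count_below ?r t + count_below (?f + dual a) t = count_below (top_mset ?T) t"
      unfolding top[symmetric] by simp
    then show "card {s \<in> ?T. s \<subseteq> t} + count_below ?r t + count_below (?f + dual a) t \<le> cd t"
      using count_below_topm[OF N tG nf] cd_join_below(2)[OF TG G_Lat[OF tG]] by linarith
  qed (use aG in auto)
  also have "\<dots> = (- 1) ^ card ?T"
    unfolding top by (rule D_topm[OF N]) auto
  finally show ?thesis
    by simp
qed

end

section \<open>Homogeneous components\<close>

definition hcomp :: "nat \<Rightarrow> 'v rat_mpoly \<Rightarrow> 'v rat_mpoly" where
  "hcomp k p = (\<Sum>m\<in>Poly_Mapping.keys p.
     Poly_Mapping.single m (if mon_degree m = k then Poly_Mapping.lookup p m else 0))"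

lemma hcomp_add: "hcomp k (p + q) = hcomp k p + hcomp k q"
  unfolding hcomp_def by (rule setsum_keys_plus_distrib) (simp_all add: single_add)

lemma hcomp_0 [simp]: "hcomp k 0 = 0"
  by (simp add: hcomp_def)

lemma hcomp_uminus: "hcomp k (- p) = - hcomp k p"
  using hcomp_add[of k p "- p"] by (simp add: eq_neg_iff_add_eq_0 add.commute)

lemma hcomp_diff: "hcomp k (p - q) = hcomp k p - hcomp k q"
  using hcomp_add[of k p "- q"] by (simp add: hcomp_uminus)

lemma hcomp_sum: "hcomp k (sum f A) = (\<Sum>a\<in>A. hcomp k (f a))"
  by (induction A rule: infinite_finite_induct) (simp_all add: hcomp_add)

lemma lookup_hcomp:
  "Poly_Mapping.lookup (hcomp k p) m = (if mon_degree m = k then Poly_Mapping.lookup p m else 0)"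
proof -
  have "Poly_Mapping.lookup (hcomp k p) m =
      (\<Sum>i\<in>Poly_Mapping.keys p. if i = m then (if mon_degree i = k then Poly_Mapping.lookup p i else 0) else 0)"
    unfolding hcomp_def lookup_sum by (intro sum.cong) (auto simp: lookup_single when_def)
  also have "\<dots> = (if mon_degree m = k then Poly_Mapping.lookup p m else 0)"
    by (simp add: in_keys_iff)
  finally show ?thesis .
qed

lemma keys_hcomp: "Poly_Mapping.keys (hcomp k p) = {m \<in> Poly_Mapping.keys p. mon_degree m = k}"
  by (auto simp: in_keys_iff lookup_hcomp split: if_splits)

lemma hcomp_homogeneous: "p \<in> carrier (mpoly_ring V) \<Longrightarrow> hcomp k p \<in> homogeneous_polys V k"
  by (auto simp: homogeneous_polys_def carrier_mpoly keys_hcomp)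

lemma homogeneous_carrier: "p \<in> homogeneous_polys V k \<Longrightarrow> p \<in> carrier (mpoly_ring V)"
  by (simp add: homogeneous_polys_def)

lemma hcomp_of_homogeneous:
  assumes "p \<in> homogeneous_polys V k"
  shows "hcomp j p = (if j = k then p else 0)"
proof (rule poly_mapping_eqI)
  fix m
  have "mon_degree m = k" if "Poly_Mapping.lookup p m \<noteq> 0"
    using that assms by (simp add: homogeneous_polys_def in_keys_iff)
  then show "Poly_Mapping.lookup (hcomp j p) m = Poly_Mapping.lookup (if j = k then p else 0) m"
    by (auto simp: lookup_hcomp)
qed

lemma sum_hcomp:
  assumes "finite K" "mon_degree ` Poly_Mapping.keys p \<subseteq> K"
  shows "(\<Sum>k\<in>K. hcomp k p) = p"
proof (rule poly_mapping_eqI)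
  fix m
  have "Poly_Mapping.lookup (\<Sum>k\<in>K. hcomp k p) m =
      (\<Sum>k\<in>K. if mon_degree m = k then Poly_Mapping.lookup p m else 0)"
    by (simp add: lookup_sum lookup_hcomp)
  also have "\<dots> = Poly_Mapping.lookup p m"
    using assms by (cases "m \<in> Poly_Mapping.keys p") (auto simp: in_keys_iff image_subset_iff)
  finally show "Poly_Mapping.lookup (\<Sum>k\<in>K. hcomp k p) m = Poly_Mapping.lookup p m" .
qed

lemma homogeneous_add:
  assumes "p \<in> homogeneous_polys V k" "q \<in> homogeneous_polys V k"
  shows "p + q \<in> homogeneous_polys V k"
  using assms keys_add[of p q] carrier_add[of p V q] unfolding homogeneous_polys_def by blast

lemma homogeneous_0: "0 \<in> homogeneous_polys V k"
  by (simp add: homogeneous_polys_def carrier_0)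

lemma homogeneous_uminus: "p \<in> homogeneous_polys V k \<Longrightarrow> - p \<in> homogeneous_polys V k"
  by (simp add: homogeneous_polys_def carrier_uminus in_keys_iff)

lemma homogeneous_sum:
  "(\<And>a. a \<in> A \<Longrightarrow> f a \<in> homogeneous_polys V k) \<Longrightarrow>
      sum f A \<in> homogeneous_polys V k"
  by (induction A rule: infinite_finite_induct) (auto simp: homogeneous_0 intro: homogeneous_add)

lemma mon_degree_add: "mon_degree (m + n) = mon_degree m + mon_degree n"
proof -
  obtain a b where "exponent a = m" "exponent b = n"
    using exponent_surj by metis
  moreover have "exponent (a + b) = exponent a + exponent b"
    by (simp add: exponent_def)
  ultimately show ?thesis
    using mon_degree_expo[of "a + b"] mon_degree_expo[of a] mon_degree_expo[of b] by simp
qed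

lemma homogeneous_mult:
  assumes "p \<in> homogeneous_polys V j" "q \<in> homogeneous_polys V k"
  shows "p * q \<in> homogeneous_polys V (j + k)"
proof -
  have "mon_degree m = j + k" if m: "m \<in> Poly_Mapping.keys (p * q)" for m
  proof -
    obtain a b where "m = a + b" "a \<in> Poly_Mapping.keys p" "b \<in> Poly_Mapping.keys q"
      using subsetD[OF keys_mult m] by blast
    then show ?thesis
      using assms by (simp add: homogeneous_polys_def mon_degree_add)
  qed
  then show ?thesis
    using assms by (simp add: homogeneous_polys_def carrier_mult)
qed

lemma homogeneous_mconst: "mconst c \<in> homogeneous_polys V 0"
  by (simp add: homogeneous_polys_def carrier_mconst) (simp add: mconst_def mon_degree_def)

lemma homogeneous_1: "1 \<in> homogeneous_polys V 0"
  using homogeneous_mconst[of 1] by simp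

lemma homogeneous_scale: "p \<in> homogeneous_polys V k \<Longrightarrow> mconst c * p \<in> homogeneous_polys V k"
  using homogeneous_mult[OF homogeneous_mconst] by fastforce

lemma homogeneous_mvar: "v \<in> V \<Longrightarrow> mvar v \<in> homogeneous_polys V 1"
  by (simp add: homogeneous_polys_def carrier_mvar) (simp add: mvar_def mon_degree_def)

lemma homogeneous_xm: "set_mset a \<subseteq> V \<Longrightarrow> var_monom a \<in> homogeneous_polys V (size a)"
proof (induction a)
  case (add v a)
  then show ?case
    using homogeneous_mult[OF homogeneous_mvar[of v V], of "var_monom a" "size a"] by (simp add: var_monom_add_mset)
qed (simp add: homogeneous_1)

lemma homogeneous_power: "p \<in> homogeneous_polys V 1 \<Longrightarrow> p ^ n \<in> homogeneous_polys V n"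
proof (induction n)
  case (Suc n)
  then show ?case
    using homogeneous_mult[of p V 1 "p ^ n" n] by simp
qed (simp add: homogeneous_1)

lemma homogeneous_degree_0:
  fixes p :: "'v rat_mpoly"
  assumes "p \<in> homogeneous_polys V 0"
  obtains c where "p = mconst c"
proof (rule that, rule poly_mapping_eqI)
  fix m :: "'v \<Rightarrow>\<^sub>0 nat"
  obtain a where a: "exponent a = m"
    using exponent_surj by metis
  have "m = 0" if "Poly_Mapping.lookup p m \<noteq> 0"
  proof -
    have "size a = 0"
      using that assms a mon_degree_expo[of a] by (simp add: homogeneous_polys_def in_keys_iff)
    then show ?thesis
      using a by (simp add: exponent_def)
  qed
  then show "Poly_Mapping.lookup p m = Poly_Mapping.lookup (mconst (Poly_Mapping.lookup p 0)) m"
    by (auto simp: mconst_def lookup_single when_def)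
qed

text \<open>The case distinction prevents the truncated difference from selecting degree 0 when k is
  smaller than the degree of the monomial.\<close>

lemma hcomp_monom_mult:
  "hcomp k (var_monom a * p) = (if size a \<le> k then var_monom a * hcomp (k - size a) p else 0)"
proof -
  have xa: "var_monom a \<in> homogeneous_polys UNIV (size a)"
    by (rule homogeneous_xm) simp
  let ?K = "mon_degree ` Poly_Mapping.keys p"
  have "hcomp k (var_monom a * p) = hcomp k (\<Sum>j\<in>?K. var_monom a * hcomp j p)"
    by (simp add: sum_distrib_left[symmetric] sum_hcomp)
  also have "\<dots> = (\<Sum>j\<in>?K. if k = size a + j then var_monom a * hcomp j p else 0)"
  proof (unfold hcomp_sum, rule sum.cong[OF refl])
    fix j
    have "hcomp j p \<in> homogeneous_polys UNIV j"
      by (rule hcomp_homogeneous) (simp add: carrier_UNIV)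
    from hcomp_of_homogeneous[OF homogeneous_mult[OF xa this]]
    show "hcomp k (var_monom a * hcomp j p) = (if k = size a + j then var_monom a * hcomp j p else 0)" .
  qed
  also have "\<dots> = (if size a \<le> k then var_monom a * hcomp (k - size a) p else 0)"
  proof (cases "size a \<le> k")
    case True
    have "(\<Sum>j\<in>?K. if k = size a + j then var_monom a * hcomp j p else 0) =
        (\<Sum>j\<in>?K. if j = k - size a then var_monom a * hcomp j p else 0)"
      using True by (intro sum.cong) auto
    also have "\<dots> = (if k - size a \<in> ?K then var_monom a * hcomp (k - size a) p else 0)"
      by simp
    also have "\<dots> = var_monom a * hcomp (k - size a) p"
    proof (cases "k - size a \<in> ?K")
      case False
      then have "Poly_Mapping.keys (hcomp (k - size a) p) = {}"
        unfolding keys_hcomp by (force simp: image_iff)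
      then have "hcomp (k - size a) p = 0"
        by (intro poly_mapping_eqI) (simp add: in_keys_iff)
      then show ?thesis
        by simp
    qed simp
    finally show ?thesis
      using True by simp
  next
    case False
    then show ?thesis
      by (intro trans[OF sum.neutral]) auto
  qed
  finally show ?thesis .
qed

section \<open>The Chow ideal\<close>

lemma mpoly_ring_simps [simp]:
  "monoid.mult (mpoly_ring V) = (*)" "one (mpoly_ring V) = 1"
  "ring.zero (mpoly_ring V) = 0" "ring.add (mpoly_ring V) = (+)"
  by (simp_all add: mpoly_ring_def ring_of_type_algebra_def)

lemma cring_mpoly: "cring (mpoly_ring V)"
proof (rule cringI)
  show "abelian_group (mpoly_ring V)"
  proof (rule abelian_groupI)
    show "\<exists>y\<in>carrier (mpoly_ring V). y \<oplus>\<^bsub>mpoly_ring V\<^esub> x =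
        \<zero>\<^bsub>mpoly_ring V\<^esub>"
      if "x \<in> carrier (mpoly_ring V)" for x
      using carrier_uminus[OF that] by (intro bexI[of _ "- x"]) simp_all
  qed (auto simp: carrier_0 carrier_add algebra_simps)
  show "Group.comm_monoid (mpoly_ring V)"
    by (rule comm_monoidI) (auto simp: carrier_1 carrier_mult algebra_simps)
qed (simp add: algebra_simps)

lemma mpoly_ideal_simps:
  assumes "ideal I (mpoly_ring V)"
  shows "I \<subseteq> carrier (mpoly_ring V)" "0 \<in> I" "p \<in> I \<Longrightarrow>
      q \<in> I \<Longrightarrow> p + q \<in> I"
    "p \<in> I \<Longrightarrow> q \<in> carrier (mpoly_ring V) \<Longrightarrow> p * q \<in> I"
    "p \<in> I \<Longrightarrow> q \<in> carrier (mpoly_ring V) \<Longrightarrow> q * p \<in> I"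
proof -
  interpret ideal I "mpoly_ring V" by fact
  show "I \<subseteq> carrier (mpoly_ring V)" "0 \<in> I"
    using a_subset additive_subgroup.zero_closed[OF is_additive_subgroup] by simp_all
  show "p + q \<in> I" if "p \<in> I" "q \<in> I"
    using additive_subgroup.a_closed[OF is_additive_subgroup that] by simp
  show "p * q \<in> I" "q * p \<in> I" if "p \<in> I" "q \<in> carrier (mpoly_ring V)"
    using I_r_closed[OF that] I_l_closed[OF that] by simp_all
qed

lemma mpoly_idealI:
  assumes "J \<subseteq> carrier (mpoly_ring V)" "0 \<in> J" "\<And>p q. p \<in> J \<Longrightarrow>
      q \<in> J \<Longrightarrow> p + q \<in> J"
    "\<And>p q. p \<in> J \<Longrightarrow> q \<in> carrier (mpoly_ring V) \<Longrightarrow> q * p \<in> J"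
  shows "ideal J (mpoly_ring V)"
proof -
  interpret cring "mpoly_ring V" by (rule cring_mpoly)
  have m: "- p \<in> J" if "p \<in> J" for p
    using assms(4)[OF that carrier_mconst[of "-1"]] by (simp add: mconst_uminus)
  have inv: "\<ominus>\<^bsub>mpoly_ring V\<^esub> p = - p" if "p \<in> carrier (mpoly_ring V)" for p
    using minus_equality[of "- p" p] carrier_uminus[OF that] that by simp
  show ?thesis
  proof (rule idealI[OF ring_axioms])
    show "subgroup J (add_monoid (mpoly_ring V))"
    proof (rule group.subgroupI[OF a_group])
      show "inv\<^bsub>add_monoid (mpoly_ring V)\<^esub> a \<in> J" if "a \<in> J" for a
        using m[OF that] inv[of a] that assms(1) by (auto simp: a_inv_def)
    qed (use assms in auto)
  qed (use assms in \<open>auto simp: mult.commute\<close>)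
qed

context polymatroid_building
begin

abbreviation R :: "'a set rat_mpoly ring" where
  "R \<equiv> mpoly_ring G"

abbreviation I :: "'a set rat_mpoly set" where
  "I \<equiv> chow_ideal E cd G"

lemma chow_relations_eq:
  "chow_relations E cd G = {(\<Prod>s\<in>S. mvar s) * cg g ^ b | S g b.
     S \<subseteq> G \<and> g \<in> G \<and> cd g \<le> b + cd (flat_join {s \<in> S. s \<subset> g})}"
proof -
  have "\<Squnion>\<^bsub>flat_lattice E cd\<^esub> {s \<in> S. s \<subset> g} =
      flat_join {s \<in> S. s \<subset> g}" if "S \<subseteq> G" for S g
    using that G_sub_Lat by (intro sup_flat_lattice) auto
  then show ?thesis
    unfolding chow_relations_def Let_def flat_lattice_simps by (simp cong: conj_cong)
qed

lemma chow_relations_homogeneous: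
  assumes "r \<in> chow_relations E cd G"
  obtains d where "r \<in> homogeneous_polys G d"
proof -
  obtain S g b where r: "r = (\<Prod>s\<in>S. mvar s) * cg g ^ b" "S \<subseteq> G"
    using assms unfolding chow_relations_eq by blast
  have fin: "finite S"
    by (rule finite_subset[OF r(2) finite_G])
  have "cg g \<in> homogeneous_polys G 1"
    unfolding cg_eq by (intro homogeneous_sum homogeneous_mvar) auto
  moreover have "(\<Prod>s\<in>S. mvar s) \<in> homogeneous_polys G (size (mset_set S))"
    unfolding prod_mvar[OF fin] using r fin by (intro homogeneous_xm) simp
  ultimately show ?thesis
    using that homogeneous_mult[OF _ homogeneous_power] r(1) by blast
qed

lemma chow_relations_carrier: "chow_relations E cd G \<subseteq> carrier R"
  using chow_relations_homogeneous homogeneous_carrier by blast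

lemma ideal_I: "ideal I R"
  unfolding chow_ideal_def
  by (rule ring.genideal_ideal[OF cring.axioms(1)[OF cring_mpoly] chow_relations_carrier])

lemmas I_simps = mpoly_ideal_simps[OF ideal_I]

lemma I_uminus: "p \<in> I \<Longrightarrow> - p \<in> I"
  using I_simps(5)[of p, OF _ carrier_mconst[of "-1"]] by (simp add: mconst_uminus)

lemma I_diff: "p \<in> I \<Longrightarrow> q \<in> I \<Longrightarrow> p - q \<in> I"
  using I_simps(3)[OF _ I_uminus] by fastforce

lemma I_minimal: "ideal J R \<Longrightarrow> chow_relations E cd G \<subseteq> J \<Longrightarrow> I \<subseteq> J"
  unfolding chow_ideal_def by (rule ring.genideal_minimal[OF cring.axioms(1)[OF cring_mpoly]])

lemma I_relation:
  assumes "S \<subseteq> G" "g \<in> G" "cd g \<le> b + cd (flat_join {s \<in> S. s \<subset> g})"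
  shows "(\<Prod>s\<in>S. mvar s) * cg g ^ b \<in> I"
proof -
  have "chow_relations E cd G \<subseteq> I"
    unfolding chow_ideal_def
    by (rule ring.genideal_self[OF cring.axioms(1)[OF cring_mpoly] chow_relations_carrier])
  then show ?thesis
    using assms unfolding chow_relations_eq by blast
qed

text \<open>The polynomials on whose multiples \<open>D\<close> vanishes form an ideal containing
  the relations.\<close>

lemma D_I:
  assumes "p \<in> I" "q \<in> carrier R"
  shows "D (p * q) = 0"
proof -
  let ?J = "{p \<in> carrier R. \<forall>q\<in>carrier R. D (p * q) = 0}"
  have "ideal ?J R"
  proof (rule mpoly_idealI)
    fix p q assume p: "p \<in> ?J" and q: "q \<in> carrier R"
    have "D (q * p * r) = 0" if "r \<in> carrier R" for r
    proof -
      have "D (p * (q * r)) = 0"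
        using p carrier_mult[OF q that] by blast
      then show ?thesis
        by (simp add: algebra_simps)
    qed
    then show "q * p \<in> ?J"
      using p q carrier_mult by auto
  qed (auto simp: carrier_0 carrier_add distrib_right D_add)
  moreover have "chow_relations E cd G \<subseteq> ?J"
  proof
    fix r assume r: "r \<in> chow_relations E cd G"
    then obtain S g b where S: "r = (\<Prod>s\<in>S. mvar s) * cg g ^ b" "S \<subseteq> G" "g \<in> G"
       "cd g \<le> b + cd (flat_join {s \<in> S. s \<subset> g})"
      unfolding chow_relations_eq by blast
    then show "r \<in> ?J"
      using r chow_relations_carrier D_relation[OF S(2-4)] by auto
  qed
  ultimately have "I \<subseteq> ?J"
    by (rule I_minimal)
  then show ?thesis
    using assms by auto
qed

text \<open>The polynomials with all components in \<open>I\<close> form an ideal, since monomials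
  merely shift components, and it contains the relations because these are homogeneous.\<close>

lemma hcomp_I:
  assumes "p \<in> I"
  shows "hcomp k p \<in> I"
proof -
  let ?J = "{p \<in> carrier R. \<forall>k. hcomp k p \<in> I}"
  have "ideal ?J R"
  proof (rule mpoly_idealI)
    fix p q assume p: "p \<in> ?J" and q: "q \<in> carrier R"
    have "\<forall>k. hcomp k (q * p) \<in> I"
      using q
    proof (induction rule: mpoly_induct)
      case (monom c a)
      have "hcomp k (var_monom a * (mconst c * p)) \<in> I" for k
      proof -
        have "hcomp j (mconst c * p) = mconst c * hcomp j p" for j
          by (rule poly_mapping_eqI)
            (simp add: lookup_hcomp mconst_def mult_map_scale_conv_mult[symmetric] map.rep_eq when_def)
        then show ?thesis
          using p monom by (auto simp: hcomp_monom_mult I_simps carrier_xm carrier_mconst)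
      qed
      then show ?case
        by (simp add: algebra_simps)
    qed (simp add: distrib_right hcomp_add I_simps)
    then show "q * p \<in> ?J"
      using p q by (auto simp: carrier_mult)
  qed (auto simp: carrier_0 carrier_add hcomp_add I_simps)
  moreover have "chow_relations E cd G \<subseteq> ?J"
  proof
    fix r assume r: "r \<in> chow_relations E cd G"
    then obtain d where d: "r \<in> homogeneous_polys G d"
      using chow_relations_homogeneous by blast
    have "r \<in> I"
      using r I_relation unfolding chow_relations_eq by blast
    then show "r \<in> ?J"
      using r chow_relations_carrier hcomp_of_homogeneous[OF d] I_simps(2) by auto
  qed
  ultimately have "I \<subseteq> ?J"
    by (rule I_minimal)
  then show ?thesis
    using assms by auto
qed

section \<open>Standard monomials span\<close>

definition standard_span :: "nat \<Rightarrow> 'a set rat_mpoly set" where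
  "standard_span k = {p. \<exists>A c. finite A \<and> (\<forall>b\<in>A. standard b \<and> size b =
      k) \<and> p - (\<Sum>b\<in>A. mconst (c b) * var_monom b) \<in> I}"

lemma standard_spanI:
  assumes "finite A" "\<And>b. b \<in> A \<Longrightarrow>
      standard b \<and> size b = k" "p - (\<Sum>b\<in>A. mconst (c b) * var_monom b) \<in> I"
  shows "p \<in> standard_span k"
  unfolding standard_span_def using assms by (intro CollectI exI[of _ A] exI[of _ c]) simp

lemma standard_span_I: "p \<in> I \<Longrightarrow> p \<in> standard_span k"
  unfolding standard_span_def by (auto intro!: exI[of _ "{}"])

lemma standard_span_std: "standard b \<Longrightarrow> size b = k \<Longrightarrow> var_monom b \<in> standard_span k"
  unfolding standard_span_def by (auto intro!: exI[of _ "{b}"] exI[of _ "\<lambda>_. 1"] simp: I_simps)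

lemma standard_span_scale:
  assumes "p \<in> standard_span k"
  shows "mconst q * p \<in> standard_span k"
proof -
  obtain A c where A: "finite A" "\<forall>b\<in>A. standard b \<and> size b =
      k" "p - (\<Sum>b\<in>A. mconst (c b) * var_monom b) \<in> I"
    using assms unfolding standard_span_def by blast
  have "mconst q * (p - (\<Sum>b\<in>A. mconst (c b) * var_monom b)) \<in> I"
    by (rule I_simps(5)[OF A(3) carrier_mconst])
  also have "mconst q * (p - (\<Sum>b\<in>A. mconst (c b) * var_monom b)) =
      mconst q * p - (\<Sum>b\<in>A. mconst (q * c b) * var_monom b)"
    by (simp add: right_diff_distrib sum_distrib_left mconst_mult mult.assoc)
  finally show ?thesis
    using A(1,2) by (intro standard_spanI) simp_all
qed

lemma standard_span_add:
  assumes "p \<in> standard_span k" "q \<in> standard_span k"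
  shows "p + q \<in> standard_span k"
proof -
  obtain A c where A: "finite A" "\<forall>b\<in>A. standard b \<and> size b =
      k" "p - (\<Sum>b\<in>A. mconst (c b) * var_monom b) \<in> I"
    using assms unfolding standard_span_def by blast
  obtain B d where B: "finite B" "\<forall>b\<in>B. standard b \<and> size b =
      k" "q - (\<Sum>b\<in>B. mconst (d b) * var_monom b) \<in> I"
    using assms unfolding standard_span_def by blast
  let ?e = "\<lambda>b. (if b \<in> A then c b else 0) + (if b \<in> B then d b else 0)"
  have 1: "(\<Sum>b\<in>A. mconst (c b) * var_monom b) =
      (\<Sum>b\<in>A \<union> B. mconst (if b \<in> A then c b else 0) * var_monom b)"
    using A(1) B(1) by (intro sum.mono_neutral_cong_left) auto
  have 2: "(\<Sum>b\<in>B. mconst (d b) * var_monom b) =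
      (\<Sum>b\<in>A \<union> B. mconst (if b \<in> B then d b else 0) * var_monom b)"
    using A(1) B(1) by (intro sum.mono_neutral_cong_left) auto
  have "(\<Sum>b\<in>A \<union> B. mconst (?e b) * var_monom b) =
      (\<Sum>b\<in>A. mconst (c b) * var_monom b) + (\<Sum>b\<in>B. mconst (d b) * var_monom b)"
    unfolding 1 2 mconst_add distrib_right by (rule sum.distrib)
  then have "p + q - (\<Sum>b\<in>A \<union> B. mconst (?e b) * var_monom b) \<in> I"
    using I_simps(3)[OF A(3) B(3)] by (simp add: algebra_simps)
  then show ?thesis
    using A(1,2) B(1,2) by (intro standard_spanI[of "A \<union> B" _ _ ?e]) auto
qed

lemma standard_span_diff: "p \<in> standard_span k \<Longrightarrow> q \<in> standard_span k \<Longrightarrow>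
    p - q \<in> standard_span k"
  using standard_span_add[of p k "- q"] standard_span_scale[of q k "-1"] by (simp add: mconst_uminus)

lemma standard_span_sum: "(\<And>a. a \<in> A \<Longrightarrow> f a \<in> standard_span k) \<Longrightarrow>
    sum f A \<in> standard_span k"
  by (induction A rule: infinite_finite_induct) (auto intro: standard_span_add standard_span_I simp: I_simps)

text \<open>Total corank, the termination measure of straightening: it falls when a variable moves
  strictly up in G.\<close>

definition height :: "'a set multiset \<Rightarrow> nat" where
  "height a = (\<Sum>g\<in>#a. cd E - cd g)"

lemma height_add_mset: "height (add_mset g a) = cd E - cd g + height a"
  by (simp add: height_def)

lemma height_union: "height (a + b) = height a + height b"
  by (simp add: height_def)

lemma cd_less_E: "g \<in> G \<Longrightarrow> h \<in> G \<Longrightarrow> g \<subset> h \<Longrightarrow>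
    cd E - cd h < cd E - cd g"
  using cd_strict[of g h] cd_le[of h E] G_Lat Lat_subset E_Lat by (intro diff_less_mono2) auto

text \<open>Every term of the expansion other than the pure power of \<open>mvar g\<close> has some
  copy of g replaced by a larger element, hence smaller height.\<close>

lemma leading_power:
  assumes "g \<in> G" "set_mset e \<subseteq> G"
    "\<And>a. set_mset a \<subseteq> G \<Longrightarrow> size a = size e + i \<Longrightarrow>
        height a < height (e + replicate_mset i g) \<Longrightarrow>
       var_monom a \<in> standard_span (size e + i)"
  shows "var_monom e * cg g ^ i - var_monom (e + replicate_mset i g) \<in> standard_span (size e + i)"
  using assms(2,3)
proof (induction i arbitrary: e)
  case 0
  then show ?case
    by (simp add: standard_span_I I_simps)
next
  case (Suc i)
  have 1: "var_monom (add_mset g e) * cg g ^ i - var_monom (add_mset g e + replicate_mset i g) \<in>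
      standard_span (size e + Suc i)"
    using Suc.IH[of "add_mset g e"] Suc.prems assms(1) by simp
  have 2: "var_monom (add_mset h e) * cg g ^ i \<in> standard_span (size e + Suc i)" if h: "h \<in> G" "g \<subset> h" for h
  proof -
    let ?e = "add_mset h e"
    have lt: "height (?e + replicate_mset i g) < height (e + replicate_mset (Suc i) g)"
      using cd_less_E[OF assms(1) h] by (simp add: height_add_mset height_union)
    have "var_monom ?e * cg g ^ i - var_monom (?e + replicate_mset i g) \<in> standard_span (size ?e + i)"
      using Suc.prems h lt by (intro Suc.IH) auto
    moreover have "var_monom (?e + replicate_mset i g) \<in> standard_span (size e + Suc i)"
      using Suc.prems(1) h assms(1) lt by (intro Suc.prems(2)) (auto split: if_splits)
    ultimately show ?thesis
      using standard_span_add by fastforce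
  qed
  have "var_monom e * cg g ^ Suc i = (\<Sum>h | h \<in> G \<and> g \<subseteq> h. var_monom (add_mset h e) * cg g ^ i)"
    by (subst (1) power_Suc, subst (1) cg_eq)
      (simp add: sum_distrib_left sum_distrib_right var_monom_add_mset algebra_simps)
  also have "\<dots> = var_monom (add_mset g e) * cg g ^ i + (\<Sum>h | h \<in> G \<and> g \<subset> h.
      var_monom (add_mset h e) * cg g ^ i)"
    by (rule sum_above[OF assms(1)])
  finally have "var_monom e * cg g ^ Suc i - var_monom (e + replicate_mset (Suc i) g) =
      (var_monom (add_mset g e) * cg g ^ i - var_monom (add_mset g e + replicate_mset i g))
       + (\<Sum>h | h \<in> G \<and> g \<subset> h. var_monom (add_mset h e) * cg g ^ i)"
    by simp
  also have "\<dots> \<in> standard_span (size e + Suc i)"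
    using 1 2 by (intro standard_span_add standard_span_sum) auto
  finally show ?case .
qed

lemma var_monom_Sp:
  assumes "set_mset a \<subseteq> G"
  shows "var_monom a \<in> standard_span (size a)"
  using assms
proof (induction "height a" arbitrary: a rule: less_induct)
  case less
  show ?case
  proof (cases "standard a")
    case True
    then show ?thesis
      by (simp add: standard_span_std)
  next
    case False
    \<comment> \<open>The exponent of g may be zero. Then the variables strictly below g already
      reach rank \<open>cd g\<close>, and their product is itself a relation, with exponent
      0.\<close>
    then obtain g where g: "g \<in> G" "cd g \<le> count a g + cd (flat_join {s \<in> set_mset a. s \<subset> g})"
      using less.prems by (auto simp: standard_def not_less)
    let ?S = "{s \<in> set_mset a. s \<subset> g}"
    let ?i = "count a g"
    let ?e = "{#s \<in># a. s \<noteq> g#}"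
    have a: "a = ?e + replicate_mset ?i g"
      by (rule multiset_eqI) auto
    have sz: "size a = size ?e + ?i"
      using arg_cong[OF a, of size] by simp
    have "mset_set ?S \<subseteq># ?e"
      by (rule mset_subset_eqI) (auto simp: count_mset_set' Suc_le_eq)
    then have e: "?e = mset_set ?S + (?e - mset_set ?S)"
      by simp
    have "(\<Prod>s\<in>?S. mvar s) * cg g ^ ?i \<in> I"
    proof (rule I_relation[OF _ g(1)])
      have "{s \<in> ?S. s \<subset> g} = ?S"
        by auto
      then show "cd g \<le> ?i + cd (flat_join {s \<in> ?S. s \<subset> g})"
        using g(2) by simp
    qed (use less.prems in auto)
    moreover have "var_monom (?e - mset_set ?S) \<in> carrier R"
    proof (rule carrier_xm, rule subsetI)
      fix x assume "x \<in># ?e - mset_set ?S"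
      then have "x \<in># ?e"
        by (rule in_diffD)
      then show "x \<in> G"
        using less.prems by auto
    qed
    ultimately have "(\<Prod>s\<in>?S. mvar s) * cg g ^ ?i * var_monom (?e - mset_set ?S) \<in> I"
      by (rule I_simps(4))
    also have "(\<Prod>s\<in>?S. mvar s) * cg g ^ ?i * var_monom (?e - mset_set ?S) = var_monom ?e * cg g ^ ?i"
    proof -
      have "var_monom ?e = var_monom (mset_set ?S) * var_monom (?e - mset_set ?S)"
        using arg_cong[OF e, of var_monom] unfolding var_monom_union .
      then show ?thesis
        by (simp add: prod_mvar algebra_simps)
    qed
    finally have 1: "var_monom ?e * cg g ^ ?i \<in> standard_span (size a)"
      by (rule standard_span_I)
    have "var_monom ?e * cg g ^ ?i - var_monom (?e + replicate_mset ?i g) \<in> standard_span (size ?e + ?i)"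
    proof (rule leading_power[OF g(1)])
      fix b assume b: "set_mset b \<subseteq> G" "size b = size ?e + ?i" "height b < height (?e + replicate_mset ?i g)"
      then have "height b < height a"
        using arg_cong[OF a, of height] by simp
      from less.hyps[OF this b(1)] show "var_monom b \<in> standard_span (size ?e + ?i)"
        using b(2) by simp
    qed (use less.prems in auto)
    then have "var_monom ?e * cg g ^ ?i - var_monom a \<in> standard_span (size a)"
      using arg_cong[OF a, of var_monom] sz by simp
    from standard_span_diff[OF 1 this] show ?thesis
      by simp
  qed
qed

lemma homogeneous_Sp:
  assumes "p \<in> homogeneous_polys G k"
  shows "p \<in> standard_span k"
proof -
  obtain A c where A: "finite A" "\<forall>a\<in>A. set_mset a \<subseteq> G \<and> exponent a \<in> Poly_Mapping.keys p"
    "p = (\<Sum>a\<in>A. mconst (c a) * var_monom a)"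
    using mpoly_sum_xm[OF homogeneous_carrier[OF assms]] by (elim exE conjE)
  have "size a = k" if "a \<in> A" for a
    using A(2) that assms mon_degree_expo[of a] by (simp add: homogeneous_polys_def)
  then have "mconst (c a) * var_monom a \<in> standard_span k" if "a \<in> A" for a
    using var_monom_Sp[of a] A(2) that by (intro standard_span_scale) simp
  then show ?thesis
    unfolding A(3) by (rule standard_span_sum)
qed

section \<open>Poincare duality for polynomials modulo the ideal\<close>

lemma lex_max:
  fixes f :: "'b \<Rightarrow> 'c \<Rightarrow> 'd::linorder"
  assumes "finite B" "B \<noteq> {}"
  shows "\<exists>b0\<in>B. \<forall>b\<in>B. (\<forall>t\<in>set gs. f b t = f b0 t) \<or>
     (\<exists>i<length gs. (\<forall>j<i. f b (gs ! j) = f b0 (gs ! j)) \<and> f b (gs ! i) < f b0 (gs ! i))"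
  using assms
proof (induction gs arbitrary: B)
  case Nil
  then show ?case
    by auto
next
  case (Cons t gs)
  let ?m = "Max ((\<lambda>b. f b t) ` B)"
  let ?B = "{b \<in> B. f b t = ?m}"
  have "?m \<in> (\<lambda>b. f b t) ` B"
    using Cons.prems by (intro Max_in) auto
  then obtain b1 where "b1 \<in> B" "f b1 t = ?m"
    by (metis (no_types, lifting) imageE)
  then have "finite ?B" "?B \<noteq> {}"
    using Cons.prems(1) by auto
  then have "\<exists>b0\<in>?B. \<forall>b\<in>?B. (\<forall>t\<in>set gs. f b t = f b0 t) \<or>
     (\<exists>i<length gs. (\<forall>j<i. f b (gs ! j) = f b0 (gs ! j)) \<and> f b (gs ! i) < f b0 (gs ! i))"
    by (rule Cons.IH)
  then obtain b0 where b0: "b0 \<in> ?B" and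
    lex: "\<forall>b\<in>?B. (\<forall>t\<in>set gs. f b t = f b0 t) \<or>
     (\<exists>i<length gs. (\<forall>j<i. f b (gs ! j) = f b0 (gs ! j)) \<and> f b (gs ! i) < f b0 (gs ! i))"
    by (rule bexE)
  have "(\<forall>u\<in>set (t # gs). f b u = f b0 u) \<or>
     (\<exists>i<length (t # gs). (\<forall>j<i. f b ((t # gs) ! j) =
         f b0 ((t # gs) ! j)) \<and> f b ((t # gs) ! i) < f b0 ((t # gs) ! i))"
    if b: "b \<in> B" for b
  proof (cases "f b t = ?m")
    case True
    then have bt: "b \<in> ?B" "f b t = f b0 t"
      using b b0 by auto
    from bspec[OF lex bt(1)] show ?thesis
    proof
      assume "\<exists>i<length gs. (\<forall>j<i. f b (gs ! j) = f b0 (gs ! j)) \<and> f b (gs ! i) < f b0 (gs ! i)"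
      then obtain i where i: "i < length gs" "\<forall>j<i. f b (gs ! j) = f b0 (gs ! j)" "f b (gs ! i) < f b0 (gs ! i)"
        by blast
      have "\<forall>j<Suc i. f b ((t # gs) ! j) = f b0 ((t # gs) ! j)"
        using i(2) bt(2) by (simp add: nth_Cons split: nat.split)
      then show ?thesis
        using i(1,3) by (intro disjI2 exI[of _ "Suc i"]) simp
    qed (use bt in simp)
  next
    case False
    have "f b t \<le> ?m"
      using b Cons.prems by (intro Max_ge) auto
    then have "f b t < f b0 t"
      using False b0 by auto
    then show ?thesis
      by (intro disjI2 exI[of _ 0]) simp
  qed
  then show ?case
    using b0 by blast
qed

lemma homogeneous_cm: "set_mset M \<subseteq> G \<Longrightarrow> c_monom M \<in> homogeneous_polys G (size M)"
proof (induction M)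
  case (add g M)
  have "cg g \<in> homogeneous_polys G 1"
    unfolding cg_eq by (intro homogeneous_sum homogeneous_mvar) auto
  then show ?case
    using homogeneous_mult[of "cg g" G 1 "c_monom M" "size M"] add by (simp add: c_monom_add_mset)
qed (simp add: homogeneous_1)

text \<open>For another b, a nonzero value would by \<open>triangular\<close> give b the larger
  weight where the exponents first differ, against the maximality of b0.\<close>

lemma pairing_maximal:
  assumes "finite B" "B \<noteq> {}" "\<And>b. b \<in> B \<Longrightarrow> standard b"
  obtains b0 where "b0 \<in> B" "\<And>b. b \<in> B \<Longrightarrow> b \<noteq> b0 \<Longrightarrow>
      D (var_monom b * c_monom (dual b0)) = 0"
proof -
  obtain xs where xs: "set xs = G"
    using finite_list[OF finite_G] by blast
  \<comment> \<open>Sorting by rank lists everything strictly below t before t, so agreement at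
    earlier positions gives the agreement that \<open>triangular\<close> requires.\<close>
  define gs where "gs = sort_key cd xs"
  have gs: "set gs = G" "sorted (map cd gs)"
    using xs by (simp_all add: gs_def)
  obtain b0 where b0: "b0 \<in> B" and lex: "\<And>b. b \<in> B \<Longrightarrow>
      (\<forall>t\<in>set gs. lex_weight t (count b t) = lex_weight t (count b0 t)) \<or>
     (\<exists>i<length gs. (\<forall>j<i. lex_weight (gs ! j) (count b (gs ! j)) =
         lex_weight (gs ! j) (count b0 (gs ! j))) \<and>
        lex_weight (gs ! i) (count b (gs ! i)) < lex_weight (gs ! i) (count b0 (gs ! i)))"
    using lex_max[OF assms(1,2), of gs "\<lambda>b t. lex_weight t (count b t)"] by blast
  have "D (var_monom b * c_monom (dual b0)) = 0" if b: "b \<in> B" "b \<noteq> b0" for b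
  proof (rule ccontr)
    assume nz: "D (var_monom b * c_monom (dual b0)) \<noteq> 0"
    have "\<not> (\<forall>t\<in>G. count b t = count b0 t)"
    proof
      assume "\<forall>t\<in>G. count b t = count b0 t"
      then have "count b t = count b0 t" for t
        using standard_G[OF assms(3)[OF b(1)]] standard_G[OF assms(3)[OF b0]]
        by (cases "t \<in> G") (auto, metis not_in_iff subsetD)
      then show False
        using b(2) multiset_eqI by blast
    qed
    then obtain i where i: "i < length gs" "\<And>j. j < i \<Longrightarrow>
        lex_weight (gs ! j) (count b (gs ! j)) = lex_weight (gs ! j) (count b0 (gs ! j))"
        "lex_weight (gs ! i) (count b (gs ! i)) < lex_weight (gs ! i) (count b0 (gs ! i))"
      using lex[OF b(1)] lex_weight_inj gs(1) by metis
    let ?t = "gs ! i"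
    have tG: "?t \<in> G"
      using i(1) gs(1) nth_mem by blast
    have "count b s = count b0 s" if s: "s \<in> G" "s \<subset> ?t" for s
    proof -
      obtain j where j: "j < length gs" "s = gs ! j"
        using s(1) gs(1) by (metis in_set_conv_nth)
      have "cd (gs ! j) < cd (gs ! i)"
        using cd_strict[OF s(2)] G_Lat s(1) tG j by simp
      then have "j < i"
        using sorted_nth_mono[OF gs(2), of i j] j(1) i(1) by (cases "j < i") auto
      then show ?thesis
        using lex_weight_inj[OF i(2)] j by simp
    qed
    moreover have "count b ?t \<noteq> count b0 ?t"
      using i(3) by auto
    ultimately have "lex_weight ?t (count b0 ?t) < lex_weight ?t (count b ?t)"
      using triangular[OF assms(3)[OF b(1)] assms(3)[OF b0] nz tG] by blast
    then show False
      using i(3) by simp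
  qed
  then show ?thesis
    using that b0 by blast
qed

abbreviation top_degree :: nat where
  "top_degree \<equiv> cd E - card (fac E)"

lemma standard_size_le: "standard b \<Longrightarrow> size b + size (dual b) = top_degree"
  using size_dual[of b] by simp

text \<open>In a standard expansion of p modulo \<open>I\<close>, pairing with the dual of a maximal
  monomial isolates its coefficient. The guard \<open>k \<le> top_degree\<close> makes the second
  assumption vacuous in higher degrees, so the lemma also shows that these vanish.\<close>

lemma D_nondegenerate:
  assumes "p \<in> homogeneous_polys G k" "\<And>q. k \<le> top_degree \<Longrightarrow>
      q \<in> homogeneous_polys G (top_degree - k) \<Longrightarrow> D (p * q) = 0"
  shows "p \<in> I"
proof -
  obtain A c where A: "finite A" "\<forall>b\<in>A. standard b \<and> size b =
      k" "p - (\<Sum>b\<in>A. mconst (c b) * var_monom b) \<in> I"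
    using homogeneous_Sp[OF assms(1)] unfolding standard_span_def by blast
  let ?B = "{b \<in> A. c b \<noteq> 0}"
  let ?s = "\<Sum>b\<in>A. mconst (c b) * var_monom b"
  have "?B = {}"
  proof (rule ccontr)
    assume "?B \<noteq> {}"
    then obtain b0 where b0: "b0 \<in> ?B" "\<And>b. b \<in> ?B \<Longrightarrow>
        b \<noteq> b0 \<Longrightarrow> D (var_monom b * c_monom (dual b0)) = 0"
      using pairing_maximal[of ?B] A by auto
    then have s: "standard b0" "size b0 = k" "b0 \<in> A" "c b0 \<noteq> 0"
      using A(2) by auto
    have sz: "k \<le> top_degree" "size (dual b0) = top_degree - k"
      using standard_size_le[OF s(1)] s(2) by auto
    let ?q = "c_monom (dual b0)"
    have "?q \<in> homogeneous_polys G (top_degree - k)"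
      using homogeneous_cm[OF dual_G, of b0] sz(2) by simp
    then have "D (p * ?q) = 0"
      using assms(2) sz(1) by blast
    moreover have "D ((p - ?s) * ?q) = 0"
      by (rule D_I[OF A(3) carrier_cm])
    ultimately have "D (?s * ?q) = 0"
      by (simp add: left_diff_distrib D_diff)
    also have "?s * ?q = (\<Sum>b\<in>A. mconst (c b) * (var_monom b * ?q))"
      by (simp add: sum_distrib_right mult.assoc)
    also have "D \<dots> = (\<Sum>b\<in>A. c b * D (var_monom b * ?q))"
      by (simp add: D_sum D_scale)
    also have "\<dots> = (\<Sum>b\<in>A. if b = b0 then c b * D (var_monom b * ?q) else 0)"
      using b0(2) by (intro sum.cong) auto
    also have "\<dots> = c b0 * D (var_monom b0 * ?q)"
      using s(3) A(1) by simp
    finally show False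
      using s(4) D_diagonal[OF s(1)] by simp
  qed
  then have "?s = 0"
    by (intro sum.neutral) auto
  then show ?thesis
    using A(3) by simp
qed

lemma D_top: "D (c_monom (top_mset {})) = 1" "top_mset {} = dual {#}" "size (top_mset {}) = top_degree"
proof -
  have standard: "standard {#}"
    using G_cd_pos cd_zer by (auto simp: standard_def flat_bot_def)
  show 2: "top_mset {} = dual {#}"
    unfolding top_mset_def dual_def by (rule arg_cong[of _ _ mset_of_fun]) auto
  show "D (c_monom (top_mset {})) = 1"
    using D_topm[of "{}"] G_nonzer by (auto simp: nested_def flat_bot_def)
  show "size (top_mset {}) = top_degree"
    using standard_size_le[OF standard] 2 by simp
qed

end

section \<open>The Chow ring\<close>

context polymatroid_building
begin

abbreviation A :: "(rat, 'a set rat_mpoly set) module" where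
  "A \<equiv> chow_ring E cd G"

abbreviation gr :: "nat \<Rightarrow> 'a set rat_mpoly set set" where
  "gr \<equiv> chow_grading E cd G"

abbreviation cls :: "'a set rat_mpoly \<Rightarrow> 'a set rat_mpoly set" where
  "cls p \<equiv> I +>\<^bsub>R\<^esub> p"

section \<open>Calculation with cosets\<close>

lemma cls_mem: "q \<in> cls p \<longleftrightarrow> q - p \<in> I"
proof
  assume "q - p \<in> I"
  then show "q \<in> cls p"
    unfolding a_r_coset_def r_coset_def by (auto intro!: bexI[of _ "q - p"])
qed (auto simp: a_r_coset_def r_coset_def)

lemma cls_eq_iff: "cls p = cls q \<longleftrightarrow> p - q \<in> I"
proof
  assume "cls p = cls q"
  moreover have "p \<in> cls p"
    by (simp add: cls_mem I_simps)
  ultimately show "p - q \<in> I"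
    by (simp add: cls_mem[symmetric])
next
  assume pq: "p - q \<in> I"
  have "r - p \<in> I \<longleftrightarrow> r - q \<in> I" for r
    using I_simps(3)[OF _ pq, of "r - p"] I_diff[OF _ pq, of "r - q"] by auto
  then show "cls p = cls q"
    by (auto simp: cls_mem)
qed

lemma cls_eqI: "p - q \<in> I \<Longrightarrow> cls p = cls q"
  by (simp add: cls_eq_iff)

lemma A_carrier: "carrier A = cls ` carrier R"
  by (auto simp: chow_ring_def Let_def FactRing_def A_RCOSETS_def')

lemma cls_carrier: "p \<in> carrier R \<Longrightarrow> cls p \<in> carrier A"
  by (simp add: A_carrier)

lemma A_mult: "p \<in> carrier R \<Longrightarrow> q \<in> carrier R \<Longrightarrow>
    cls p \<otimes>\<^bsub>A\<^esub> cls q = cls (p * q)"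
  using ideal.rcoset_mult_add[OF ideal_I, of p q] by (simp add: chow_ring_def Let_def FactRing_def)

lemma A_add: "p \<in> carrier R \<Longrightarrow> q \<in> carrier R \<Longrightarrow>
    cls p \<oplus>\<^bsub>A\<^esub> cls q = cls (p + q)"
  using abelian_subgroup.a_rcos_sum[of I R p q] ideal_I
  by (simp add: chow_ring_def Let_def FactRing_def ideal_def abelian_subgroupI3 ring.is_abelian_group)

lemma A_one: "\<one>\<^bsub>A\<^esub> = cls 1"
  by (simp add: chow_ring_def Let_def FactRing_def)

lemma A_zero: "\<zero>\<^bsub>A\<^esub> = cls 0"
proof -
  have "cls 0 = I"
    by (auto simp: cls_mem)
  then show ?thesis
    by (simp add: chow_ring_def Let_def FactRing_def)
qed

lemma A_smult: "p \<in> carrier R \<Longrightarrow> c \<odot>\<^bsub>A\<^esub> cls p = cls (mconst c * p)"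
  using A_mult[OF carrier_mconst, of p c] by (simp add: chow_ring_def Let_def)

lemmas A_simps = A_mult A_add A_one A_zero A_smult cls_carrier carrier_0 carrier_1 carrier_add
  carrier_mult carrier_mconst

lemma cring_A: "cring A"
proof (rule cringI)
  show "abelian_group A"
  proof (rule abelian_groupI)
    fix x assume "x \<in> carrier A"
    then obtain p where p: "p \<in> carrier R" "x = cls p"
      by (auto simp: A_carrier)
    then show "\<exists>y\<in>carrier A. y \<oplus>\<^bsub>A\<^esub> x = \<zero>\<^bsub>A\<^esub>"
      using carrier_uminus[OF p(1)] by (intro bexI[of _ "cls (- p)"]) (simp_all add: A_simps)
  qed (auto simp: A_carrier A_simps ac_simps)
  show "Group.comm_monoid A"
    by (rule comm_monoidI) (auto simp: A_carrier A_simps ac_simps)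
qed (auto simp: A_carrier A_simps distrib_right)

lemma rat_field_simps [simp]:
  "carrier rat_field = UNIV" "monoid.mult rat_field = (*)" "one rat_field = 1" "ring.add rat_field = (+)"
  by (simp_all add: ring_of_type_algebra_def)

lemma algebra_A: "algebra rat_field A"
  by (rule algebraI[OF cring_from_type_algebra cring_A])
    (auto simp: A_carrier A_simps mconst_add mconst_mult distrib_right distrib_left mult.assoc)

lemma gr_eq: "gr k = cls ` homogeneous_polys G k"
  by (simp add: chow_grading_def)

lemma cls_gr: "p \<in> homogeneous_polys G k \<Longrightarrow> cls p \<in> gr k"
  by (simp add: gr_eq)

lemma grE:
  assumes "a \<in> gr k"
  obtains p where "p \<in> homogeneous_polys G k" "p \<in> carrier R" "a = cls p"
  using assms homogeneous_carrier unfolding gr_eq by blast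

lemma submodule_gr: "submodule (gr k) rat_field A"
proof -
  interpret algebra rat_field A by (rule algebra_A)
  show ?thesis
  proof (rule submoduleI)
    show "gr k \<subseteq> carrier A"
      by (auto elim!: grE intro: cls_carrier)
    show "\<zero>\<^bsub>A\<^esub> \<in> gr k"
      unfolding A_zero by (rule cls_gr[OF homogeneous_0])
    fix x assume "x \<in> gr k"
    then obtain p where p: "p \<in> homogeneous_polys G k" "p \<in> carrier R" "x = cls p"
      by (rule grE)
    show "c \<odot>\<^bsub>A\<^esub> x \<in> gr k" for c
      using p homogeneous_scale[OF p(1)] by (simp add: cls_gr A_smult)
    have "\<ominus>\<^bsub>A\<^esub> x = cls (- p)"
      using p carrier_uminus[OF p(2)] by (intro M.minus_equality) (simp_all add: A_simps)
    then show "\<ominus>\<^bsub>A\<^esub> x \<in> gr k"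
      using homogeneous_uminus[OF p(1)] by (simp add: cls_gr)
    show "x \<oplus>\<^bsub>A\<^esub> y \<in> gr k" if y: "y \<in> gr k" for y
    proof -
      obtain q where q: "q \<in> homogeneous_polys G k" "q \<in> carrier R" "y = cls q"
        using y by (rule grE)
      then show ?thesis
        using p homogeneous_add[OF p(1) q(1)] by (simp add: cls_gr A_add)
    qed
  qed
qed

lemma sum_in_I: "(\<And>k. k \<in> K \<Longrightarrow> f k \<in> I) \<Longrightarrow> sum f K \<in> I"
  by (induction K rule: infinite_finite_induct) (auto simp: I_simps)

lemma finsum_cls:
  assumes "finite K" "\<And>k. k \<in> K \<Longrightarrow> p k \<in> carrier R"
  shows "(\<Oplus>\<^bsub>A\<^esub>k\<in>K. cls (p k)) = cls (\<Sum>k\<in>K. p k)"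
  using assms
proof (induction K)
  case (insert k K)
  interpret cring A by (rule cring_A)
  have "(\<Oplus>\<^bsub>A\<^esub>k\<in>insert k K. cls (p k)) =
      cls (p k) \<oplus>\<^bsub>A\<^esub> (\<Oplus>\<^bsub>A\<^esub>k\<in>K. cls (p k))"
    using insert by (intro finsum_insert) (auto intro: cls_carrier)
  then show ?case
    using insert by (simp add: A_add carrier_sum)
next
  case empty
  interpret cring A by (rule cring_A)
  show ?case
    by (simp add: A_zero)
qed

text \<open>A decomposition is given by homogeneous components. It is unique because components of
  congruent polynomials are congruent, the ideal being homogeneous.\<close>

lemma graded_A: "graded_algebra rat_field A gr"
  unfolding graded_algebra_def
proof (intro conjI allI ballI)
  show "algebra rat_field A"
    by (rule algebra_A)
  show "submodule (gr k) rat_field A" for k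
    by (rule submodule_gr)
  show "\<one>\<^bsub>A\<^esub> \<in> gr 0"
    using homogeneous_1 by (auto simp: A_one gr_eq)
  show "a \<otimes>\<^bsub>A\<^esub> b \<in> gr (i + j)" if "a \<in> gr i" "b \<in> gr j" for a b i j
    using that by (auto elim!: grE simp: A_mult intro!: cls_gr homogeneous_mult)
  fix a assume "a \<in> carrier A"
  then obtain p where p: "p \<in> carrier R" "a = cls p"
    by (auto simp: A_carrier)
  let ?f = "\<lambda>k. cls (hcomp k p)"
  have hc: "hcomp k p \<in> carrier R" for k
    using hcomp_homogeneous[OF p(1)] homogeneous_carrier by blast
  have nz: "{k. ?f k \<noteq> \<zero>\<^bsub>A\<^esub>} \<subseteq> mon_degree ` Poly_Mapping.keys p"
  proof
    fix k assume "k \<in> {k. ?f k \<noteq> \<zero>\<^bsub>A\<^esub>}"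
    then have "hcomp k p \<noteq> 0"
      by (auto simp: A_zero)
    then obtain m where "Poly_Mapping.lookup (hcomp k p) m \<noteq> 0"
      by (metis lookup_zero poly_mapping_eqI)
    then show "k \<in> mon_degree ` Poly_Mapping.keys p"
      by (auto simp: lookup_hcomp in_keys_iff split: if_splits)
  qed
  have fin: "finite {k. ?f k \<noteq> \<zero>\<^bsub>A\<^esub>}"
    by (rule finite_subset[OF nz]) simp
  show "\<exists>!f. (\<forall>k. f k \<in> gr k) \<and> finite {k. f k \<noteq> \<zero>\<^bsub>A\<^esub>} \<and>
      a = (\<Oplus>\<^bsub>A\<^esub>k \<in> {k. f k \<noteq> \<zero>\<^bsub>A\<^esub>}. f k)"
  proof (rule ex1I, intro conjI allI)
    show "?f k \<in> gr k" for k
      by (rule cls_gr[OF hcomp_homogeneous[OF p(1)]])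
    show "finite {k. ?f k \<noteq> \<zero>\<^bsub>A\<^esub>}"
      by (rule fin)
    let ?K = "mon_degree ` Poly_Mapping.keys p"
    \<comment> \<open>The sum over nonzero classes omits components that lie in \<open>I\<close>
      without being zero; the difference consists of these.\<close>
    have "p - (\<Sum>k | ?f k \<noteq> \<zero>\<^bsub>A\<^esub>. hcomp k p) =
        (\<Sum>k\<in>?K. hcomp k p) - (\<Sum>k | ?f k \<noteq> \<zero>\<^bsub>A\<^esub>. hcomp k p)"
      by (simp add: sum_hcomp)
    also have "\<dots> = (\<Sum>k\<in>?K - {k. ?f k \<noteq> \<zero>\<^bsub>A\<^esub>}. hcomp k p)"
      using nz by (simp add: sum_diff)
    also have "\<dots> \<in> I"
    proof -
      have "hcomp k p \<in> I" if "k \<in> ?K - {k. ?f k \<noteq> \<zero>\<^bsub>A\<^esub>}" for k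
        using that cls_eq_iff[of "hcomp k p" 0] by (simp add: A_zero)
      then show ?thesis
        by (rule sum_in_I)
    qed
    finally show "a = (\<Oplus>\<^bsub>A\<^esub>k \<in> {k. ?f k \<noteq> \<zero>\<^bsub>A\<^esub>}. ?f k)"
      using p(2) fin hc by (simp add: finsum_cls cls_eqI)
  next
    fix f assume f: "(\<forall>k. f k \<in> gr k) \<and> finite {k. f k \<noteq> \<zero>\<^bsub>A\<^esub>} \<and>
      a = (\<Oplus>\<^bsub>A\<^esub>k \<in> {k. f k \<noteq> \<zero>\<^bsub>A\<^esub>}. f k)"
    let ?K = "{k. f k \<noteq> \<zero>\<^bsub>A\<^esub>}"
    have "\<forall>k. \<exists>q\<in>homogeneous_polys G k. f k = cls q"
      using f grE by metis
    then obtain q where q: "\<And>k. q k \<in> homogeneous_polys G k" "\<And>k. f k = cls (q k)"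
      by metis
    have qc: "q k \<in> carrier R" for k
      using q(1) homogeneous_carrier by blast
    have "cls p = (\<Oplus>\<^bsub>A\<^esub>k\<in>?K. cls (q k))"
      using f p(2) q(2) by simp
    also have "\<dots> = cls (\<Sum>k\<in>?K. q k)"
      using f qc by (intro finsum_cls) auto
    finally have "p - (\<Sum>k\<in>?K. q k) \<in> I"
      by (simp add: cls_eq_iff)
    then have *: "hcomp k p - hcomp k (\<Sum>k\<in>?K. q k) \<in> I" for k
      using hcomp_I[of _ k] by (metis hcomp_diff)
    have hq: "hcomp k (\<Sum>k\<in>?K. q k) = (if k \<in> ?K then q k else 0)" for k
      using f by (simp add: hcomp_sum hcomp_of_homogeneous[OF q(1)])
    show "f = ?f"
    proof
      fix k
      show "f k = ?f k"
      proof (cases "k \<in> ?K")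
        case True
        then show ?thesis
          using *[of k] hq[of k] q(2)[of k] cls_eqI[of "hcomp k p" "q k"] by simp
      next
        case False
        then have "f k = cls 0"
          by (simp add: A_zero)
        then show ?thesis
          using *[of k] hq[of k] False cls_eqI[of "hcomp k p" 0] by simp
      qed
    qed
  qed
qed

text \<open>The choice of representative does not matter because \<open>D\<close> vanishes on
  \<open>I\<close>.\<close>

definition deg_map :: "'a set rat_mpoly set \<Rightarrow> rat" where
  "deg_map a = D (SOME p. p \<in> carrier R \<and> a = cls p)"

lemma deg_map_cls:
  assumes "p \<in> carrier R"
  shows "deg_map (cls p) = D p"
proof -
  let ?q = "SOME q. q \<in> carrier R \<and> cls p = cls q"
  have "?q \<in> carrier R \<and> cls p = cls ?q"
    by (rule someI[of _ p]) (use assms in simp)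
  then have "p - ?q \<in> I"
    by (simp add: cls_eq_iff)
  from D_I[OF this carrier_1] show ?thesis
    by (simp add: deg_map_def D_diff)
qed

lemma poincare_duality_chow_ring: "poincare_duality_algebra A gr top_degree"
  unfolding poincare_duality_algebra_def
proof (intro conjI allI impI exI[of _ deg_map] ballI)
  let ?w = "c_monom (top_mset {})"
  have w: "?w \<in> homogeneous_polys G top_degree"
    using homogeneous_cm[of "top_mset {}"] D_top(3) by (simp add: top_mset_def set_msum)
  show "graded_algebra rat_field A gr"
    by (rule graded_A)
  show "gr top_degree \<noteq> {\<zero>\<^bsub>A\<^esub>}"
  proof
    assume "gr top_degree = {\<zero>\<^bsub>A\<^esub>}"
    then have "cls ?w = cls 0"
      using cls_gr[OF w] by (simp add: A_zero)
    then have "?w \<in> I"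
      by (simp add: cls_eq_iff)
    from D_I[OF this carrier_1] show False
      using D_top(1) by simp
  qed
  show "gr k = {\<zero>\<^bsub>A\<^esub>}" if "top_degree < k" for k
  proof -
    have "cls p = cls 0" if "p \<in> homogeneous_polys G k" for p
    proof (rule cls_eqI)
      show "p - 0 \<in> I"
        using D_nondegenerate[OF that] \<open>top_degree < k\<close> by simp
    qed
    then have "gr k = (\<lambda>_. cls 0) ` homogeneous_polys G k"
      unfolding gr_eq by (rule image_cong[OF refl])
    then show ?thesis
      unfolding A_zero using image_constant[OF homogeneous_0[of G k], of "cls 0"] by (rule trans)
  qed
  have hc: "p \<in> carrier R" if "p \<in> homogeneous_polys G k" for p k
    using homogeneous_carrier[OF that] .
  show "bij_betw deg_map (gr top_degree) UNIV"
  proof (rule bij_betwI')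
    fix x y assume "x \<in> gr top_degree" "y \<in> gr top_degree"
    then obtain p q where p: "p \<in> homogeneous_polys G top_degree" "x = cls p"
      and q: "q \<in> homogeneous_polys G top_degree" "y = cls q"
      using grE by metis
    \<comment> \<open>In the complementary degree 0 there are only constants, so equality of the two
      values already makes every pairing with \<open>p - q\<close> vanish.\<close>
    have "p - q \<in> I" if eq: "D p = D q"
    proof (rule D_nondegenerate)
      show "p - q \<in> homogeneous_polys G top_degree"
        using homogeneous_add[OF p(1) homogeneous_uminus[OF q(1)]] by simp
      fix r assume "r \<in> homogeneous_polys G (top_degree - top_degree)"
      then obtain c where "r = mconst c"
        using homogeneous_degree_0[of r G] by auto
      then have "(p - q) * r = mconst c * (p - q)"
        by simp
      then show "D ((p - q) * r) = 0"
        using eq by (simp add: D_scale D_diff)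
    qed
    then have "D p = D q \<Longrightarrow> cls p = cls q"
      by (intro cls_eqI)
    moreover have "deg_map x = D p" "deg_map y = D q"
      using p q hc deg_map_cls by blast+
    ultimately show "deg_map x = deg_map y \<longleftrightarrow> x = y"
      using p(2) q(2) by metis
  next
    fix c :: rat
    have "mconst c * ?w \<in> homogeneous_polys G top_degree"
      by (rule homogeneous_scale[OF w])
    moreover from hc[OF this] have "deg_map (cls (mconst c * ?w)) = c"
      using D_top(1) by (simp add: deg_map_cls D_scale)
    ultimately show "\<exists>x\<in>gr top_degree. c = deg_map x"
      using cls_gr by metis
  qed simp
  show "deg_map (a \<oplus>\<^bsub>A\<^esub> b) =
      deg_map a + deg_map b" if "a \<in> gr top_degree" "b \<in> gr top_degree" for a b
    using that by (auto elim!: grE simp: A_add deg_map_cls D_add carrier_add)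
  show "deg_map (c \<odot>\<^bsub>A\<^esub> a) = c * deg_map a" if "a \<in> gr top_degree" for c a
    using that by (auto elim!: grE simp: A_smult deg_map_cls D_scale carrier_mult carrier_mconst)
  have nd: "p \<in> I" if "p \<in> homogeneous_polys G k" "\<forall>q\<in>homogeneous_polys G (top_degree - k).
      D (p * q) = 0" for p k
    using D_nondegenerate that by blast
  have dm: "deg_map (cls p \<otimes>\<^bsub>A\<^esub> cls q) = D (p * q)" if "p \<in> carrier R" "q \<in> carrier R" for p q
    using that by (simp add: A_mult deg_map_cls carrier_mult)
  show "a = \<zero>\<^bsub>A\<^esub>" if "k \<le> top_degree"
      and a: "a \<in> gr k" "\<forall>b\<in>gr (top_degree - k). deg_map (a \<otimes>\<^bsub>A\<^esub> b) = 0" for k a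
  proof -
    obtain p where p: "p \<in> homogeneous_polys G k" "p \<in> carrier R" "a = cls p"
      using a(1) by (rule grE)
    have "D (p * q) = 0" if q: "q \<in> homogeneous_polys G (top_degree - k)" for q
      using bspec[OF a(2) cls_gr[OF q]] dm[OF p(2) hc[OF q]] p(3) by simp
    then have "p \<in> I"
      using nd[OF p(1)] by blast
    then show ?thesis
      using p by (simp add: A_zero cls_eq_iff)
  qed
  show "b = \<zero>\<^bsub>A\<^esub>" if k: "k \<le> top_degree"
      and b: "b \<in> gr (top_degree - k)" "\<forall>a\<in>gr k. deg_map (a \<otimes>\<^bsub>A\<^esub> b) = 0" for k b
  proof -
    obtain q where q: "q \<in> homogeneous_polys G (top_degree - k)" "q \<in> carrier R" "b = cls q"
      using b(1) by (rule grE)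
    \<comment> \<open>Commutativity reduces this to the other side, applied in the complementary
      degree.\<close>
    have "D (q * p) = 0" if p: "p \<in> homogeneous_polys G k" for p
      using bspec[OF b(2) cls_gr[OF p]] dm[OF hc[OF p] q(2)] q(3) by (simp add: mult.commute)
    moreover have "top_degree - (top_degree - k) = k"
      using k by simp
    ultimately have "q \<in> I"
      using nd[OF q(1)] by simp
    then show ?thesis
      using q by (simp add: A_zero cls_eq_iff)
  qed
qed

end

theorem theorem4p7:
  fixes E :: "'a set" and cd :: "'a set \<Rightarrow> nat" and G :: "'a set set"
  assumes "polymatroid E cd"
    and "building_set E cd G"
  shows "(\<top>\<^bsub>flat_lattice E cd\<^esub> \<in> G \<longrightarrow>
            poincare_duality_algebra (chow_ring E cd G) (chow_grading E cd G)
              (cd \<top>\<^bsub>flat_lattice E cd\<^esub> - 1)) \<and>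
         poincare_duality_algebra (chow_ring E cd G) (chow_grading E cd G)
           (cd \<top>\<^bsub>flat_lattice E cd\<^esub> - card (bs_factors E cd G \<top>\<^bsub>flat_lattice E cd\<^esub>))"
proof -
  interpret polymatroid_building E cd G
    using assms by (simp add: polymatroid_building_def polymatroid_building_axioms_def)
  \<comment> \<open>If E belongs to G, it is its own only factor, so the general dimension becomes
    \<open>cd E - 1\<close>.\<close>
  show ?thesis
    unfolding top_flat_lattice using poincare_duality_chow_ring fac_self[of E] by auto
qed

end
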